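(* Let $0<\delta\le\frac12$ and $\rho=1-(1-2\delta)^{1/2}$. Let $\Phi:\mathcal H\to\mathbb R$ be globally Lipschitz with constant $L$ and such that $\exp(-\Phi)$ is $\gamma$-integrable. Assume that there are $R>0$, $\alpha_l>-\infty$ and a function $r:\mathbb R^+\to\mathbb R^+$ with $r(s)\le\frac{\rho}{2}s$ for all $s\ge R$ such that for all $x\in\mathcal H\setminus B_R(0)$ $$\inf_{z\in B_{r(\|x\|)}((1-\rho)x)}\exp\bigl(-\Phi(z)+\Phi(x)\bigr)>\exp(\alpha_l).$$ Assume moreover that one of the following holds: (1) $r(\|x\|)=r\|x\|^a$ with a constant $r>0$ and some $a\in(\frac12,1)$, and $V(x)=\|x\|^i$ with $i\in\mathbb N$ or $V(x)=\exp(v\|x\|)$ with $v>0$; or (2) $r(\|x\|)=r$ with a constant $r>0$, and $V(x)=\|x\|^i$ with $i\in\mathbb N$. Then $\mu$ is the unique invariant measure of the pCN kernel $\mathcal P$ on $\mathcal H$, and, for every $m$, $\mu_m$ is the unique invariant measure of the pCN kernel $\mathcal P_m$ on $P_m\mathcal H$. Moreover, define $$d(x,y)=1\wedge\frac{\|x-y\|}{\epsilon},\qquad \tilde d(x,y)=\sqrt{d(x,y)\,(1+V(x)+V(y))}.$$ Then for all sufficiently small $\epsilon>0$ there exists $\tilde n\in\mathbb N$ (not depending on $m$) such that $$\tilde d(\nu_1\mathcal P^{\tilde n},\nu_2\mathcal P^{\tilde n})\le\tfrac12\tilde d(\nu_1,\nu_2)$$ for all probability measures $\nu_1,\nu_2$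 on $\mathcal H$, and $$\tilde d(\nu_1\mathcal P_m^{\tilde n},\nu_2\mathcal P_m^{\tilde n})\le\tfrac12\tilde d(\nu_1,\nu_2)$$ for all $m\in\mathbb N$ and all probability measures $\nu_1,\nu_2$ on $P_m\mathcal H$.
   Context: $(\mathcal H,\langle\cdot,\cdot\rangle)$ is a separable Hilbert space with norm $\|\cdot\|$, $B_s(x)$ is the ball of radius $s$ centred at $x$, and $\gamma$ is a centred Gaussian measure on $\mathcal H$ with covariance operator $\mathcal C$. $(e_n)_{n\in\mathbb N}$ is an orthonormal basis of eigenvectors of $\mathcal C$ with eigenvalues $\lambda_n^2$, so that $\gamma$ is the law of $\sum_{i=1}^\infty\lambda_ie_i\xi_i$ with $\xi_i$ i.i.d. $\mathcal N(0,1)$. $P_m$ is the orthogonal projection onto the span of $e_1,\dots,e_m$, and $\gamma_m$ is the law of $\sum_{i=1}^m\lambda_ie_i\xi_i$. The target measures are $\mu(dx)=M\exp(-\Phi(x))\gamma(dx)$ on $\mathcal H$ and $\mu_m(dx)=M_m\exp(-\Phi(P_mx))\gamma_m(dx)$ on $P_m\mathcal H$, where $M,M_m$ are normalising constants. The pCN (preconditioned Crank–Nicolson) kernel $\mathcal P$ on $\mathcal H$ is the transition kernel of the following Markov chain: from $X_n$, draw $\xi\sim\gamma$ independently, set $p=(1-2\delta)^{1/2}X_n+\sqrt{2\delta}\,\xi=(1-\rho)X_n+\sqrt{2\delta}\,\xi$, and let $X_{n+1}=p$ with probability $\alpha(X_n,p)$ and $X_{n+1}=X_n$ otherwise, where $\alpha(x,y)=1\wedge\exp(\Phi(x)-\Phi(y))$.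 The kernel $\mathcal P_m$ on $P_m\mathcal H$ is defined in the same way with $\xi\sim\gamma_m$. For a symmetric lower semicontinuous function $\tilde d\ge0$ vanishing exactly on the diagonal, and probability measures $\nu_1,\nu_2$, $\tilde d(\nu_1,\nu_2)=\inf_{\pi}\int\tilde d(x,y)\,\pi(dx,dy)$, the infimum being over all couplings $\pi$ of $\nu_1$ and $\nu_2$. *)

theory Defs
  imports "HOL-Probability.Probability"
begin

text \<open>
  The Hilbert space is a type of sort \<open>{real_inner, polish_space}\<close>, that is, a complete separable
  real inner product space.

  Every measure carries its state space as \<open>space\<close>/\<open>sets\<close>. For \<open>\<H>\<close> this is \<open>borel\<close>; for the
  closed subspace \<open>P_m \<H>\<close> it is \<open>restrict_space borel (head_span e m)\<close>.
\<close>

subsection \<open>Gaussian measures\<close>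

text \<open>Degenerate marginals are allowed, so that the covariance need not be injective.\<close>

definition centred_gaussian :: "'a::real_inner measure \<Rightarrow> bool" where
  "centred_gaussian g \<longleftrightarrow> prob_space g \<and> sets g = sets borel \<and>
     (\<forall>h. distr g borel (\<lambda>x. x \<bullet> h) = return borel 0 \<or>
          (\<exists>\<sigma>>0. distr g borel (\<lambda>x. x \<bullet> h) = density lborel (normal_density 0 \<sigma>)))"

definition covariance_operator :: "'a::real_inner measure \<Rightarrow> ('a \<Rightarrow> 'a) \<Rightarrow> bool" where
  "covariance_operator g C \<longleftrightarrow> bounded_linear C \<and>
     (\<forall>h k. integrable g (\<lambda>x. (x \<bullet> h) * (x \<bullet> k)) \<and>
            C h \<bullet> k = (\<integral>x. (x \<bullet> h) * (x \<bullet> k) \<partial>g))"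

definition orthonormal_basis :: "(nat \<Rightarrow> 'a::real_inner) \<Rightarrow> bool" where
  "orthonormal_basis e \<longleftrightarrow>
     (\<forall>i j. e i \<bullet> e j = (if i = j then 1 else 0)) \<and> closure (span (range e)) = UNIV"

text \<open>
  The basis is indexed from \<open>0\<close>, so the first \<open>m\<close> basis vectors are \<open>e 0, \<dots>, e (m - 1)\<close>.
\<close>

definition head_span :: "(nat \<Rightarrow> 'a::real_inner) \<Rightarrow> nat \<Rightarrow> 'a set" where
  "head_span e m = span (e ` {..<m})"

definition orth_proj :: "'a::real_inner set \<Rightarrow> 'a \<Rightarrow> 'a" where
  "orth_proj S x = (THE y. y \<in> S \<and> (\<forall>z\<in>S. orthogonal (x - y) z))"

definition gaussian_head ::
  "(nat \<Rightarrow> real) \<Rightarrow> (nat \<Rightarrow> 'a::real_inner) \<Rightarrow> nat \<Rightarrow> 'a measure" where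
  "gaussian_head lam e m =
     distr (\<Pi>\<^sub>M i\<in>{..<m}. density lborel std_normal_density)
       (restrict_space borel (head_span e m)) (\<lambda>\<xi>. \<Sum>i<m. (lam i * \<xi> i) *\<^sub>R e i)"

subsection \<open>Target measure and pCN kernel\<close>

definition target :: "'a measure \<Rightarrow> ('a \<Rightarrow> real) \<Rightarrow> 'a measure" where
  "target g \<Phi> = density g (\<lambda>x. ennreal (exp (- \<Phi> x) / (\<integral>z. exp (- \<Phi> z) \<partial>g)))"

definition accept_prob :: "('a \<Rightarrow> real) \<Rightarrow> 'a \<Rightarrow> 'a \<Rightarrow> real" where
  "accept_prob \<Phi> x y = min 1 (exp (\<Phi> x - \<Phi> y))"

text \<open>
  One step from \<open>x\<close>: draw \<open>\<xi>\<close> from \<open>g\<close>, then flip a coin that decides between the proposal and \<open>x\<close>.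
  The second argument of \<open>distr\<close> only supplies the \<open>\<sigma>\<close>-algebra: the kernel lives on the same state
  space as \<open>g\<close>.
\<close>

definition pcn_kernel ::
  "real \<Rightarrow> ('a \<Rightarrow> real) \<Rightarrow> 'a::real_vector measure \<Rightarrow> 'a \<Rightarrow> 'a measure" where
  "pcn_kernel \<delta> \<Phi> g x =
     g \<bind> (\<lambda>\<xi>. let p = sqrt (1 - 2 * \<delta>) *\<^sub>R x + sqrt (2 * \<delta>) *\<^sub>R \<xi> in
       distr (measure_pmf (bernoulli_pmf (accept_prob \<Phi> x p))) g (\<lambda>b. if b then p else x))"

subsection \<open>Markov kernels acting on probability measures\<close>

definition unique_invariant :: "'a measure \<Rightarrow> ('a \<Rightarrow> 'a measure) \<Rightarrow> 'a measure \<Rightarrow> bool" where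
  "unique_invariant N K \<mu> \<longleftrightarrow>
     \<mu> \<in> space (prob_algebra N) \<and> \<mu> \<bind> K = \<mu> \<and>
     (\<forall>\<nu>\<in>space (prob_algebra N). \<nu> \<bind> K = \<nu> \<longrightarrow> \<nu> = \<mu>)"

definition kernel_steps :: "('a \<Rightarrow> 'a measure) \<Rightarrow> nat \<Rightarrow> 'a measure \<Rightarrow> 'a measure" where
  "kernel_steps K n \<nu> = ((\<lambda>\<nu>'. \<nu>' \<bind> K) ^^ n) \<nu>"

subsection \<open>Wasserstein-type distance\<close>

definition couplings :: "'a measure \<Rightarrow> 'a measure \<Rightarrow> ('a \<times> 'a) measure set" where
  "couplings \<nu>1 \<nu>2 =
     {\<pi>. sets \<pi> = sets (\<nu>1 \<Otimes>\<^sub>M \<nu>2) \<and> distr \<pi> \<nu>1 fst = \<nu>1 \<and> distr \<pi> \<nu>2 snd = \<nu>2}"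

definition transport_dist ::
  "('a \<Rightarrow> 'a \<Rightarrow> real) \<Rightarrow> 'a measure \<Rightarrow> 'a measure \<Rightarrow> ennreal" where
  "transport_dist c \<nu>1 \<nu>2 =
     (INF \<pi>\<in>couplings \<nu>1 \<nu>2. \<integral>\<^sup>+ z. ennreal (c (fst z) (snd z)) \<partial>\<pi>)"

definition trunc_dist :: "real \<Rightarrow> 'a::real_normed_vector \<Rightarrow> 'a \<Rightarrow> real" where
  "trunc_dist \<epsilon> x y = min 1 (norm (x - y) / \<epsilon>)"

definition weighted_dist ::
  "real \<Rightarrow> ('a \<Rightarrow> real) \<Rightarrow> 'a::real_normed_vector \<Rightarrow> 'a \<Rightarrow> real" where
  "weighted_dist \<epsilon> V x y = sqrt (trunc_dist \<epsilon> x y * (1 + V x + V y))"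

end

theory Submission
  imports Defs
begin

text \<open>
Two copies of the pCN chain are run with the same Gaussian draw and the same uniform variable for
accepting or rejecting. This synchronous coupling is one Markov kernel on pairs, and the whole
theorem follows from a one-step inequality for it: the cost
\<open>sqrt (f |x - y| * (1 + \<beta> V x + \<beta> V y))\<close> with \<open>f t = 1 - exp (- t / \<eta>)\<close> shrinks in mean by a
fixed factor \<open>\<kappa> < 1\<close>.

The distance part (\<open>distance_contraction\<close>). There is a ball of noises on which every state accepts
its proposal with probability at least \<open>a > 0\<close>: near the origin because \<open>\<Phi>\<close> is Lipschitz, far out by
the assumed lower bound on \<open>exp (\<Phi> x - \<Phi> z)\<close>. Hence both copies accept together with
probability at least some \<open>q > 0\<close>, whatever the two states are, and then their distance \<open>t\<close> becomes
\<open>(1 - \<rho>) t\<close>. Harm is done only when exactly one copy accepts. As \<open>min 1 \<circ> exp\<close> is 1-Lipschitz, this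
has probability at most \<open>2 L t\<close>, and it costs at most \<open>1 - f t = exp (- t / \<eta>)\<close>, whereas the gain of
a joint acceptance is at least \<open>exp (- t / \<eta>) \<rho> t / \<eta>\<close>. So for \<open>\<eta> = q \<rho> / (2 L + 1)\<close> the mean of \<open>f\<close>
never increases, and it decreases by a fixed factor while the two states stay in a bounded set.

The weight part (\<open>lyapunov_step\<close>, \<open>exists_weight_contraction\<close>). Far from the origin an accepted
proposal with small noise decreases \<open>V\<close> by a fixed factor, and large noises are too rare to spoil this,
so \<open>V\<close> satisfies a drift inequality. Either \<open>V x + V y\<close> is small and \<open>f\<close> contracts, or it
is large and the weight \<open>1 + \<beta> V x + \<beta> V y\<close> contracts; for small \<open>\<beta>\<close> the product of the two
means contracts in both cases, and the Cauchy-Schwarz inequality passes to the square root.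

For each \<open>\<epsilon> > 0\<close> the function \<open>f t\<close> is comparable with \<open>min 1 (t / \<epsilon>)\<close>, so iterating the one-step
inequality gives the contraction of the transport distance, starting from an arbitrary coupling of
\<open>\<nu>1\<close> and \<open>\<nu>2\<close>. Starting from the product of two invariant measures it gives their equality.
Invariance of the target is detailed balance, that is, the symmetry of the law of a state and its
proposal under \<open>\<gamma> \<Otimes> \<gamma>\<close>.

The constants see the noise only through lower bounds for the mass of balls and upper bounds for
exponential moments of the norm (the locale \<open>pcn\<close>). The truncated noise is the image of \<open>\<gamma>\<close> under
an orthogonal projection (\<open>gaussian_head_eq\<close>), which does not increase norms, so the constants
of \<open>\<gamma>\<close> serve for all dimensions.

What has to be known about \<open>\<gamma>\<close> is derived from its characteristic function \<open>exp (- C h \<bullet> h / 2)\<close>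
by a Cramer-Wold theorem in Hilbert space (\<open>cramer_wold\<close>): the law of its projections, the
reversibility of the proposal, the positivity of balls and the exponential moments.
\<close>

section \<open>Measures determined by their characteristic functions\<close>

lemma abs_mult_le_bound:
  fixes a b B :: real
  assumes "0 \<le> a" "a \<le> B" "\<bar>b\<bar> \<le> 1"
  shows "\<bar>a * b\<bar> \<le> B"
  using mult_mono[of a B "\<bar>b\<bar>" 1] assms by (simp add: abs_mult)

text \<open>
The indicator of a closed set \<open>A\<close> is the decreasing limit of the Lipschitz functions
\<open>max 0 (1 - k * infdist z A)\<close>, and closed sets form an intersection-stable generator.
\<close>

lemma prob_measure_eqI_lipschitz:
  fixes \<mu> \<nu> :: "'b::metric_space measure"
  assumes "prob_space \<mu>" "prob_space \<nu>" and [measurable_cong]: "sets \<mu> = sets borel" "sets \<nu> = sets borel"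
    and eq: "\<And>f C. C-lipschitz_on UNIV f \<Longrightarrow> (\<And>z. 0 \<le> f z \<and> f z \<le> 1) \<Longrightarrow>
                (\<integral>z. f z \<partial>\<mu>) = (\<integral>z. f z \<partial>\<nu> :: real)"
  shows "\<mu> = \<nu>"
proof -
  interpret \<mu>: prob_space \<mu> by fact
  interpret \<nu>: prob_space \<nu> by fact
  have sp: "space \<mu> = UNIV" "space \<nu> = UNIV"
    using sets_eq_imp_space_eq[OF assms(3)] sets_eq_imp_space_eq[OF assms(4)] by simp_all
  have closed_eq: "emeasure \<mu> A = emeasure \<nu> A" if A: "closed A" for A
  proof (cases "A = {}")
    case False
    define f where "f k z = max 0 (1 - real k * infdist z A)" for k z
    have lip: "(real k)-lipschitz_on UNIV (f k)" for k
    proof (rule lipschitz_onI)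
      fix x y
      have "\<bar>infdist x A - infdist y A\<bar> \<le> dist x y" by (rule infdist_triangle_abs)
      then have "real k * \<bar>infdist x A - infdist y A\<bar> \<le> real k * dist x y"
        by (rule mult_left_mono) simp
      moreover have "\<bar>f k x - f k y\<bar> \<le> \<bar>real k * infdist x A - real k * infdist y A\<bar>"
        unfolding f_def by (simp add: max_def abs_real_def)
      moreover have "\<bar>real k * infdist x A - real k * infdist y A\<bar> = real k * \<bar>infdist x A - infdist y A\<bar>"
        by (metis abs_mult abs_of_nat right_diff_distrib)
      ultimately show "dist (f k x) (f k y) \<le> real k * dist x y"
        by (simp add: dist_real_def)
    qed simp
    have bd: "0 \<le> f k z \<and> f k z \<le> 1" for k z
      unfolding f_def by (simp add: infdist_nonneg)
    have meas[measurable]: "f k \<in> borel_measurable borel" for k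
      by (intro borel_measurable_continuous_onI lipschitz_on_continuous_on[OF lip])
    have lim: "(\<lambda>k. f k z) \<longlonglongrightarrow> indicator A z" for z
    proof (cases "z \<in> A")
      case True
      then show ?thesis by (simp add: f_def)
    next
      case F: False
      then have pos: "infdist z A > 0"
        using A \<open>A \<noteq> {}\<close> in_closed_iff_infdist_zero[of A z] infdist_nonneg[of z A] by force
      obtain k0 :: nat where k0: "real k0 * infdist z A > 1"
        using reals_Archimedean3[OF pos] by blast
      have "f k z = 0" if "k \<ge> k0" for k
      proof -
        have "real k0 * infdist z A \<le> real k * infdist z A"
          using that pos by (intro mult_right_mono) auto
        then show ?thesis unfolding f_def using k0 by simp
      qed
      then have "eventually (\<lambda>k. f k z = indicator A z) sequentially"
        using F by (auto simp: eventually_sequentially)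
      then show ?thesis by (rule tendsto_eventually)
    qed
    have [measurable]: "A \<in> sets borel" using A by simp
    have L1: "(\<lambda>k. \<integral>z. f k z \<partial>\<mu>) \<longlonglongrightarrow> (\<integral>z. indicator A z \<partial>\<mu>)"
      by (rule integral_dominated_convergence[where w="\<lambda>_. 1"]) (simp_all add: lim bd)
    have L2: "(\<lambda>k. \<integral>z. f k z \<partial>\<nu>) \<longlonglongrightarrow> (\<integral>z. indicator A z \<partial>\<nu>)"
      by (rule integral_dominated_convergence[where w="\<lambda>_. 1"]) (simp_all add: lim bd)
    have L3: "(\<integral>z. f k z \<partial>\<mu>) = (\<integral>z. f k z \<partial>\<nu>)" for k
      using eq[OF lip bd] .
    have "(\<integral>z. indicator A z \<partial>\<mu>) = (\<integral>z. indicator A z \<partial>\<nu> :: real)"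
      using LIMSEQ_unique[OF L1 L2[folded L3]] .
    then have "measure \<mu> A = measure \<nu> A" by (simp add: sp)
    then show ?thesis by (simp add: \<mu>.emeasure_eq_measure \<nu>.emeasure_eq_measure)
  qed simp
  show ?thesis
  proof (rule measure_eqI_generator_eq[where E="Collect closed" and \<Omega>=UNIV and A="\<lambda>_. UNIV"])
    show "Int_stable (Collect closed :: 'b set set)" by (auto simp: Int_stable_def)
    show "sets \<mu> = sigma_sets UNIV (Collect closed)" "sets \<nu> = sigma_sets UNIV (Collect closed)"
      using assms(3,4) by (simp_all add: borel_eq_closed)
  qed (auto simp: closed_eq)
qed

text \<open>
A weighted version of the uniqueness theorem of Levy: after normalisation the weight \<open>w\<close> turns the
measures into probability measures under which \<open>X\<close> has the same characteristic function. The
sine is a cosine with shifted phase, which is why one family of integrals suffices.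
\<close>

lemma weighted_law_unique:
  fixes X w :: "'b \<Rightarrow> real"
  assumes pr: "prob_space M" "prob_space N"
    and meas: "X \<in> borel_measurable M" "w \<in> borel_measurable M" "X \<in> borel_measurable N" "w \<in> borel_measurable N"
    and w: "\<And>z. 0 \<le> w z \<and> w z \<le> B"
    and eq: "\<And>\<phi> s. (\<integral>z. w z * cos (\<phi> + s * X z) \<partial>M) = (\<integral>z. w z * cos (\<phi> + s * X z) \<partial>N)"
    and A[measurable]: "A \<in> sets borel"
  shows "(\<integral>z. w z * indicator A (X z) \<partial>M) = (\<integral>z. w z * indicator A (X z) \<partial>N)"
proof -
  define c where "c = (\<integral>z. w z \<partial>M)"
  have cQ: "(\<integral>z. w z \<partial>Q) = c" if "Q = M \<or> Q = N" for Q
    using that eq[of 0 0] by (auto simp: c_def)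
  have int: "integrable Q (\<lambda>z. w z * h z)"
    if "Q = M \<or> Q = N" "h \<in> borel_measurable Q" "\<And>z. \<bar>h z\<bar> \<le> 1" for Q h
    using that meas pr w abs_mult_le_bound[OF _ _ that(3)]
    by (auto intro!: finite_measure.integrable_const_bound[where B=B] AE_I2 prob_space.finite_measure)
  have int0: "integrable Q w" if "Q = M \<or> Q = N" for Q using int[OF that, of "\<lambda>_. 1"] by simp
  have c0: "c \<ge> 0" unfolding c_def using w by (intro integral_nonneg_AE) auto
  show ?thesis
  proof (cases "c = 0")
    case True
    have "(\<integral>z. w z * indicator A (X z) \<partial>Q) = 0" if Q: "Q = M \<or> Q = N" for Q
    proof -
      have "AE z in Q. w z = 0"
        using integral_nonneg_eq_0_iff_AE[OF int0[OF Q]] cQ[OF Q] True w by simp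
      then show ?thesis by (intro integral_eq_zero_AE) auto
    qed
    then show ?thesis by simp
  next
    case False
    then have c: "c > 0" using c0 by simp
    define D where "D Q = density Q (\<lambda>z. ennreal (w z / c))" for Q :: "'b measure"
    have D: "real_distribution (distr (D Q) borel X)"
        "char (distr (D Q) borel X) s = Complex ((\<integral>z. w z * cos (s * X z) \<partial>Q) / c) ((\<integral>z. w z * sin (s * X z) \<partial>Q) / c)"
        "(\<integral>y. indicator A y \<partial>distr (D Q) borel X) = (\<integral>z. w z * indicator A (X z) \<partial>Q) / c"
      if Q: "Q = M \<or> Q = N" for Q s
    proof -
      have [measurable]: "X \<in> borel_measurable Q" "w \<in> borel_measurable Q" using meas Q by auto
      have XD[measurable]: "X \<in> borel_measurable (D Q)" by (simp add: D_def)
      have I: "(\<integral>z. h z \<partial>D Q) = (\<integral>z. w z * h z \<partial>Q) / c"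
        if [measurable]: "h \<in> borel_measurable Q" for h :: "'b \<Rightarrow> real"
        unfolding D_def using w c by (subst integral_density) auto
      have "emeasure (D Q) (space (D Q)) = (\<integral>\<^sup>+z. ennreal (w z / c) \<partial>Q)"
        unfolding D_def by (simp add: emeasure_density cong: nn_integral_cong)
      also have "\<dots> = ennreal (\<integral>z. w z / c \<partial>Q)"
        using int0[OF Q] w c by (intro nn_integral_eq_integral) auto
      finally interpret P: prob_space "D Q"
        using c cQ[OF Q] by (intro prob_spaceI) simp
      show "real_distribution (distr (D Q) borel X)" by (rule P.real_distribution_distr) measurable
      have i: "integrable (D Q) (\<lambda>z. iexp (s * X z))"
        by (rule P.integrable_const_bound[where B=1]) auto
      have "char (distr (D Q) borel X) s = (\<integral>z. iexp (s * X z) \<partial>D Q)"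
        unfolding char_def by (subst integral_distr) auto
      also have "\<dots> = Complex (\<integral>z. cos (s * X z) \<partial>D Q) (\<integral>z. sin (s * X z) \<partial>D Q)"
        using i by (simp add: complex_eq_iff Re_exp Im_exp flip: integral_Re integral_Im)
      finally show "char (distr (D Q) borel X) s = Complex ((\<integral>z. w z * cos (s * X z) \<partial>Q) / c) ((\<integral>z. w z * sin (s * X z) \<partial>Q) / c)"
        by (simp add: I)
      have "(\<integral>y. indicator A y \<partial>distr (D Q) borel X) = (\<integral>z. indicator A (X z) \<partial>D Q :: real)"
        by (rule integral_distr) measurable
      then show "(\<integral>y. indicator A y \<partial>distr (D Q) borel X) = (\<integral>z. w z * indicator A (X z) \<partial>Q) / c"
        by (simp add: I)
    qed
    have sin_cos: "sin (t::real) = cos (- pi/2 + t)" for t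
      by (simp add: cos_diff)
    have "char (distr (D M) borel X) s = char (distr (D N) borel X) s" for s
      using eq[of 0 s] eq[of "- pi/2" s] by (simp add: D(2) sin_cos)
    then have "distr (D M) borel X = distr (D N) borel X"
      by (intro Levy_uniqueness D(1)) auto
    then show ?thesis using D(3)[of M] D(3)[of N] c by simp
  qed
qed

text \<open>
The one-dimensional theorem is applied to one coordinate after the other: at stage \<open>k\<close> the first \<open>k\<close>
coordinates are already tested against Borel sets and the others still against trigonometric
functions. For \<open>k = n\<close> this is equality on rectangles, which avoids an inversion formula in several
dimensions.
\<close>

lemma cylinder_cos_eq:
  fixes X :: "nat \<Rightarrow> 'b \<Rightarrow> real"
  assumes pr: "prob_space M" "prob_space N"
    and meas: "\<And>i. X i \<in> borel_measurable M" "\<And>i. X i \<in> borel_measurable N"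
    and eq: "\<And>\<phi> t. (\<integral>z. cos (\<phi> + (\<Sum>j<n. t j * X j z)) \<partial>M) = (\<integral>z. cos (\<phi> + (\<Sum>j<n. t j * X j z)) \<partial>N)"
    and "k \<le> n" and A[measurable]: "\<And>j. A j \<in> sets borel"
  shows "(\<integral>z. (\<Prod>j<k. indicator (A j) (X j z)) * cos (\<phi> + (\<Sum>j\<in>{k..<n}. t j * X j z)) \<partial>M)
       = (\<integral>z. (\<Prod>j<k. indicator (A j) (X j z)) * cos (\<phi> + (\<Sum>j\<in>{k..<n}. t j * X j z)) \<partial>N)"
  using \<open>k \<le> n\<close>
proof (induction k arbitrary: \<phi> t)
  case 0
  then show ?case using eq[of \<phi> t] by (simp add: atLeast0LessThan)
next
  case (Suc k)
  have kn: "k < n" "k \<le> n" using Suc by auto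
  define G where "G z = (\<Prod>j<k. indicator (A j) (X j z) :: real)" for z
  define S where "S t z = (\<Sum>j\<in>{Suc k..<n}. t j * X j z)" for t z
  have G01: "0 \<le> G z \<and> G z \<le> 1" for z
    unfolding G_def by (auto intro!: prod_nonneg prod_le_1)
  have gm: "G \<in> borel_measurable Q" "S t \<in> borel_measurable Q" "X k \<in> borel_measurable Q" if "Q = M \<or> Q = N" for Q t
  proof -
    have [measurable]: "X i \<in> borel_measurable Q" for i using meas that by auto
    show "G \<in> borel_measurable Q" "S t \<in> borel_measurable Q" "X k \<in> borel_measurable Q"
      unfolding G_def S_def by measurable
  qed
  have IH: "(\<integral>z. G z * cos (\<phi> + (s * X k z + S t z)) \<partial>M) = (\<integral>z. G z * cos (\<phi> + (s * X k z + S t z)) \<partial>N)" for \<phi> s t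
    using Suc.IH[OF kn(2), of \<phi> "t(k := s)"] kn
    by (simp add: G_def S_def sum.atLeast_Suc_lessThan)
  have int: "integrable Q (\<lambda>z. G z * h z)"
    if "Q = M \<or> Q = N" "h \<in> borel_measurable Q" "\<And>z. \<bar>h z\<bar> \<le> 1" for Q h
    using that gm[OF that(1)] pr abs_mult_le_bound[OF _ _ that(3)] G01
    by (auto intro!: finite_measure.integrable_const_bound[where B=1] AE_I2 prob_space.finite_measure)
  have trig: "(1 + cos a) * cos b = cos b + (cos (b + a) + cos (b - a)) / 2" for a b :: real
    by (simp add: cos_add cos_diff algebra_simps)
  \<comment> \<open>The weight \<open>1 + cos\<close> is nonnegative, and its products with \<open>cos\<close> are again covered by the induction hypothesis.\<close>
  have key: "(\<integral>z. (G z * (1 + cos (\<phi> + S t z))) * indicator (A k) (X k z) \<partial>M)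
           = (\<integral>z. (G z * (1 + cos (\<phi> + S t z))) * indicator (A k) (X k z) \<partial>N)" for \<phi> t
  proof (rule weighted_law_unique[where B=2, OF pr])
    show "0 \<le> G z * (1 + cos (\<phi> + S t z)) \<and> G z * (1 + cos (\<phi> + S t z)) \<le> 2" for z
    proof -
      have "0 \<le> 1 + cos (\<phi> + S t z)" "1 + cos (\<phi> + S t z) \<le> 2"
        using cos_ge_minus_one[of "\<phi> + S t z"] cos_le_one[of "\<phi> + S t z"] by linarith+
      then show ?thesis using G01[of z] mult_mono[of "G z" 1 "1 + cos (\<phi> + S t z)" 2] by auto
    qed
    fix \<psi> s
    have expand: "(\<integral>z. G z * (1 + cos (\<phi> + S t z)) * cos (\<psi> + s * X k z) \<partial>Q)
       = (\<integral>z. G z * cos (\<psi> + (s * X k z + S (\<lambda>_. 0) z)) \<partial>Q)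
       + ((\<integral>z. G z * cos ((\<psi> + \<phi>) + (s * X k z + S t z)) \<partial>Q)
       + (\<integral>z. G z * cos ((\<psi> - \<phi>) + (s * X k z + S (\<lambda>j. - t j) z)) \<partial>Q)) / 2"
      if Q: "Q = M \<or> Q = N" for Q
    proof -
      note [measurable] = gm[OF Q]
      have "G z * (1 + cos (\<phi> + S t z)) * cos (\<psi> + s * X k z)
         = G z * cos (\<psi> + (s * X k z + S (\<lambda>_. 0) z))
         + (G z * cos ((\<psi> + \<phi>) + (s * X k z + S t z))
         + G z * cos ((\<psi> - \<phi>) + (s * X k z + S (\<lambda>j. - t j) z))) / 2" for z
      proof -
        have a: "S (\<lambda>_. 0) z = 0" "S (\<lambda>j. - t j) z = - S t z" by (simp_all add: S_def sum_negf)
        have b: "(\<psi> + \<phi>) + (s * X k z + S t z) = (\<psi> + s * X k z) + (\<phi> + S t z)"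
          "(\<psi> - \<phi>) + (s * X k z + - S t z) = (\<psi> + s * X k z) - (\<phi> + S t z)" by auto
        have "G z * (1 + cos (\<phi> + S t z)) * cos (\<psi> + s * X k z)
          = G z * ((1 + cos (\<phi> + S t z)) * cos (\<psi> + s * X k z))" by simp
        also have "\<dots> = G z * (cos (\<psi> + s * X k z) + (cos ((\<psi> + s * X k z) + (\<phi> + S t z)) + cos ((\<psi> + s * X k z) - (\<phi> + S t z))) / 2)"
          by (simp only: trig)
        finally show ?thesis unfolding a b by (simp add: algebra_simps)
      qed
      then show ?thesis by (simp add: int[OF Q])
    qed
    show "(\<integral>z. G z * (1 + cos (\<phi> + S t z)) * cos (\<psi> + s * X k z) \<partial>M)
       = (\<integral>z. G z * (1 + cos (\<phi> + S t z)) * cos (\<psi> + s * X k z) \<partial>N)"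
      using expand[of M] expand[of N] IH by simp
  qed (use gm A in \<open>auto intro!: borel_measurable_times borel_measurable_add borel_measurable_cos\<close>)
  have base: "(\<integral>z. G z * indicator (A k) (X k z) \<partial>M) = (\<integral>z. G z * indicator (A k) (X k z) \<partial>N)"
    using key[of "pi/2" "\<lambda>_. 0"] by (simp add: S_def)
  have split: "(\<integral>z. (G z * (1 + cos (\<phi> + S t z))) * indicator (A k) (X k z) \<partial>Q)
      = (\<integral>z. G z * indicator (A k) (X k z) \<partial>Q) + (\<integral>z. G z * indicator (A k) (X k z) * cos (\<phi> + S t z) \<partial>Q)"
    if Q: "Q = M \<or> Q = N" for Q
  proof -
    note [measurable] = gm[OF Q]
    have "integrable Q (\<lambda>z. G z * indicator (A k) (X k z))"
      by (rule int[OF Q]) (simp_all add: indicator_def)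
    moreover have "integrable Q (\<lambda>z. G z * (indicator (A k) (X k z) * cos (\<phi> + S t z)))"
      by (rule int[OF Q]) (simp_all add: indicator_def)
    ultimately show ?thesis
      by (subst Bochner_Integration.integral_add[symmetric]) (simp_all add: algebra_simps)
  qed
  have "(\<integral>z. G z * indicator (A k) (X k z) * cos (\<phi> + S t z) \<partial>M)
      = (\<integral>z. G z * indicator (A k) (X k z) * cos (\<phi> + S t z) \<partial>N)"
    using key[of \<phi> t] base split[OF disjI1[OF refl]] split[OF disjI2[OF refl]] by linarith
  then show ?case
    by (simp add: G_def S_def)
qed

lemma cramer_wold_finite:
  fixes \<mu> \<nu> :: "'b::real_inner measure" and b :: "nat \<Rightarrow> 'b"
  assumes "prob_space \<mu>" "prob_space \<nu>" "sets \<mu> = sets borel" "sets \<nu> = sets borel"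
    and eq: "\<And>h \<theta>. (\<integral>z. cos (\<theta> + z \<bullet> h) \<partial>\<mu>) = (\<integral>z. cos (\<theta> + z \<bullet> h) \<partial>\<nu>)"
  shows "distr \<mu> (PiM {..<n} (\<lambda>_. borel)) (\<lambda>z. \<lambda>i\<in>{..<n}. z \<bullet> b i)
       = distr \<nu> (PiM {..<n} (\<lambda>_. borel)) (\<lambda>z. \<lambda>i\<in>{..<n}. z \<bullet> b i)"
    (is "distr \<mu> ?P ?f = distr \<nu> ?P ?f")
proof (rule measure_eqI_PiM_finite[where I="{..<n}" and M="\<lambda>_. borel" and A="\<lambda>_::nat. {..<n} \<rightarrow>\<^sub>E UNIV"])
  interpret \<mu>: prob_space \<mu> by fact
  interpret \<nu>: prob_space \<nu> by fact
  note sp = sets_eq_imp_space_eq[OF assms(3), simplified] sets_eq_imp_space_eq[OF assms(4), simplified]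
  have inner_meas[measurable]: "(\<lambda>z. z \<bullet> h) \<in> borel_measurable \<mu>" "(\<lambda>z. z \<bullet> h) \<in> borel_measurable \<nu>" for h
    unfolding measurable_cong_sets[OF assms(3) refl] measurable_cong_sets[OF assms(4) refl]
    by (auto intro!: borel_measurable_continuous_onI continuous_intros)
  have f: "?f \<in> \<mu> \<rightarrow>\<^sub>M ?P" "?f \<in> \<nu> \<rightarrow>\<^sub>M ?P" by measurable
  interpret D: prob_space "distr \<mu> ?P ?f" by (rule \<mu>.prob_space_distr[OF f(1)])
  show "finite {..<n}" "sets (distr \<mu> ?P ?f) = sets ?P" "sets (distr \<nu> ?P ?f) = sets ?P" by auto
  show "range (\<lambda>_::nat. {..<n} \<rightarrow>\<^sub>E UNIV) \<subseteq> prod_algebra {..<n} (\<lambda>_. borel)"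
    by (auto intro!: prod_algebraI_finite)
  show "(\<Union>i::nat. {..<n} \<rightarrow>\<^sub>E UNIV) = space ?P" by (simp add: space_PiM)
  show "emeasure (distr \<mu> ?P ?f) ({..<n} \<rightarrow>\<^sub>E UNIV) \<noteq> \<infinity>" by simp
  fix A :: "nat \<Rightarrow> real set" assume A: "\<And>i. i \<in> {..<n} \<Longrightarrow> A i \<in> sets borel"
  define B where "B i = (if i < n then A i else UNIV)" for i
  have B[measurable]: "B i \<in> sets borel" for i using A by (simp add: B_def)
  have AB: "(\<Pi>\<^sub>E i\<in>{..<n}. A i) = (\<Pi>\<^sub>E i\<in>{..<n}. B i)" by (auto simp: B_def PiE_def Pi_def)
  have meas: "(\<Pi>\<^sub>E i\<in>{..<n}. B i) \<in> sets ?P" by (intro sets_PiM_I_finite) auto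
  define E where "E = {z. \<forall>i<n. z \<bullet> b i \<in> B i}"
  have E\<mu>: "E \<in> sets \<mu>" and E\<nu>: "E \<in> sets \<nu>"
  proof -
    have "{z \<in> space \<mu>. \<forall>i\<in>{..<n}. z \<bullet> b i \<in> B i} \<in> sets \<mu>" by measurable
    then show "E \<in> sets \<mu>" by (simp add: E_def sp Ball_def)
    have "{z \<in> space \<nu>. \<forall>i\<in>{..<n}. z \<bullet> b i \<in> B i} \<in> sets \<nu>" by measurable
    then show "E \<in> sets \<nu>" by (simp add: E_def sp Ball_def)
  qed
  have ind: "(\<Prod>j<n. indicator (B j) (z \<bullet> b j)) = (indicator E z :: real)" for z
  proof (cases "z \<in> E")
    case True then show ?thesis by (simp add: E_def)
  next
    case False
    then obtain j where "j < n" "z \<bullet> b j \<notin> B j" by (auto simp: E_def)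
    then show ?thesis using False by (intro trans[OF prod_zero]) (auto intro!: bexI[of _ j])
  qed
  have "(\<integral>z. (\<Prod>j<n. indicator (B j) (z \<bullet> b j)) * cos (0 + (\<Sum>j\<in>{n..<n}. 0 * (z \<bullet> b j))) \<partial>\<mu>)
      = (\<integral>z. (\<Prod>j<n. indicator (B j) (z \<bullet> b j)) * cos (0 + (\<Sum>j\<in>{n..<n}. 0 * (z \<bullet> b j))) \<partial>\<nu>)"
  proof (rule cylinder_cos_eq[OF assms(1,2)])
    fix \<theta> :: real and t
    have "(\<Sum>j<n. t j * (z \<bullet> b j)) = z \<bullet> (\<Sum>j<n. t j *\<^sub>R b j)" for z
      by (simp add: inner_sum_right)
    then show "(\<integral>z. cos (\<theta> + (\<Sum>j<n. t j * (z \<bullet> b j))) \<partial>\<mu>) = (\<integral>z. cos (\<theta> + (\<Sum>j<n. t j * (z \<bullet> b j))) \<partial>\<nu>)"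
      using eq by simp
  qed auto
  then have "measure \<mu> E = measure \<nu> E"
    using E\<mu> E\<nu> by (simp add: ind)
  moreover have "?f -` (\<Pi>\<^sub>E i\<in>{..<n}. B i) = E"
    by (auto simp: E_def PiE_def Pi_def)
  ultimately show "emeasure (distr \<mu> ?P ?f) (\<Pi>\<^sub>E i\<in>{..<n}. A i) = emeasure (distr \<nu> ?P ?f) (\<Pi>\<^sub>E i\<in>{..<n}. A i)"
    unfolding AB using meas f
    by (simp add: emeasure_distr \<mu>.emeasure_eq_measure \<nu>.emeasure_eq_measure sp)
qed

text \<open>
The finite-rank maps \<open>z \<mapsto> (\<Sum>i<k n. (z \<bullet> b i) *\<^sub>R b i)\<close> are functions of finitely many coordinates, so
the laws agree on \<open>f\<close> composed with them; dominated convergence then removes the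
truncation. The index map \<open>k\<close> serves for pair spaces, where only every second partial sum is convenient.
\<close>

theorem cramer_wold:
  fixes \<mu> \<nu> :: "'b::{real_inner, second_countable_topology} measure" and b :: "nat \<Rightarrow> 'b" and k :: "nat \<Rightarrow> nat"
  assumes pr: "prob_space \<mu>" "prob_space \<nu>" and se: "sets \<mu> = sets borel" "sets \<nu> = sets borel"
    and cf: "\<And>h. (\<integral>z. iexp (z \<bullet> h) \<partial>\<mu>) = (\<integral>z. iexp (z \<bullet> h) \<partial>\<nu>)"
    and lim: "\<And>z. (\<lambda>n. \<Sum>i<k n. (z \<bullet> b i) *\<^sub>R b i) \<longlonglongrightarrow> z"
  shows "\<mu> = \<nu>"
proof (rule prob_measure_eqI_lipschitz[OF pr se])
  interpret \<mu>: prob_space \<mu> by fact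
  interpret \<nu>: prob_space \<nu> by fact
  have inner_meas[measurable]: "(\<lambda>z. z \<bullet> h) \<in> borel_measurable \<mu>" "(\<lambda>z. z \<bullet> h) \<in> borel_measurable \<nu>" for h
    unfolding measurable_cong_sets[OF se(1) refl] measurable_cong_sets[OF se(2) refl]
    by (auto intro!: borel_measurable_continuous_onI continuous_intros)
  have cos_eq: "(\<integral>z. cos (\<theta> + z \<bullet> h) \<partial>\<mu>) = (\<integral>z. cos (\<theta> + z \<bullet> h) \<partial>\<nu>)" for \<theta> h
  proof -
    have r: "cos (\<theta> + x) = Re (iexp \<theta> * iexp x)" for x
      by (simp add: Re_exp Im_exp cos_add)
    have "integrable \<mu> (\<lambda>z. iexp (z \<bullet> h))" by (rule \<mu>.integrable_const_bound[where B=1]) auto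
    then have "(\<integral>z. cos (\<theta> + z \<bullet> h) \<partial>\<mu>) = Re (iexp \<theta> * (\<integral>z. iexp (z \<bullet> h) \<partial>\<mu>))"
      unfolding r by (subst integral_Re) auto
    moreover have "integrable \<nu> (\<lambda>z. iexp (z \<bullet> h))" by (rule \<nu>.integrable_const_bound[where B=1]) auto
    then have "(\<integral>z. cos (\<theta> + z \<bullet> h) \<partial>\<nu>) = Re (iexp \<theta> * (\<integral>z. iexp (z \<bullet> h) \<partial>\<nu>))"
      unfolding r by (subst integral_Re) auto
    ultimately show ?thesis using cf by simp
  qed
  fix f :: "'b \<Rightarrow> real" and c assume lip: "c-lipschitz_on UNIV f" and bd: "\<And>z. 0 \<le> f z \<and> f z \<le> 1"
  have cont: "continuous_on UNIV f" by (rule lipschitz_on_continuous_on[OF lip])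
  have fm[measurable]: "f \<in> borel_measurable borel" by (rule borel_measurable_continuous_onI[OF cont])
  define T where "T n z = (\<Sum>i<k n. (z \<bullet> b i) *\<^sub>R b i)" for n z
  have fT: "(\<lambda>n. f (T n z)) \<longlonglongrightarrow> f z" for z
    using lim[of z] cont unfolding T_def continuous_on_eq_continuous_at[OF open_UNIV]
    by (auto intro: isCont_tendsto_compose)
  have [measurable]: "T n \<in> \<mu> \<rightarrow>\<^sub>M borel" "T n \<in> \<nu> \<rightarrow>\<^sub>M borel" for n
    unfolding T_def by measurable
  have eqT: "(\<integral>z. f (T n z) \<partial>\<mu>) = (\<integral>z. f (T n z) \<partial>\<nu>)" for n
  proof -
    let ?P = "PiM {..<k n} (\<lambda>_. borel :: real measure)"
    let ?f = "\<lambda>z. \<lambda>i\<in>{..<k n}. z \<bullet> b i"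
    have m: "?f \<in> \<mu> \<rightarrow>\<^sub>M ?P" "?f \<in> \<nu> \<rightarrow>\<^sub>M ?P" by measurable
    have g[measurable]: "(\<lambda>y. f (\<Sum>i<k n. y i *\<^sub>R b i)) \<in> borel_measurable ?P" by measurable
    have "(\<integral>z. f (T n z) \<partial>\<mu>) = (\<integral>y. f (\<Sum>i<k n. y i *\<^sub>R b i) \<partial>distr \<mu> ?P ?f)"
      by (subst integral_distr[OF m(1) g]) (simp add: T_def)
    also have "\<dots> = (\<integral>y. f (\<Sum>i<k n. y i *\<^sub>R b i) \<partial>distr \<nu> ?P ?f)"
      by (simp only: cramer_wold_finite[OF pr se cos_eq])
    also have "\<dots> = (\<integral>z. f (T n z) \<partial>\<nu>)"
      by (subst integral_distr[OF m(2) g]) (simp add: T_def)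
    finally show ?thesis .
  qed
  have fm2[measurable]: "f \<in> borel_measurable \<mu>" "f \<in> borel_measurable \<nu>"
    unfolding measurable_cong_sets[OF se(1) refl] measurable_cong_sets[OF se(2) refl] by (rule fm)+
  have L1: "(\<lambda>n. \<integral>z. f (T n z) \<partial>\<mu>) \<longlonglongrightarrow> (\<integral>z. f z \<partial>\<mu>)"
    by (rule integral_dominated_convergence[where w="\<lambda>_. 1"]) (simp_all add: fT bd)
  have L2: "(\<lambda>n. \<integral>z. f (T n z) \<partial>\<nu>) \<longlonglongrightarrow> (\<integral>z. f z \<partial>\<nu>)"
    by (rule integral_dominated_convergence[where w="\<lambda>_. 1"]) (simp_all add: fT bd)
  show "(\<integral>z. f z \<partial>\<mu>) = (\<integral>z. f z \<partial>\<nu>)"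
    using LIMSEQ_unique[OF L1 L2[folded eqT]] .
qed

section \<open>Orthonormal bases\<close>

definition basis_proj :: "(nat \<Rightarrow> 'a::real_inner) \<Rightarrow> nat \<Rightarrow> 'a \<Rightarrow> 'a" where
  "basis_proj e m x = (\<Sum>i<m. (x \<bullet> e i) *\<^sub>R e i)"

lemma linear_basis_proj: "linear (basis_proj e m)"
  unfolding basis_proj_def
  by (auto intro!: linearI simp: inner_add_left scaleR_add_left sum.distrib scaleR_sum_right)

lemma continuous_basis_proj: "continuous_on UNIV (basis_proj e m)"
  unfolding basis_proj_def by (intro continuous_intros)

lemma head_span_mono: "m \<le> n \<Longrightarrow> head_span e m \<subseteq> head_span e n"
  unfolding head_span_def by (intro span_mono image_mono) auto

text \<open>
The two copies of the basis are interleaved, so that a partial sum of even length is a pair of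
partial sums.
\<close>

definition pair_basis :: "(nat \<Rightarrow> 'a::real_inner) \<Rightarrow> nat \<Rightarrow> 'a \<times> 'a" where
  "pair_basis e i = (if even i then (e (i div 2), 0) else (0, e (i div 2)))"

context
  fixes e :: "nat \<Rightarrow> 'a::real_inner"
  assumes onb: "orthonormal_basis e"
begin

lemma ortho: "e i \<bullet> e j = (if i = j then 1 else 0)"
  using onb by (simp add: orthonormal_basis_def)

lemma basis_proj_inner: "j < m \<Longrightarrow> basis_proj e m x \<bullet> e j = x \<bullet> e j"
  by (simp add: basis_proj_def inner_sum_left ortho if_distrib cong: if_cong)

lemma norm_basis_proj: "(norm (basis_proj e m x))\<^sup>2 = (\<Sum>i<m. (x \<bullet> e i)\<^sup>2)"
  unfolding power2_norm_eq_inner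
  by (subst (2) basis_proj_def)
     (simp add: inner_sum_right basis_proj_inner power2_eq_square)

lemma basis_proj_orthogonal:
  assumes "y \<in> head_span e m" shows "(x - basis_proj e m x) \<bullet> y = 0"
  using assms unfolding head_span_def
proof (induction rule: span_induct_alt)
  case base then show ?case by simp
next
  case (step c v y)
  then obtain i where "i < m" "v = e i" by auto
  then show ?case using step basis_proj_inner[of i m x]
    by (simp add: inner_add_right inner_diff_left)
qed

lemma basis_proj_in_head_span: "basis_proj e m x \<in> head_span e m"
  unfolding basis_proj_def head_span_def by (intro span_sum span_scale span_base) auto

lemma basis_proj_of_head_span: "y \<in> head_span e m \<Longrightarrow> basis_proj e m y = y"
proof -
  assume y: "y \<in> head_span e m"
  have "y - basis_proj e m y \<in> head_span e m"
    using y basis_proj_in_head_span[of m y] unfolding head_span_def by (rule span_diff)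
  then have "(y - basis_proj e m y) \<bullet> (y - basis_proj e m y) = 0"
    by (rule basis_proj_orthogonal)
  then show ?thesis by simp
qed

lemma norm_basis_proj_le: "norm (basis_proj e m x) \<le> norm x"
proof -
  have o: "(x - basis_proj e m x) \<bullet> basis_proj e m x = 0"
    by (rule basis_proj_orthogonal[OF basis_proj_in_head_span])
  have "(norm (basis_proj e m x))\<^sup>2 \<le> (norm (x - basis_proj e m x))\<^sup>2 + (norm (basis_proj e m x))\<^sup>2"
    by simp
  also have "\<dots> = (norm x)\<^sup>2"
    using norm_add_Pythagorean[of "x - basis_proj e m x" "basis_proj e m x"] o
    by (simp add: orthogonal_def)
  finally show ?thesis by (simp add: power2_le_iff_abs_le)
qed

text \<open>
A vector of the dense span lies in some \<open>head_span e m\<close> and is fixed by all later projections; these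
do not increase norms, so they move a nearby \<open>x\<close> by at most twice the distance.
\<close>

lemma basis_proj_tendsto: "(\<lambda>m. basis_proj e m x) \<longlonglongrightarrow> x"
proof (rule LIMSEQ_I)
  fix \<epsilon> :: real assume "\<epsilon> > 0"
  have "x \<in> closure (span (range e))" using onb by (simp add: orthonormal_basis_def)
  then obtain y where y: "y \<in> span (range e)" "dist y x < \<epsilon>/2"
    using \<open>\<epsilon> > 0\<close> by (meson closure_approachable half_gt_zero)
  have "\<exists>m. y \<in> head_span e m"
    using y(1)
  proof (induction rule: span_induct_alt)
    case base then show ?case by (auto simp: head_span_def intro: span_zero)
  next
    case (step c v y)
    then obtain i m where i: "v = e i" and m: "y \<in> head_span e m" by auto
    have "e i \<in> head_span e (max m (Suc i))" unfolding head_span_def by (intro span_base) auto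
    moreover have "y \<in> head_span e (max m (Suc i))"
      using m head_span_mono[of m "max m (Suc i)" e] by auto
    ultimately show ?case unfolding i head_span_def by (intro exI span_add span_scale)
  qed
  then obtain m where m: "y \<in> head_span e m" by blast
  have "norm (basis_proj e n x - x) < \<epsilon>" if "n \<ge> m" for n
  proof -
    have "y \<in> head_span e n" using m head_span_mono[OF that, of e] by auto
    then have h: "basis_proj e n x - x = basis_proj e n (x - y) - (x - y)"
      using linear_diff[OF linear_basis_proj, of e n x y] basis_proj_of_head_span[of y n] by simp
    have "norm (basis_proj e n x - x) \<le> norm (x - y) + norm (x - y)"
      unfolding h using norm_basis_proj_le[of n "x - y"] norm_triangle_ineq4[of "basis_proj e n (x - y)" "x - y"] by linarith
    also have "\<dots> < \<epsilon>" using y(2) by (simp add: dist_norm norm_minus_commute)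
    finally show ?thesis .
  qed
  then show "\<exists>no. \<forall>n\<ge>no. norm (basis_proj e n x - x) < \<epsilon>" by blast
qed

lemma head_span_eq_fixed: "head_span e m = {x. basis_proj e m x = x}"
  using basis_proj_of_head_span basis_proj_in_head_span by (auto, metis)

lemma closed_head_span: "closed (head_span e m)"
  unfolding head_span_eq_fixed by (intro closed_Collect_eq continuous_basis_proj continuous_intros)

lemma orth_proj_head_span: "x \<in> head_span e m \<Longrightarrow> orth_proj (head_span e m) x = x"
  unfolding orth_proj_def
proof (rule the_equality)
  fix y assume x: "x \<in> head_span e m"
    and y: "y \<in> head_span e m \<and> (\<forall>z\<in>head_span e m. orthogonal (x - y) z)"
  then have "x - y \<in> head_span e m" unfolding head_span_def by (auto intro: span_diff)
  then have "orthogonal (x - y) (x - y)" using y by blast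
  then show "y = x" by (simp add: orthogonal_def)
qed (simp add: orthogonal_def)

lemma pair_basis_tendsto: "(\<lambda>n. \<Sum>i<2*n. (z \<bullet> pair_basis e i) *\<^sub>R pair_basis e i) \<longlonglongrightarrow> z"
proof -
  have "(\<Sum>i<2*n. (z \<bullet> pair_basis e i) *\<^sub>R pair_basis e i) = (basis_proj e n (fst z), basis_proj e n (snd z))" for n
  proof (induction n)
    case (Suc n)
    have "(\<Sum>i<2 * Suc n. (z \<bullet> pair_basis e i) *\<^sub>R pair_basis e i)
      = (\<Sum>i<2 * n. (z \<bullet> pair_basis e i) *\<^sub>R pair_basis e i)
        + (z \<bullet> pair_basis e (2*n)) *\<^sub>R pair_basis e (2*n) + (z \<bullet> pair_basis e (Suc (2*n))) *\<^sub>R pair_basis e (Suc (2*n))"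
      by simp
    then show ?case unfolding Suc by (simp add: pair_basis_def basis_proj_def inner_prod_def)
  qed (simp add: basis_proj_def zero_prod_def)
  moreover have "(\<lambda>n. (basis_proj e n (fst z), basis_proj e n (snd z))) \<longlonglongrightarrow> (fst z, snd z)"
    by (intro tendsto_Pair basis_proj_tendsto)
  ultimately show ?thesis by simp
qed

end

section \<open>Gaussian measures on a Hilbert space\<close>

text \<open>
Multiplying the standard normal density by \<open>exp (- b t\<^sup>2)\<close> gives a multiple of another normal density. The
case \<open>b > 0\<close> bounds the trace of the covariance below, the case \<open>b < 0\<close> gives the moments.
\<close>

lemma nn_integral_exp_square_std_normal:
  assumes b: "1 + 2 * b > 0"
  shows "(\<integral>\<^sup>+t. ennreal (exp (- b * t\<^sup>2)) \<partial>density lborel std_normal_density) = ennreal (1 / sqrt (1 + 2 * b))"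
proof -
  define \<sigma> where "\<sigma> = 1 / sqrt (1 + 2 * b)"
  have \<sigma>: "\<sigma> > 0" "\<sigma>\<^sup>2 = 1 / (1 + 2 * b)" using b by (auto simp: \<sigma>_def power_divide)
  have "std_normal_density t * exp (- b * t\<^sup>2) = \<sigma> * normal_density 0 \<sigma> t" for t
  proof -
    have e: "exp (- (t\<^sup>2) / 2) * exp (- b * t\<^sup>2) = exp (- (t\<^sup>2) / (2 * \<sigma>\<^sup>2))"
      using b by (simp add: \<sigma>(2) flip: exp_add) (simp add: field_simps)
    have s: "sqrt (2 * pi * \<sigma>\<^sup>2) = sqrt (2 * pi) * \<sigma>"
      using \<sigma>(1) by (simp add: real_sqrt_mult)
    have "std_normal_density t * exp (- b * t\<^sup>2) = 1 / sqrt (2 * pi) * (exp (- (t\<^sup>2) / 2) * exp (- b * t\<^sup>2))"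
      by (simp add: std_normal_density_def)
    also have "\<dots> = \<sigma> * normal_density 0 \<sigma> t"
      unfolding e normal_density_def s using \<sigma>(1) by simp
    finally show ?thesis .
  qed
  then have "(\<integral>\<^sup>+t. ennreal (exp (- b * t\<^sup>2)) \<partial>density lborel std_normal_density)
     = (\<integral>\<^sup>+t. ennreal \<sigma> * ennreal (normal_density 0 \<sigma> t) \<partial>lborel)"
    using \<sigma> by (subst nn_integral_density) (auto simp flip: ennreal_mult)
  also have "\<dots> = ennreal \<sigma> * (\<integral>\<^sup>+t. ennreal (normal_density 0 \<sigma> t) \<partial>lborel)"
    by (rule nn_integral_cmult) simp
  also have "(\<integral>\<^sup>+t. ennreal (normal_density 0 \<sigma> t) \<partial>lborel) = 1"
    using prob_space.emeasure_space_1[OF prob_space_normal_density[OF \<sigma>(1), of 0]]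
    by (simp add: emeasure_density)
  finally show ?thesis by (simp add: \<sigma>_def)
qed

lemma prob_space_std_normal: "prob_space (density lborel std_normal_density)"
  using prob_space_normal_density[of 1 0] by simp

lemma basis_proj_measurable[measurable]: "basis_proj e m \<in> borel \<rightarrow>\<^sub>M borel"
  for e :: "nat \<Rightarrow> 'a::{real_inner, second_countable_topology}"
  by (rule borel_measurable_continuous_onI[OF continuous_basis_proj])

lemma sum_in_head_span: "(\<Sum>i<m. c i *\<^sub>R e i) \<in> head_span e m"
  unfolding head_span_def by (intro span_sum span_scale span_base) auto

locale gaussian_measure =
  fixes \<gamma> :: "'a::{real_inner, polish_space} measure" and C :: "'a \<Rightarrow> 'a"
    and e :: "nat \<Rightarrow> 'a" and lam :: "nat \<Rightarrow> real"
  assumes gauss: "centred_gaussian \<gamma>" and cov: "covariance_operator \<gamma> C"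
    and onb: "orthonormal_basis e" and eig: "C (e n) = (lam n)\<^sup>2 *\<^sub>R e n"
begin

lemma sets_\<gamma>[simp, measurable_cong]: "sets \<gamma> = sets borel"
  using gauss by (simp add: centred_gaussian_def)

lemma space_\<gamma>[simp]: "space \<gamma> = UNIV"
  using sets_eq_imp_space_eq[OF sets_\<gamma>] by simp

sublocale prob_space \<gamma>
  using gauss by (simp add: centred_gaussian_def)

lemma sets_\<gamma>_pair: "sets (\<gamma> \<Otimes>\<^sub>M \<gamma>) = sets borel"
  unfolding borel_prod[symmetric] by (rule sets_pair_measure_cong) (rule sets_\<gamma>)+

sublocale PP: pair_prob_space \<gamma> \<gamma> ..

lemma cov_eq: "C h \<bullet> k = (\<integral>x. (x \<bullet> h) * (x \<bullet> k) \<partial>\<gamma>)"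
  using cov by (simp add: covariance_operator_def)

lemma cov_sym: "C h \<bullet> k = C k \<bullet> h"
  unfolding cov_eq by (simp add: mult.commute)

lemma linear_C: "linear C"
  using cov bounded_linear.linear by (auto simp: covariance_operator_def)

lemma characteristic_function: "(\<integral>z. iexp (z \<bullet> h) \<partial>\<gamma>) = complex_of_real (exp (- (C h \<bullet> h) / 2))"
proof -
  have cases: "distr \<gamma> borel (\<lambda>x. x \<bullet> h) = return borel 0 \<or>
          (\<exists>\<sigma>>0. distr \<gamma> borel (\<lambda>x. x \<bullet> h) = density lborel (normal_density 0 \<sigma>))"
    using gauss by (simp add: centred_gaussian_def)
  have Ch: "C h \<bullet> h = (\<integral>x. (x \<bullet> h)\<^sup>2 \<partial>\<gamma>)"
    unfolding cov_eq by (simp add: power2_eq_square)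
  have d: "(\<integral>z. iexp (z \<bullet> h) \<partial>\<gamma>) = char (distr \<gamma> borel (\<lambda>x. x \<bullet> h)) 1"
    unfolding char_def by (subst integral_distr) auto
  have d2: "C h \<bullet> h = (\<integral>y. y\<^sup>2 \<partial>distr \<gamma> borel (\<lambda>x. x \<bullet> h))"
    unfolding Ch by (subst integral_distr) auto
  from cases show ?thesis
  proof
    assume r: "distr \<gamma> borel (\<lambda>x. x \<bullet> h) = return borel 0"
    show ?thesis unfolding d d2 unfolding r char_def by (simp add: integral_return)
  next
    assume "\<exists>\<sigma>>0. distr \<gamma> borel (\<lambda>x. x \<bullet> h) = density lborel (normal_density 0 \<sigma>)"
    then obtain \<sigma> where \<sigma>: "\<sigma> > 0" "distr \<gamma> borel (\<lambda>x. x \<bullet> h) = density lborel (normal_density 0 \<sigma>)" by blast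
    have "distr \<gamma> lborel (\<lambda>x. x \<bullet> h) = distr \<gamma> borel (\<lambda>x. x \<bullet> h)"
      by (rule distr_cong) auto
    then have D: "distributed \<gamma> lborel (\<lambda>x. x \<bullet> h) (normal_density 0 \<sigma>)"
      unfolding distributed_def using \<sigma>(2) by auto
    have v: "C h \<bullet> h = \<sigma>\<^sup>2"
      using normal_distributed_variance[OF \<sigma>(1) D] normal_distributed_expectation[OF \<sigma>(1) D]
      unfolding Ch by simp
    have D1: "distributed \<gamma> lborel (\<lambda>x. (x \<bullet> h - 0) / \<sigma>) std_normal_density"
      using normal_standard_normal_convert[OF \<sigma>(1), of "\<lambda>x. x \<bullet> h" 0] D by blast
    have "distr \<gamma> borel (\<lambda>x. (x \<bullet> h - 0) / \<sigma>) = distr \<gamma> lborel (\<lambda>x. (x \<bullet> h - 0) / \<sigma>)"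
      by (rule distr_cong) auto
    also have "\<dots> = density lborel std_normal_density"
      using D1 by (simp add: distributed_def)
    finally have D2: "distr \<gamma> borel (\<lambda>x. (x \<bullet> h - 0) / \<sigma>) = std_normal_distribution" .
    have "(\<integral>z. iexp (z \<bullet> h) \<partial>\<gamma>) = char (distr \<gamma> borel (\<lambda>x. (x \<bullet> h - 0) / \<sigma>)) \<sigma>"
      unfolding char_def using \<sigma>(1) by (subst integral_distr) auto
    then show ?thesis unfolding D2 char_std_normal_distribution v by simp
  qed
qed

text \<open>
Two independent draws; all joint laws used below are linear images of such a pair.
\<close>

lemma characteristic_function_pair:
  "(\<integral>p. iexp (fst p \<bullet> h + snd p \<bullet> k) \<partial>(\<gamma> \<Otimes>\<^sub>M \<gamma>)) = complex_of_real (exp (- (C h \<bullet> h + C k \<bullet> k) / 2))"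
proof -
  have i: "integrable (\<gamma> \<Otimes>\<^sub>M \<gamma>) (\<lambda>p. iexp (fst p \<bullet> h + snd p \<bullet> k))"
    by (rule PP.integrable_const_bound[where B=1]) auto
  have "(\<integral>p. iexp (fst p \<bullet> h + snd p \<bullet> k) \<partial>(\<gamma> \<Otimes>\<^sub>M \<gamma>)) = (\<integral>x. \<integral>y. iexp (x \<bullet> h + y \<bullet> k) \<partial>\<gamma> \<partial>\<gamma>)"
    using PP.integral_fst'[OF i] by simp
  also have "\<dots> = (\<integral>x. iexp (x \<bullet> h) * (\<integral>y. iexp (y \<bullet> k) \<partial>\<gamma>) \<partial>\<gamma>)"
    by (simp add: exp_add distrib_left)
  also have "\<dots> = (\<integral>x. iexp (x \<bullet> h) \<partial>\<gamma>) * (\<integral>y. iexp (y \<bullet> k) \<partial>\<gamma>)"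
    by (simp only: integral_mult_left_zero)
  finally show ?thesis unfolding characteristic_function by (simp add: exp_add add_divide_distrib diff_divide_distrib flip: of_real_mult exp_add)
qed

text \<open>
The exponent of the characteristic function of \<open>(x, c x + \<theta> \<xi>)\<close> at \<open>(u, v)\<close> is
\<open>C u \<bullet> u + 2 c (C u \<bullet> v) + (c\<^sup>2 + \<theta>\<^sup>2) (C v \<bullet> v)\<close>, which is symmetric in \<open>u\<close> and \<open>v\<close>.
\<close>

lemma rotation_symmetric:
  assumes c: "c\<^sup>2 + \<theta>\<^sup>2 = 1"
  shows "distr (\<gamma> \<Otimes>\<^sub>M \<gamma>) (\<gamma> \<Otimes>\<^sub>M \<gamma>) (\<lambda>p. (fst p, c *\<^sub>R fst p + \<theta> *\<^sub>R snd p))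
       = distr (\<gamma> \<Otimes>\<^sub>M \<gamma>) (\<gamma> \<Otimes>\<^sub>M \<gamma>) (\<lambda>p. (c *\<^sub>R fst p + \<theta> *\<^sub>R snd p, fst p))" (is "?L = ?R")
proof (rule cramer_wold[where k="\<lambda>n. 2*n" and b="pair_basis e"])
  have m[measurable]: "(\<lambda>p. (fst p, c *\<^sub>R fst p + \<theta> *\<^sub>R snd p)) \<in> \<gamma> \<Otimes>\<^sub>M \<gamma> \<rightarrow>\<^sub>M \<gamma> \<Otimes>\<^sub>M \<gamma>"
    "(\<lambda>p. (c *\<^sub>R fst p + \<theta> *\<^sub>R snd p, fst p)) \<in> \<gamma> \<Otimes>\<^sub>M \<gamma> \<rightarrow>\<^sub>M \<gamma> \<Otimes>\<^sub>M \<gamma>"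
    by measurable
  show "prob_space ?L" "prob_space ?R" by (intro PP.prob_space_distr m)+
  show "sets ?L = sets borel" "sets ?R = sets borel" unfolding sets_distr by (rule sets_\<gamma>_pair)+
  show "(\<lambda>n. \<Sum>i<2 * n. (z \<bullet> pair_basis e i) *\<^sub>R pair_basis e i) \<longlonglongrightarrow> z" for z
    by (rule pair_basis_tendsto[OF onb])
  fix h :: "'a \<times> 'a"
  obtain a b where h: "h = (a, b)" by (cases h)
  have im: "(\<lambda>z. iexp (z \<bullet> h)) \<in> borel_measurable (\<gamma> \<Otimes>\<^sub>M \<gamma>)"
    unfolding measurable_cong_sets[OF sets_\<gamma>_pair refl]
    by (intro borel_measurable_continuous_onI continuous_intros)
  have L: "(\<integral>z. iexp (z \<bullet> h) \<partial>?L) = (\<integral>p. iexp (fst p \<bullet> (a + c *\<^sub>R b) + snd p \<bullet> (\<theta> *\<^sub>R b)) \<partial>(\<gamma> \<Otimes>\<^sub>M \<gamma>))"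
    by (subst integral_distr[OF m(1) im]) (simp add: h inner_prod_def inner_add_right inner_add_left add.assoc)
  have R: "(\<integral>z. iexp (z \<bullet> h) \<partial>?R) = (\<integral>p. iexp (fst p \<bullet> (b + c *\<^sub>R a) + snd p \<bullet> (\<theta> *\<^sub>R a)) \<partial>(\<gamma> \<Otimes>\<^sub>M \<gamma>))"
    by (subst integral_distr[OF m(2) im]) (simp add: h inner_prod_def inner_add_right inner_add_left algebra_simps)
  have q: "C (u + c *\<^sub>R v) \<bullet> (u + c *\<^sub>R v) + C (\<theta> *\<^sub>R v) \<bullet> (\<theta> *\<^sub>R v) = C u \<bullet> u + 2 * c * (C u \<bullet> v) + C v \<bullet> v" for u v
  proof -
    have "C (u + c *\<^sub>R v) \<bullet> (u + c *\<^sub>R v) + C (\<theta> *\<^sub>R v) \<bullet> (\<theta> *\<^sub>R v)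
       = C u \<bullet> u + c * (C u \<bullet> v) + c * (C v \<bullet> u) + (c\<^sup>2 + \<theta>\<^sup>2) * (C v \<bullet> v)"
      by (simp add: linear_add[OF linear_C] linear_scale[OF linear_C] inner_add_left inner_add_right
          power2_eq_square algebra_simps)
    then show ?thesis unfolding c cov_sym[of v u] by simp
  qed
  show "(\<integral>z. iexp (z \<bullet> h) \<partial>?L) = (\<integral>z. iexp (z \<bullet> h) \<partial>?R)"
    unfolding L R characteristic_function_pair q cov_sym[of b a] by (simp add: algebra_simps)
qed

lemma rotation_difference:
  "distr (\<gamma> \<Otimes>\<^sub>M \<gamma>) borel (\<lambda>p. (1 / sqrt 2) *\<^sub>R (fst p - snd p)) = \<gamma>" (is "?L = _")
proof (rule cramer_wold[where k="\<lambda>n. n" and b=e])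
  have m: "(\<lambda>p. (1 / sqrt 2) *\<^sub>R (fst p - snd p)) \<in> \<gamma> \<Otimes>\<^sub>M \<gamma> \<rightarrow>\<^sub>M borel" by measurable
  show "prob_space ?L" by (intro PP.prob_space_distr m)
  show "prob_space \<gamma>" by (rule prob_space_axioms)
  show "(\<lambda>n. \<Sum>i<n. (z \<bullet> e i) *\<^sub>R e i) \<longlonglongrightarrow> z" for z
    using basis_proj_tendsto[OF onb] by (simp add: basis_proj_def)
  fix h :: 'a
  have "(\<integral>z. iexp (z \<bullet> h) \<partial>?L) = (\<integral>p. iexp (fst p \<bullet> ((1 / sqrt 2) *\<^sub>R h) + snd p \<bullet> (- (1 / sqrt 2) *\<^sub>R h)) \<partial>(\<gamma> \<Otimes>\<^sub>M \<gamma>))"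
    by (subst integral_distr[OF m]) (auto simp: inner_diff_left algebra_simps)
  also have "\<dots> = (\<integral>z. iexp (z \<bullet> h) \<partial>\<gamma>)"
    unfolding characteristic_function_pair characteristic_function by (simp add: linear_scale[OF linear_C] linear_neg[OF linear_C] field_simps)
  finally show "(\<integral>z. iexp (z \<bullet> h) \<partial>?L) = (\<integral>z. iexp (z \<bullet> h) \<partial>\<gamma>)" .
qed simp_all

text \<open>
By separability some ball has positive mass. If two independent draws fall into it, their
difference is small, and the difference divided by \<open>sqrt 2\<close> has law \<open>\<gamma>\<close> again
(\<open>rotation_difference\<close>).
\<close>

lemma small_ball_pos:
  assumes "s > 0" shows "measure \<gamma> (ball 0 s) > 0"
proof -
  obtain D :: "'a set" where D: "countable D" "\<And>X. open X \<Longrightarrow> X \<noteq> {} \<Longrightarrow> \<exists>d\<in>D. d \<in> X"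
    by (rule countable_dense_setE) blast
  define r where "r = s / 2"
  have "r > 0" using assms by (simp add: r_def)
  have "\<exists>a. measure \<gamma> (ball a r) \<noteq> 0"
  proof (rule ccontr)
    assume "\<nexists>a. measure \<gamma> (ball a r) \<noteq> 0"
    then have z: "ball a r \<in> null_sets \<gamma>" for a
      by (auto simp: null_sets_def emeasure_eq_measure)
    have "(\<Union>a\<in>D. ball a r) \<in> null_sets \<gamma>"
      by (rule null_sets_UN'[OF D(1)]) (rule z)
    moreover have "(\<Union>a\<in>D. ball a r) = UNIV"
    proof -
      have "\<exists>a\<in>D. x \<in> ball a r" for x
        using D(2)[of "ball x r"] \<open>r > 0\<close> by (auto simp: dist_commute)
      then show ?thesis by auto
    qed
    ultimately show False using emeasure_space_1 by auto
  qed
  then obtain a where a: "measure \<gamma> (ball a r) > 0" by (metis measure_nonneg less_eq_real_def)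
  have m: "(\<lambda>p. (1 / sqrt 2) *\<^sub>R (fst p - snd p)) \<in> \<gamma> \<Otimes>\<^sub>M \<gamma> \<rightarrow>\<^sub>M borel" by measurable
  have sub: "ball a r \<times> ball a r \<subseteq> (\<lambda>p. (1 / sqrt 2) *\<^sub>R (fst p - snd p)) -` ball 0 s \<inter> space (\<gamma> \<Otimes>\<^sub>M \<gamma>)"
  proof (clarsimp simp: space_pair_measure)
    fix x y assume xy: "dist a x < r" "dist a y < r"
    have "norm (x - y) < 2 * r"
      using dist_triangle_less_add[of x a r y r] xy by (simp add: dist_norm norm_minus_commute)
    moreover have "norm (x - y) / sqrt 2 \<le> norm (x - y)"
      by (simp add: divide_le_eq mult_le_cancel_left1)
    ultimately show "norm (x - y) / sqrt 2 < s" unfolding r_def by simp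
  qed
  have "0 < emeasure \<gamma> (ball a r) * emeasure \<gamma> (ball a r)"
    using a by (simp add: emeasure_eq_measure ennreal_zero_less_mult_iff)
  also have "\<dots> = emeasure (\<gamma> \<Otimes>\<^sub>M \<gamma>) (ball a r \<times> ball a r)"
    by (rule emeasure_pair_measure_Times[symmetric]) auto
  also have "\<dots> \<le> emeasure (\<gamma> \<Otimes>\<^sub>M \<gamma>) ((\<lambda>p. (1 / sqrt 2) *\<^sub>R (fst p - snd p)) -` ball 0 s \<inter> space (\<gamma> \<Otimes>\<^sub>M \<gamma>))"
    using sub by (rule emeasure_mono) (rule measurable_sets[OF m], simp)
  also have "\<dots> = emeasure (distr (\<gamma> \<Otimes>\<^sub>M \<gamma>) borel (\<lambda>p. (1 / sqrt 2) *\<^sub>R (fst p - snd p))) (ball 0 s)"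
    by (rule emeasure_distr[symmetric, OF m]) simp
  also have "\<dots> = emeasure \<gamma> (ball 0 s)" by (simp only: rotation_difference)
  finally show ?thesis by (simp add: emeasure_eq_measure)
qed

abbreviation Nprod :: "nat \<Rightarrow> (nat \<Rightarrow> real) measure" where
  "Nprod m \<equiv> \<Pi>\<^sub>M i\<in>{..<m}. density lborel std_normal_density"

lemma law_of_projection_borel:
  "distr (Nprod m) borel (\<lambda>\<xi>. \<Sum>i<m. (lam i * \<xi> i) *\<^sub>R e i) = distr \<gamma> borel (basis_proj e m)" (is "?L = ?R")
proof (rule cramer_wold[where k="\<lambda>n. n" and b=e])
  interpret N: product_prob_space "\<lambda>_. density lborel std_normal_density" "{..<m}"
    by (intro product_prob_spaceI prob_space_std_normal)
  have m1: "(\<lambda>\<xi>. \<Sum>i<m. (lam i * \<xi> i) *\<^sub>R e i) \<in> Nprod m \<rightarrow>\<^sub>M borel" by measurable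
  have m2[measurable]: "basis_proj e m \<in> borel \<rightarrow>\<^sub>M borel"
    by (rule borel_measurable_continuous_onI[OF continuous_basis_proj])
  show "prob_space ?L" by (intro prob_space.prob_space_distr m1 prob_space_PiM prob_space_std_normal)
  show "prob_space ?R" by (intro prob_space_distr) simp
  show "(\<lambda>n. \<Sum>i<n. (z \<bullet> e i) *\<^sub>R e i) \<longlonglongrightarrow> z" for z
    using basis_proj_tendsto[OF onb] by (simp add: basis_proj_def)
  fix h :: 'a
  have i: "integrable (density lborel std_normal_density) (\<lambda>t. iexp (c * t))" for c
    by (rule prob_space.finite_measure[OF prob_space_std_normal, THEN finite_measure.integrable_const_bound[where B=1]]) auto
  have "(\<integral>z. iexp (z \<bullet> h) \<partial>?L) = (\<integral>\<xi>. (\<Prod>i<m. iexp ((lam i * (e i \<bullet> h)) * \<xi> i)) \<partial>Nprod m)"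
  proof (subst integral_distr[OF m1])
    have "\<i> * complex_of_real ((\<Sum>i<m. (lam i * \<xi> i) *\<^sub>R e i) \<bullet> h) = (\<Sum>i<m. \<i> * complex_of_real ((lam i * (e i \<bullet> h)) * \<xi> i))" for \<xi>
      by (simp add: inner_sum_left sum_distrib_left mult_ac)
    then show "(\<integral>\<xi>. iexp ((\<Sum>i<m. (lam i * \<xi> i) *\<^sub>R e i) \<bullet> h) \<partial>Nprod m) = (\<integral>\<xi>. (\<Prod>i<m. iexp ((lam i * (e i \<bullet> h)) * \<xi> i)) \<partial>Nprod m)"
      by (simp only: exp_sum finite_lessThan)
  qed simp
  also have "\<dots> = (\<Prod>i<m. \<integral>t. iexp ((lam i * (e i \<bullet> h)) * t) \<partial>density lborel std_normal_density)"
    by (rule N.product_integral_prod[OF _ i]) simp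
  also have "\<dots> = (\<Prod>i<m. char std_normal_distribution (lam i * (e i \<bullet> h)))"
    by (simp add: char_def)
  also have "\<dots> = complex_of_real (exp (- (\<Sum>i<m. (lam i * (e i \<bullet> h))\<^sup>2) / 2))"
    by (simp add: char_std_normal_distribution sum_divide_distrib sum_negf[symmetric] exp_sum)
  also have "(\<Sum>i<m. (lam i * (e i \<bullet> h))\<^sup>2) = C (basis_proj e m h) \<bullet> basis_proj e m h"
  proof -
    have "C (basis_proj e m h) = (\<Sum>i<m. (h \<bullet> e i) *\<^sub>R C (e i))"
      unfolding basis_proj_def by (simp add: linear_sum[OF linear_C] linear_scale[OF linear_C])
    then have "C (basis_proj e m h) \<bullet> basis_proj e m h = (\<Sum>i<m. (h \<bullet> e i) * ((lam i)\<^sup>2 * (e i \<bullet> basis_proj e m h)))"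
      by (simp add: inner_sum_left eig mult.assoc)
    also have "\<dots> = (\<Sum>i<m. (lam i * (e i \<bullet> h))\<^sup>2)"
      by (rule sum.cong) (simp_all add: inner_commute[of "e _"] basis_proj_inner[OF onb] power2_eq_square)
    finally show ?thesis ..
  qed
  also have "complex_of_real (exp (- (C (basis_proj e m h) \<bullet> basis_proj e m h) / 2)) = (\<integral>z. iexp (z \<bullet> basis_proj e m h) \<partial>\<gamma>)"
    by (rule characteristic_function[symmetric])
  also have "\<dots> = (\<integral>z. iexp (z \<bullet> h) \<partial>?R)"
  proof (subst integral_distr)
    have "z \<bullet> basis_proj e m h = basis_proj e m z \<bullet> h" for z
      by (simp add: basis_proj_def inner_sum_left inner_sum_right inner_commute mult.commute)
    then show "(\<integral>z. iexp (z \<bullet> basis_proj e m h) \<partial>\<gamma>) = (\<integral>z. iexp (basis_proj e m z \<bullet> h) \<partial>\<gamma>)" by simp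
  qed auto
  finally show "(\<integral>z. iexp (z \<bullet> h) \<partial>?L) = (\<integral>z. iexp (z \<bullet> h) \<partial>?R)" .
qed simp_all

lemma measurable_basis_proj:
  "basis_proj e m \<in> \<gamma> \<rightarrow>\<^sub>M restrict_space borel (head_span e m)"
  by (rule measurable_restrict_space2)
     (auto intro: basis_proj_in_head_span[OF onb])

lemma gaussian_head_eq:
  "gaussian_head lam e m = distr \<gamma> (restrict_space borel (head_span e m)) (basis_proj e m)" (is "?L = ?R")
proof (rule measure_eqI)
  let ?S = "head_span e m" and ?f = "\<lambda>\<xi>. \<Sum>i<m. (lam i * \<xi> i) *\<^sub>R e i"
  show "sets ?L = sets ?R" by (simp add: gaussian_head_def)
  have cl: "?S \<in> sets borel" using closed_head_span[OF onb] by simp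
  fix A assume "A \<in> sets ?L"
  then have A: "A \<in> sets (restrict_space borel ?S)" "A \<in> sets borel"
    using cl by (auto simp: gaussian_head_def sets_restrict_space_iff)
  have m1: "?f \<in> Nprod m \<rightarrow>\<^sub>M borel" by measurable
  have m1': "?f \<in> Nprod m \<rightarrow>\<^sub>M restrict_space borel ?S"
    by (rule measurable_restrict_space2[OF _ m1]) (auto intro: sum_in_head_span)
  have "emeasure ?L A = emeasure (distr (Nprod m) borel ?f) A"
    using A m1 m1' by (simp add: gaussian_head_def emeasure_distr)
  also have "\<dots> = emeasure (distr \<gamma> borel (basis_proj e m)) A"
    by (simp only: law_of_projection_borel)
  also have "\<dots> = emeasure ?R A"
    using A measurable_basis_proj by (simp add: emeasure_distr borel_measurable_continuous_onI[OF continuous_basis_proj])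
  finally show "emeasure ?L A = emeasure ?R A" .
qed

lemma nn_integral_exp_norm_projection:
  assumes b: "\<And>i. i < m \<Longrightarrow> 1 + 2 * (b * (lam i)\<^sup>2) > 0"
  shows "(\<integral>\<^sup>+x. ennreal (exp (- b * (norm (basis_proj e m x))\<^sup>2)) \<partial>\<gamma>) = (\<Prod>i<m. ennreal (1 / sqrt (1 + 2 * (b * (lam i)\<^sup>2))))"
proof -
  interpret N: product_prob_space "\<lambda>_. density lborel std_normal_density" "{..<m}"
    by (intro product_prob_spaceI prob_space_std_normal)
  have m1: "(\<lambda>\<xi>. \<Sum>i<m. (lam i * \<xi> i) *\<^sub>R e i) \<in> Nprod m \<rightarrow>\<^sub>M borel" by measurable
  have m2[measurable]: "basis_proj e m \<in> borel \<rightarrow>\<^sub>M borel"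
    by (rule borel_measurable_continuous_onI[OF continuous_basis_proj])
  have "(\<integral>\<^sup>+x. ennreal (exp (- b * (norm (basis_proj e m x))\<^sup>2)) \<partial>\<gamma>)
      = (\<integral>\<^sup>+x. ennreal (exp (- b * (norm x)\<^sup>2)) \<partial>distr \<gamma> borel (basis_proj e m))"
    by (subst nn_integral_distr) auto
  also have "\<dots> = (\<integral>\<^sup>+\<xi>. ennreal (exp (- b * (norm (\<Sum>i<m. (lam i * \<xi> i) *\<^sub>R e i))\<^sup>2)) \<partial>Nprod m)"
    unfolding law_of_projection_borel[symmetric] by (subst nn_integral_distr[OF m1]) auto
  also have "\<dots> = (\<integral>\<^sup>+\<xi>. (\<Prod>i<m. ennreal (exp (- (b * (lam i)\<^sup>2) * (\<xi> i)\<^sup>2))) \<partial>Nprod m)"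
  proof (rule nn_integral_cong)
    fix \<xi> :: "nat \<Rightarrow> real"
    define y where "y = (\<Sum>i<m. (lam i * \<xi> i) *\<^sub>R e i)"
    have ye: "y \<bullet> e j = lam j * \<xi> j" if "j < m" for j
      using that by (simp add: y_def inner_sum_left ortho[OF onb] if_distrib cong: if_cong)
    have "y \<in> head_span e m"
      unfolding y_def by (rule sum_in_head_span)
    then have "(norm y)\<^sup>2 = (\<Sum>i<m. (lam i * \<xi> i)\<^sup>2)"
      using norm_basis_proj[OF onb, of m y] basis_proj_of_head_span[OF onb, of y m] by (simp add: ye)
    then show "ennreal (exp (- b * (norm (\<Sum>i<m. (lam i * \<xi> i) *\<^sub>R e i))\<^sup>2)) = (\<Prod>i<m. ennreal (exp (- (b * (lam i)\<^sup>2) * (\<xi> i)\<^sup>2)))"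
      unfolding y_def[symmetric]
      by (simp add: prod_ennreal exp_sum[symmetric] sum_distrib_left sum_negf power_mult_distrib mult_ac)
  qed
  also have "\<dots> = (\<Prod>i<m. \<integral>\<^sup>+t. ennreal (exp (- (b * (lam i)\<^sup>2) * t\<^sup>2)) \<partial>density lborel std_normal_density)"
    by (rule N.product_nn_integral_prod) simp_all
  also have "\<dots> = (\<Prod>i<m. ennreal (1 / sqrt (1 + 2 * (b * (lam i)\<^sup>2))))"
    using b by (intro prod.cong nn_integral_exp_square_std_normal) auto
  finally show ?thesis .
qed

text \<open>
The mean of \<open>exp (- |P x|\<^sup>2 / 2)\<close> over the projection \<open>P\<close> onto the first \<open>m\<close> basis vectors equals
\<open>\<Prod>i<m. (1 + (lam i)\<^sup>2) powr (-1/2)\<close>. It is bounded below by the mean of \<open>exp (- |x|\<^sup>2 / 2)\<close>, which is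
positive as all norms are finite; so the product, and with it the sum, stays bounded.
\<close>

lemma trace_bounded: "\<exists>T. \<forall>m. (\<Sum>i<m. (lam i)\<^sup>2) \<le> T"
proof -
  define E where "E = (\<integral>x. exp (- (1/2) * (norm x)\<^sup>2) \<partial>\<gamma>)"
  have int: "integrable \<gamma> (\<lambda>x. exp (- (1/2) * (norm x)\<^sup>2))"
    by (rule integrable_const_bound[where B=1]) auto
  have E0: "E > 0"
  proof -
    have "E \<ge> 0" unfolding E_def by simp
    moreover have "E \<noteq> 0"
    proof
      assume "E = 0"
      then have "AE x in \<gamma>. exp (- (1/2) * (norm x)\<^sup>2) = 0"
        unfolding E_def using int by (subst (asm) integral_nonneg_eq_0_iff_AE) auto
      then have "AE x in \<gamma>. False" by simp
      then show False by simp
    qed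
    ultimately show ?thesis by simp
  qed
  have nE: "(\<integral>\<^sup>+x. ennreal (exp (- (1/2) * (norm x)\<^sup>2)) \<partial>\<gamma>) = ennreal E"
    unfolding E_def using int by (intro nn_integral_eq_integral) auto
  have "(\<Sum>i<m. (lam i)\<^sup>2) \<le> 1 / E\<^sup>2" for m
  proof -
    define P where "P = (\<Prod>i<m. 1 + (lam i)\<^sup>2)"
    have P: "P \<ge> 1 + (\<Sum>i<m. (lam i)\<^sup>2)"
      unfolding P_def
    proof (induction m)
      case (Suc m)
      have S: "(\<Sum>i<m. (lam i)\<^sup>2) \<ge> 0" by (rule sum_nonneg) simp
      have "1 + (\<Sum>i<Suc m. (lam i)\<^sup>2) \<le> (1 + (\<Sum>i<m. (lam i)\<^sup>2)) * (1 + (lam m)\<^sup>2)"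
        using mult_nonneg_nonneg[OF S zero_le_power2[of "lam m"]] by (simp add: algebra_simps)
      also have "\<dots> \<le> (\<Prod>i<m. 1 + (lam i)\<^sup>2) * (1 + (lam m)\<^sup>2)"
        by (rule mult_right_mono[OF Suc.IH]) simp
      finally show ?case by simp
    qed simp
    have P1: "P \<ge> 1" using P sum_nonneg[of "{..<m}" "\<lambda>i. (lam i)\<^sup>2"] by simp
    have "ennreal E \<le> (\<integral>\<^sup>+x. ennreal (exp (- (1/2) * (norm (basis_proj e m x))\<^sup>2)) \<partial>\<gamma>)"
      unfolding nE[symmetric]
      by (intro nn_integral_mono ennreal_leI) (simp add: norm_basis_proj_le[OF onb] power_mono)
    also have "\<dots> = (\<Prod>i<m. ennreal (1 / sqrt (1 + 2 * (1/2 * (lam i)\<^sup>2))))"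
      by (rule nn_integral_exp_norm_projection) (simp add: add_pos_nonneg)
    also have "\<dots> = ennreal (\<Prod>i<m. 1 / sqrt (1 + (lam i)\<^sup>2))"
      by (simp add: prod_ennreal)
    also have "(\<Prod>i<m. 1 / sqrt (1 + (lam i)\<^sup>2)) = 1 / sqrt P"
      unfolding P_def by (induction m) (simp_all add: real_sqrt_mult)
    finally have "E \<le> 1 / sqrt P" using P1 by (simp add: ennreal_le_iff)
    then have "E * sqrt P \<le> 1" using P1 by (simp add: field_simps)
    then have "(E * sqrt P)\<^sup>2 \<le> 1" using E0 P1 by (intro power_le_one) auto
    then have "P \<le> 1 / E\<^sup>2" using E0 P1 by (simp add: power_mult_distrib field_simps)
    then show ?thesis using P by simp
  qed
  then show ?thesis by blast
qed

lemma inverse_sqrt_le_exp: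
  assumes "0 \<le> u" "u \<le> 1/2" shows "1 / sqrt (1 - u) \<le> exp (u::real)"
proof -
  have "1 \<le> (1 - u) * (1 + 2 * u)"
    using mult_nonneg_nonneg[of u "1 - 2 * u"] assms by (simp add: algebra_simps)
  also have "\<dots> \<le> (1 - u) * exp (2 * u)"
    using assms by (intro mult_left_mono exp_ge_add_one_self) auto
  also have "\<dots> = (sqrt (1 - u) * exp u)\<^sup>2"
    using assms by (simp add: power_mult_distrib exp_double)
  finally have "1 \<le> sqrt (1 - u) * exp u"
    using assms by (intro power2_le_imp_le[of 1]) auto
  then show ?thesis using assms by (simp add: field_simps)
qed

text \<open>
For \<open>\<beta>\<close> small compared with the inverse of the trace, the product formula bounds the moments of all
projections, and the lemma of Fatou passes to the limit.
\<close>

lemma exp_square_moment: "\<exists>\<beta>>0. (\<integral>\<^sup>+x. ennreal (exp (\<beta> * (norm x)\<^sup>2)) \<partial>\<gamma>) < \<infinity>"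
proof -
  obtain T where T: "\<And>m. (\<Sum>i<m. (lam i)\<^sup>2) \<le> T" using trace_bounded by blast
  have T0: "T \<ge> 0" using T[of 0] by simp
  have lT: "(lam i)\<^sup>2 \<le> T" for i
    using T[of "Suc i"] sum_nonneg[of "{..<i}" "\<lambda>i. (lam i)\<^sup>2"] by simp
  define \<beta> where "\<beta> = 1 / (4 * (T + 1))"
  have \<beta>: "\<beta> > 0" using T0 by (simp add: \<beta>_def)
  have u: "0 \<le> 2 * (\<beta> * (lam i)\<^sup>2)" "2 * (\<beta> * (lam i)\<^sup>2) \<le> 1/2" for i
  proof -
    have "\<beta> * (lam i)\<^sup>2 \<le> \<beta> * (T + 1)" using \<beta> lT[of i] by (intro mult_left_mono) auto
    also have "\<beta> * (T + 1) = 1/4" using T0 by (simp add: \<beta>_def field_simps)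
    finally show "2 * (\<beta> * (lam i)\<^sup>2) \<le> 1/2" by simp
  qed (use \<beta> in simp)
  have "(\<integral>\<^sup>+x. ennreal (exp (\<beta> * (norm (basis_proj e m x))\<^sup>2)) \<partial>\<gamma>) \<le> ennreal (exp (2 * \<beta> * T))" for m
  proof -
    have "(\<integral>\<^sup>+x. ennreal (exp (- (- \<beta>) * (norm (basis_proj e m x))\<^sup>2)) \<partial>\<gamma>) = (\<Prod>i<m. ennreal (1 / sqrt (1 + 2 * (- \<beta> * (lam i)\<^sup>2))))"
    proof (rule nn_integral_exp_norm_projection)
      show "0 < 1 + 2 * (- \<beta> * (lam i)\<^sup>2)" for i using u(2)[of i] by simp
    qed
    also have "\<dots> \<le> (\<Prod>i<m. ennreal (exp (2 * (\<beta> * (lam i)\<^sup>2))))"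
    proof -
      have pos: "0 \<le> 1 / sqrt (1 + 2 * (- \<beta> * (lam i)\<^sup>2))" for i using u(2)[of i] by simp
      have "(\<Prod>i<m. 1 / sqrt (1 + 2 * (- \<beta> * (lam i)\<^sup>2))) \<le> (\<Prod>i<m. exp (2 * (\<beta> * (lam i)\<^sup>2)))"
        using inverse_sqrt_le_exp[OF u] pos by (intro prod_mono) simp
      then show ?thesis using pos by (simp only: prod_ennreal exp_ge_zero ennreal_leI)
    qed
    also have "\<dots> = ennreal (exp (2 * \<beta> * (\<Sum>i<m. (lam i)\<^sup>2)))"
      by (simp add: prod_ennreal exp_sum[symmetric] sum_distrib_left mult_ac)
    also have "\<dots> \<le> ennreal (exp (2 * \<beta> * T))"
      using \<beta> T by (intro ennreal_leI) (simp add: mult_left_mono)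
    finally show ?thesis by simp
  qed
  note bound = this
  have "(\<integral>\<^sup>+x. ennreal (exp (\<beta> * (norm x)\<^sup>2)) \<partial>\<gamma>)
      = (\<integral>\<^sup>+x. liminf (\<lambda>m. ennreal (exp (\<beta> * (norm (basis_proj e m x))\<^sup>2))) \<partial>\<gamma>)"
  proof (rule nn_integral_cong)
    fix x
    have "(\<lambda>m. ennreal (exp (\<beta> * (norm (basis_proj e m x))\<^sup>2))) \<longlonglongrightarrow> ennreal (exp (\<beta> * (norm x)\<^sup>2))"
      by (intro tendsto_intros basis_proj_tendsto[OF onb])
    then show "ennreal (exp (\<beta> * (norm x)\<^sup>2)) = liminf (\<lambda>m. ennreal (exp (\<beta> * (norm (basis_proj e m x))\<^sup>2)))"
      by (intro lim_imp_Liminf[symmetric]) auto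
  qed
  also have "\<dots> \<le> liminf (\<lambda>m. \<integral>\<^sup>+x. ennreal (exp (\<beta> * (norm (basis_proj e m x))\<^sup>2)) \<partial>\<gamma>)"
  proof (rule nn_integral_liminf)
    have [measurable]: "basis_proj e m \<in> borel \<rightarrow>\<^sub>M borel" for m
      by (rule borel_measurable_continuous_onI[OF continuous_basis_proj])
    show "(\<lambda>x. ennreal (exp (\<beta> * (norm (basis_proj e m x))\<^sup>2))) \<in> borel_measurable \<gamma>" for m by measurable
  qed
  also have "\<dots> \<le> liminf (\<lambda>m. ennreal (exp (2 * \<beta> * T)))"
    by (intro Liminf_mono always_eventually allI bound)
  also have "\<dots> < \<infinity>" by (simp add: Liminf_const)
  finally show ?thesis using \<beta> by blast
qed

lemma exp_moment: "(\<integral>\<^sup>+x. ennreal (exp (w * norm x)) \<partial>\<gamma>) < \<infinity>"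
proof -
  obtain \<beta> where \<beta>: "\<beta> > 0" "(\<integral>\<^sup>+x. ennreal (exp (\<beta> * (norm x)\<^sup>2)) \<partial>\<gamma>) < \<infinity>"
    using exp_square_moment by blast
  have "w * t \<le> w\<^sup>2 / (4 * \<beta>) + \<beta> * t\<^sup>2" for t
  proof -
    have "0 \<le> (w - 2 * \<beta> * t)\<^sup>2" by simp
    also have "\<dots> = 4 * \<beta> * (w\<^sup>2 / (4 * \<beta>) + \<beta> * t\<^sup>2 - w * t)"
      using \<beta>(1) by (simp add: power2_eq_square field_simps)
    finally show ?thesis using \<beta>(1) by (simp add: zero_le_mult_iff)
  qed
  then have "(\<integral>\<^sup>+x. ennreal (exp (w * norm x)) \<partial>\<gamma>) \<le> (\<integral>\<^sup>+x. ennreal (exp (w\<^sup>2 / (4 * \<beta>))) * ennreal (exp (\<beta> * (norm x)\<^sup>2)) \<partial>\<gamma>)"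
    by (intro nn_integral_mono) (simp flip: ennreal_mult exp_add)
  also have "\<dots> = ennreal (exp (w\<^sup>2 / (4 * \<beta>))) * (\<integral>\<^sup>+x. ennreal (exp (\<beta> * (norm x)\<^sup>2)) \<partial>\<gamma>)"
    by (rule nn_integral_cmult) measurable
  also have "\<dots> < \<infinity>" using \<beta>(2) by (simp add: ennreal_mult_less_top)
  finally show ?thesis .
qed

end

section \<open>Chains driven by random maps and their synchronous coupling\<close>

lemma ennreal_min_one: "0 \<le> x \<Longrightarrow> ennreal (min 1 x) = min 1 (ennreal x)"
  by (simp add: min_def)

text \<open>
A Markov kernel given by a map \<open>F x w\<close> of the state and of a random input \<open>w\<close>. Feeding the same input
to two states couples two copies of the chain.
\<close>

locale random_map =
  fixes M :: "'x measure" and W :: "'w measure" and F :: "'x \<Rightarrow> 'w \<Rightarrow> 'x"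
  assumes prob_W: "prob_space W" and F_meas[measurable]: "(\<lambda>(x, w). F x w) \<in> M \<Otimes>\<^sub>M W \<rightarrow>\<^sub>M M"
begin

definition kern :: "'x \<Rightarrow> 'x measure" where
  "kern x = distr W M (F x)"

definition coupled_kern :: "'x \<times> 'x \<Rightarrow> ('x \<times> 'x) measure" where
  "coupled_kern z = distr W (M \<Otimes>\<^sub>M M) (\<lambda>w. (F (fst z) w, F (snd z) w))"

lemma W_const: "(\<lambda>_. W) \<in> N \<rightarrow>\<^sub>M prob_algebra W"
  using prob_W by (intro measurable_const) (simp add: space_prob_algebra)

lemma F_sect: "x \<in> space M \<Longrightarrow> F x \<in> W \<rightarrow>\<^sub>M M"
  using measurable_compose_Pair1[OF _ F_meas] by simp

lemma kern_measurable[measurable]: "kern \<in> M \<rightarrow>\<^sub>M prob_algebra M"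
  unfolding kern_def[abs_def] by (rule measurable_distr_prob_space2[OF W_const F_meas])

lemma coupled_kern_measurable[measurable]: "coupled_kern \<in> M \<Otimes>\<^sub>M M \<rightarrow>\<^sub>M prob_algebra (M \<Otimes>\<^sub>M M)"
  unfolding coupled_kern_def[abs_def]
  by (rule measurable_distr_prob_space2[OF W_const]) measurable

lemma coupling_prob:
  assumes "\<pi> \<in> couplings \<nu>1 \<nu>2" "\<nu>1 \<in> space (prob_algebra M)" "\<nu>2 \<in> space (prob_algebra M)"
  shows "\<pi> \<in> space (prob_algebra (M \<Otimes>\<^sub>M M))"
proof -
  have s: "sets \<nu>1 = sets M" "sets \<nu>2 = sets M" and p: "prob_space \<nu>1"
    using assms by (auto simp: space_prob_algebra)
  have c: "sets \<pi> = sets (\<nu>1 \<Otimes>\<^sub>M \<nu>2)" "distr \<pi> \<nu>1 fst = \<nu>1" using assms by (auto simp: couplings_def)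
  have "fst \<in> \<pi> \<rightarrow>\<^sub>M \<nu>1" using measurable_cong_sets[OF c(1) refl] measurable_fst by blast
  then have "prob_space \<pi>" using p c(2) by (metis prob_space_distrD)
  moreover have "sets \<pi> = sets (M \<Otimes>\<^sub>M M)" unfolding c(1) by (rule sets_pair_measure_cong[OF s])
  ultimately show ?thesis by (simp add: space_prob_algebra)
qed

lemma coupling_step:
  assumes \<pi>: "\<pi> \<in> couplings \<nu>1 \<nu>2" and \<nu>: "\<nu>1 \<in> space (prob_algebra M)" "\<nu>2 \<in> space (prob_algebra M)"
  shows "\<pi> \<bind> coupled_kern \<in> couplings (\<nu>1 \<bind> kern) (\<nu>2 \<bind> kern)"
proof -
  have \<pi>p: "\<pi> \<in> space (prob_algebra (M \<Otimes>\<^sub>M M))" by (rule coupling_prob[OF assms])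
  then have \<pi>s[measurable_cong]: "sets \<pi> = sets (M \<Otimes>\<^sub>M M)" and "prob_space \<pi>" by (auto simp: space_prob_algebra)
  then have ne: "space \<pi> \<noteq> {}" by (simp add: prob_space.not_empty)
  have sp: "space \<pi> = space M \<times> space M" using sets_eq_imp_space_eq[OF \<pi>s] by (simp add: space_pair_measure)
  have s\<nu>: "sets \<nu>1 = sets M" "sets \<nu>2 = sets M" using \<nu> by (auto simp: space_prob_algebra)
  have sb: "sets (\<nu>1 \<bind> kern) = sets M" "sets (\<nu>2 \<bind> kern) = sets M"
    using sets_bind'[OF _ kern_measurable] \<nu> by auto
  have csub: "coupled_kern \<in> \<pi> \<rightarrow>\<^sub>M subprob_algebra (M \<Otimes>\<^sub>M M)"
    using measurable_prob_algebraD[OF coupled_kern_measurable] by measurable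
  have ksub: "kern \<in> M \<rightarrow>\<^sub>M subprob_algebra M"
    by (rule measurable_prob_algebraD[OF kern_measurable])
  have m: "distr \<pi> M fst = \<nu>1" "distr \<pi> M snd = \<nu>2"
    using \<pi> distr_cong[OF refl s\<nu>(1), of \<pi> fst fst] distr_cong[OF refl s\<nu>(2), of \<pi> snd snd] by (auto simp: couplings_def)
  have pm: "p \<in> \<pi> \<rightarrow>\<^sub>M M" "p \<in> M \<Otimes>\<^sub>M M \<rightarrow>\<^sub>M M" if "p = fst \<or> p = snd" for p :: "'x \<times> 'x \<Rightarrow> 'x"
    using that by auto
  have marg: "distr (\<pi> \<bind> coupled_kern) M p = distr \<pi> M p \<bind> kern" if p: "p = fst \<or> p = snd" for p
  proof -
    have "distr (\<pi> \<bind> coupled_kern) M p = \<pi> \<bind> (\<lambda>z. distr (coupled_kern z) M p)"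
      by (rule distr_bind[OF csub ne pm(2)[OF p]])
    also have "\<dots> = \<pi> \<bind> (\<lambda>z. kern (p z))"
    proof (rule bind_cong[OF refl])
      fix z assume "z \<in> space \<pi>"
      then have z: "fst z \<in> space M" "snd z \<in> space M" by (auto simp: sp)
      have "(\<lambda>w. (F (fst z) w, F (snd z) w)) \<in> W \<rightarrow>\<^sub>M M \<Otimes>\<^sub>M M"
        using F_sect[OF z(1)] F_sect[OF z(2)] by measurable
      then show "distr (coupled_kern z) M p = kern (p z)"
        using p by (auto simp: coupled_kern_def kern_def distr_distr[OF pm(2)[OF p]] comp_def)
    qed
    also have "\<dots> = distr \<pi> M p \<bind> kern"
      by (rule bind_distr[symmetric, OF pm(1)[OF p] ksub ne])
    finally show ?thesis .
  qed
  have "sets (\<pi> \<bind> coupled_kern) = sets ((\<nu>1 \<bind> kern) \<Otimes>\<^sub>M (\<nu>2 \<bind> kern))"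
    unfolding sets_bind'[OF \<pi>p coupled_kern_measurable] by (rule sets_pair_measure_cong[OF sb[symmetric]])
  moreover have "distr (\<pi> \<bind> coupled_kern) (\<nu>1 \<bind> kern) fst = \<nu>1 \<bind> kern"
    using marg[of fst] distr_cong[OF refl sb(1), of "\<pi> \<bind> coupled_kern" fst fst] m by simp
  moreover have "distr (\<pi> \<bind> coupled_kern) (\<nu>2 \<bind> kern) snd = \<nu>2 \<bind> kern"
    using marg[of snd] distr_cong[OF refl sb(2), of "\<pi> \<bind> coupled_kern" snd snd] m by simp
  ultimately show ?thesis by (simp add: couplings_def)
qed

lemma nn_integral_coupling_step:
  assumes \<pi>: "\<pi> \<in> space (prob_algebra (M \<Otimes>\<^sub>M M))"
    and c[measurable]: "c \<in> borel_measurable (M \<Otimes>\<^sub>M M)"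
    and b: "\<And>x y. x \<in> space M \<Longrightarrow> y \<in> space M \<Longrightarrow> (\<integral>\<^sup>+w. c (F x w, F y w) \<partial>W) \<le> c' (x, y)"
  shows "(\<integral>\<^sup>+z. c z \<partial>(\<pi> \<bind> coupled_kern)) \<le> (\<integral>\<^sup>+z. c' z \<partial>\<pi>)"
proof -
  have \<pi>s[measurable_cong]: "sets \<pi> = sets (M \<Otimes>\<^sub>M M)" using \<pi> by (auto simp: space_prob_algebra)
  have sp: "space \<pi> = space M \<times> space M" using sets_eq_imp_space_eq[OF \<pi>s] by (simp add: space_pair_measure)
  have csub: "coupled_kern \<in> \<pi> \<rightarrow>\<^sub>M subprob_algebra (M \<Otimes>\<^sub>M M)"
    using measurable_prob_algebraD[OF coupled_kern_measurable] by measurable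
  have "(\<integral>\<^sup>+z. c z \<partial>(\<pi> \<bind> coupled_kern)) = (\<integral>\<^sup>+z. \<integral>\<^sup>+y. c y \<partial>coupled_kern z \<partial>\<pi>)"
    by (rule nn_integral_bind[OF c csub])
  also have "\<dots> \<le> (\<integral>\<^sup>+z. c' z \<partial>\<pi>)"
  proof (rule nn_integral_mono)
    fix z assume "z \<in> space \<pi>"
    then have z: "fst z \<in> space M" "snd z \<in> space M" by (auto simp: sp)
    have "(\<lambda>w. (F (fst z) w, F (snd z) w)) \<in> W \<rightarrow>\<^sub>M M \<Otimes>\<^sub>M M"
      using F_sect[OF z(1)] F_sect[OF z(2)] by measurable
    then have "(\<integral>\<^sup>+y. c y \<partial>coupled_kern z) = (\<integral>\<^sup>+w. c (F (fst z) w, F (snd z) w) \<partial>W)"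
      unfolding coupled_kern_def by (rule nn_integral_distr) (simp add: c)
    also have "\<dots> \<le> c' z" using b[OF z] by simp
    finally show "(\<integral>\<^sup>+y. c y \<partial>coupled_kern z) \<le> c' z" .
  qed
  finally show ?thesis .
qed

lemma kernel_steps_Suc: "kernel_steps K (Suc n) \<nu> = kernel_steps K n \<nu> \<bind> K"
  by (simp add: kernel_steps_def)

lemma bind_kern_prob: "\<nu> \<in> space (prob_algebra M) \<Longrightarrow> \<nu> \<bind> kern \<in> space (prob_algebra M)"
  using prob_space_bind'[OF _ kern_measurable] sets_bind'[OF _ kern_measurable] by (simp add: space_prob_algebra)

lemma kernel_steps_prob: "\<nu> \<in> space (prob_algebra M) \<Longrightarrow> kernel_steps kern n \<nu> \<in> space (prob_algebra M)"
  by (induction n) (auto simp: kernel_steps_Suc intro: bind_kern_prob, simp add: kernel_steps_def)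

context
  fixes c :: "'x \<times> 'x \<Rightarrow> ennreal" and \<kappa> :: ennreal
  assumes c[measurable]: "c \<in> borel_measurable (M \<Otimes>\<^sub>M M)"
    and contr: "\<And>x y. x \<in> space M \<Longrightarrow> y \<in> space M \<Longrightarrow> (\<integral>\<^sup>+w. c (F x w, F y w) \<partial>W) \<le> \<kappa> * c (x, y)"
begin

text \<open>
Two consequences of a one-step contraction for the coupled chain. The truncated one makes sense
for couplings of infinite cost and is used for uniqueness.
\<close>

lemma coupling_steps:
  assumes \<pi>: "\<pi> \<in> couplings \<nu>1 \<nu>2" and \<nu>: "\<nu>1 \<in> space (prob_algebra M)" "\<nu>2 \<in> space (prob_algebra M)"
  shows "\<exists>\<pi>'\<in>couplings (kernel_steps kern n \<nu>1) (kernel_steps kern n \<nu>2).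
    \<forall>a::ennreal. (\<integral>\<^sup>+z. min 1 (a * c z) \<partial>\<pi>') \<le> (\<integral>\<^sup>+z. min 1 (a * (\<kappa> ^ n * c z)) \<partial>\<pi>) \<and>
       (\<integral>\<^sup>+z. c z \<partial>\<pi>') \<le> \<kappa> ^ n * (\<integral>\<^sup>+z. c z \<partial>\<pi>)"
proof (induction n)
  case 0
  then show ?case using \<pi> by (intro bexI[of _ \<pi>]) (auto simp: kernel_steps_def)
next
  case (Suc n)
  then obtain \<pi>' where \<pi>': "\<pi>' \<in> couplings (kernel_steps kern n \<nu>1) (kernel_steps kern n \<nu>2)"
    and IH: "\<And>a. (\<integral>\<^sup>+z. min 1 (a * c z) \<partial>\<pi>') \<le> (\<integral>\<^sup>+z. min 1 (a * (\<kappa> ^ n * c z)) \<partial>\<pi>)"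
      "(\<integral>\<^sup>+z. c z \<partial>\<pi>') \<le> \<kappa> ^ n * (\<integral>\<^sup>+z. c z \<partial>\<pi>)" by blast
  note ks = kernel_steps_prob[OF \<nu>(1), of n] kernel_steps_prob[OF \<nu>(2), of n]
  have p': "\<pi>' \<in> space (prob_algebra (M \<Otimes>\<^sub>M M))" by (rule coupling_prob[OF \<pi>' ks])
  then have [measurable_cong]: "sets \<pi>' = sets (M \<Otimes>\<^sub>M M)" by (simp add: space_prob_algebra)
  show ?case
  proof (intro bexI[of _ "\<pi>' \<bind> coupled_kern"] allI conjI)
    show "\<pi>' \<bind> coupled_kern \<in> couplings (kernel_steps kern (Suc n) \<nu>1) (kernel_steps kern (Suc n) \<nu>2)"
      unfolding kernel_steps_Suc by (rule coupling_step[OF \<pi>' ks])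
    fix a :: ennreal
    have "(\<integral>\<^sup>+z. min 1 (a * c z) \<partial>(\<pi>' \<bind> coupled_kern)) \<le> (\<integral>\<^sup>+z. min 1 ((a * \<kappa>) * c z) \<partial>\<pi>')"
    proof (rule nn_integral_coupling_step[OF p'])
      fix x y assume xy: "x \<in> space M" "y \<in> space M"
      have mm: "(\<lambda>w. c (F x w, F y w)) \<in> borel_measurable W"
        using F_sect[OF xy(1)] F_sect[OF xy(2)] by measurable
      have "(\<integral>\<^sup>+w. min 1 (a * c (F x w, F y w)) \<partial>W) \<le> (\<integral>\<^sup>+w. 1 \<partial>W)"
        by (rule nn_integral_mono) simp
      also have "\<dots> = 1" using prob_space.emeasure_space_1[OF prob_W] by simp
      finally have 1: "(\<integral>\<^sup>+w. min 1 (a * c (F x w, F y w)) \<partial>W) \<le> 1" .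
      have "(\<integral>\<^sup>+w. min 1 (a * c (F x w, F y w)) \<partial>W) \<le> (\<integral>\<^sup>+w. a * c (F x w, F y w) \<partial>W)"
        by (rule nn_integral_mono) simp
      also have "\<dots> = a * (\<integral>\<^sup>+w. c (F x w, F y w) \<partial>W)" by (rule nn_integral_cmult[OF mm])
      also have "\<dots> \<le> a * (\<kappa> * c (x, y))" using contr[OF xy] by (rule mult_left_mono) simp
      finally show "(\<integral>\<^sup>+w. min 1 (a * c (F x w, F y w)) \<partial>W) \<le> min 1 ((a * \<kappa>) * c (x, y))"
        using 1 by (simp add: mult.assoc)
    qed measurable
    also have "\<dots> \<le> (\<integral>\<^sup>+z. min 1 ((a * \<kappa>) * (\<kappa> ^ n * c z)) \<partial>\<pi>)" by (rule IH(1))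
    finally show "(\<integral>\<^sup>+z. min 1 (a * c z) \<partial>(\<pi>' \<bind> coupled_kern)) \<le> (\<integral>\<^sup>+z. min 1 (a * (\<kappa> ^ Suc n * c z)) \<partial>\<pi>)"
      by (simp add: mult_ac)
    have "(\<integral>\<^sup>+z. c z \<partial>(\<pi>' \<bind> coupled_kern)) \<le> (\<integral>\<^sup>+z. \<kappa> * c z \<partial>\<pi>')"
      by (rule nn_integral_coupling_step[OF p' c contr])
    also have "\<dots> = \<kappa> * (\<integral>\<^sup>+z. c z \<partial>\<pi>')" by (rule nn_integral_cmult) measurable
    also have "\<dots> \<le> \<kappa> * (\<kappa> ^ n * (\<integral>\<^sup>+z. c z \<partial>\<pi>))" by (rule mult_left_mono[OF IH(2)]) simp
    finally show "(\<integral>\<^sup>+z. c z \<partial>(\<pi>' \<bind> coupled_kern)) \<le> \<kappa> ^ Suc n * (\<integral>\<^sup>+z. c z \<partial>\<pi>)"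
      by (simp add: mult_ac)
  qed
qed

text \<open>
A cost that contracts in one step controls each comparable distance after sufficiently many steps.
\<close>

lemma transport_dist_steps:
  fixes D :: "'x \<Rightarrow> 'x \<Rightarrow> real" and A B :: ennreal
  assumes D[measurable]: "(\<lambda>z. ennreal (D (fst z) (snd z))) \<in> borel_measurable (M \<Otimes>\<^sub>M M)"
    and DA: "\<And>x y. x \<in> space M \<Longrightarrow> y \<in> space M \<Longrightarrow> ennreal (D x y) \<le> A * c (x, y)"
    and DB: "\<And>x y. x \<in> space M \<Longrightarrow> y \<in> space M \<Longrightarrow> c (x, y) \<le> B * ennreal (D x y)"
    and n: "2 * (A * \<kappa> ^ n * B) \<le> 1"
    and \<nu>: "\<nu>1 \<in> space (prob_algebra M)" "\<nu>2 \<in> space (prob_algebra M)"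
  shows "transport_dist D (kernel_steps kern n \<nu>1) (kernel_steps kern n \<nu>2) \<le> 1/2 * transport_dist D \<nu>1 \<nu>2"
proof -
  let ?D = "\<lambda>z. ennreal (D (fst z) (snd z))"
  let ?T = "transport_dist D (kernel_steps kern n \<nu>1) (kernel_steps kern n \<nu>2)"
  have "2 * ?T \<le> transport_dist D \<nu>1 \<nu>2"
    unfolding transport_dist_def[of D \<nu>1 \<nu>2]
  proof (rule INF_greatest)
    fix \<pi> assume \<pi>: "\<pi> \<in> couplings \<nu>1 \<nu>2"
    obtain \<pi>' where \<pi>': "\<pi>' \<in> couplings (kernel_steps kern n \<nu>1) (kernel_steps kern n \<nu>2)"
      and le: "(\<integral>\<^sup>+z. c z \<partial>\<pi>') \<le> \<kappa> ^ n * (\<integral>\<^sup>+z. c z \<partial>\<pi>)"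
      using coupling_steps[OF \<pi> \<nu>, of n] by blast
    have s[measurable_cong]: "sets \<pi> = sets (M \<Otimes>\<^sub>M M)" "sets \<pi>' = sets (M \<Otimes>\<^sub>M M)"
      using coupling_prob[OF \<pi> \<nu>] coupling_prob[OF \<pi>' kernel_steps_prob[OF \<nu>(1)] kernel_steps_prob[OF \<nu>(2)]]
      by (auto simp: space_prob_algebra)
    have sp: "space \<pi> = space M \<times> space M" "space \<pi>' = space M \<times> space M"
      using sets_eq_imp_space_eq[OF s(1)] sets_eq_imp_space_eq[OF s(2)] by (auto simp: space_pair_measure)
    have "?T \<le> (\<integral>\<^sup>+z. ?D z \<partial>\<pi>')"
      unfolding transport_dist_def by (rule INF_lower[OF \<pi>'])
    also have "\<dots> \<le> (\<integral>\<^sup>+z. A * c z \<partial>\<pi>')"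
      using DA by (intro nn_integral_mono) (auto simp: sp)
    also have "\<dots> = A * (\<integral>\<^sup>+z. c z \<partial>\<pi>')" by (rule nn_integral_cmult) measurable
    also have "\<dots> \<le> A * (\<kappa> ^ n * (\<integral>\<^sup>+z. c z \<partial>\<pi>))" by (rule mult_left_mono[OF le]) simp
    also have "(\<integral>\<^sup>+z. c z \<partial>\<pi>) \<le> (\<integral>\<^sup>+z. B * ?D z \<partial>\<pi>)"
      using DB by (intro nn_integral_mono) (auto simp: sp)
    also have "(\<integral>\<^sup>+z. B * ?D z \<partial>\<pi>) = B * (\<integral>\<^sup>+z. ?D z \<partial>\<pi>)"
      by (rule nn_integral_cmult) measurable
    finally have "?T \<le> A * (\<kappa> ^ n * (B * (\<integral>\<^sup>+z. ?D z \<partial>\<pi>)))"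
      by (simp add: mult_left_mono)
    then have "2 * ?T \<le> 2 * (A * (\<kappa> ^ n * (B * (\<integral>\<^sup>+z. ?D z \<partial>\<pi>))))" by (rule mult_left_mono) simp
    also have "\<dots> = (2 * (A * \<kappa> ^ n * B)) * (\<integral>\<^sup>+z. ?D z \<partial>\<pi>)" by (simp add: mult_ac)
    also have "\<dots> \<le> 1 * (\<integral>\<^sup>+z. ?D z \<partial>\<pi>)" by (rule mult_right_mono[OF n]) simp
    finally show "2 * ?T \<le> (\<integral>\<^sup>+z. ?D z \<partial>\<pi>)" by simp
  qed
  then have "1/2 * (2 * ?T) \<le> 1/2 * transport_dist D \<nu>1 \<nu>2" by (rule mult_left_mono) simp
  moreover have "1/2 * (2 * ?T) = ?T"
  proof -
    have "(1/2 :: ennreal) * 2 = 1" by (simp add: ennreal_divide_times)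
    then show ?thesis by (metis mult.assoc mult_1)
  qed
  ultimately show ?thesis by simp
qed

end

end

text \<open>
The coupled chain is started from the product of the two invariant measures. Its marginals do not
change, while the integral of \<open>min 1 (A * cost)\<close> tends to \<open>0\<close> by dominated convergence, even if \<open>cost\<close>
is not integrable. So both measures give the same integrals of Lipschitz functions.
\<close>

lemma unique_invariant_of_contraction:
  fixes S :: "'a::{real_normed_vector, second_countable_topology} set" and cost :: "'a \<Rightarrow> 'a \<Rightarrow> real" and A \<kappa> :: real
  assumes rm: "random_map (restrict_space borel S) W F" and S: "S \<in> sets borel"
    and cm[measurable]: "(\<lambda>z. cost (fst z) (snd z)) \<in> borel_measurable (restrict_space borel S \<Otimes>\<^sub>M restrict_space borel S)"
    and \<kappa>: "0 \<le> \<kappa>" "\<kappa> < 1" and A: "A \<ge> 0"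
    and cost0: "\<And>x y. x \<in> S \<Longrightarrow> y \<in> S \<Longrightarrow> 0 \<le> cost x y"
    and contr: "\<And>x y. x \<in> S \<Longrightarrow> y \<in> S \<Longrightarrow> (\<integral>\<^sup>+w. ennreal (cost (F x w) (F y w)) \<partial>W) \<le> ennreal \<kappa> * ennreal (cost x y)"
    and dom: "\<And>x y. x \<in> S \<Longrightarrow> y \<in> S \<Longrightarrow> min 1 (norm (x - y)) \<le> A * cost x y"
    and \<nu>: "\<nu>1 \<in> space (prob_algebra (restrict_space borel S))" "\<nu>2 \<in> space (prob_algebra (restrict_space borel S))"
    and inv: "\<nu>1 \<bind> random_map.kern (restrict_space borel S) W F = \<nu>1"
      "\<nu>2 \<bind> random_map.kern (restrict_space borel S) W F = \<nu>2"
  shows "\<nu>1 = \<nu>2"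
proof -
  let ?M = "restrict_space borel S"
  interpret random_map ?M W F by fact
  have spM: "space ?M = S" by (simp add: space_restrict_space)
  have s\<nu>[measurable_cong]: "sets \<nu>1 = sets ?M" "sets \<nu>2 = sets ?M" and p\<nu>: "prob_space \<nu>1" "prob_space \<nu>2"
    using \<nu> by (auto simp: space_prob_algebra)
  interpret N1: prob_space \<nu>1 by fact
  interpret N2: prob_space \<nu>2 by fact
  interpret N12: pair_prob_space \<nu>1 \<nu>2 ..
  have fixed: "kernel_steps kern n \<nu>1 = \<nu>1" "kernel_steps kern n \<nu>2 = \<nu>2" for n
    by (induction n) (simp_all add: kernel_steps_Suc inv, simp_all add: kernel_steps_def)
  let ?c = "\<lambda>z. ennreal (cost (fst z) (snd z))"
  have cM: "?c \<in> borel_measurable (?M \<Otimes>\<^sub>M ?M)" by measurable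
  have idm: "(\<lambda>x. x) \<in> ?M \<rightarrow>\<^sub>M borel" by (rule measurable_restrict_space1) simp
  define \<pi> where "\<pi> = \<nu>1 \<Otimes>\<^sub>M \<nu>2"
  have \<pi>: "\<pi> \<in> couplings \<nu>1 \<nu>2"
  proof -
    have "distr (\<nu>1 \<Otimes>\<^sub>M \<nu>2) \<nu>2 snd = \<nu>2"
    proof (rule measure_eqI)
      fix B assume "B \<in> sets (distr (\<nu>1 \<Otimes>\<^sub>M \<nu>2) \<nu>2 snd)"
      then have B: "B \<in> sets \<nu>2" by simp
      have "snd -` B \<inter> space (\<nu>1 \<Otimes>\<^sub>M \<nu>2) = space \<nu>1 \<times> B"
        using sets.sets_into_space[OF B] by (auto simp: space_pair_measure)
      then show "emeasure (distr (\<nu>1 \<Otimes>\<^sub>M \<nu>2) \<nu>2 snd) B = emeasure \<nu>2 B"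
        using B by (simp add: emeasure_distr N2.emeasure_pair_measure_Times N1.emeasure_space_1)
    qed simp
    then show ?thesis
      unfolding couplings_def \<pi>_def by (simp add: N2.distr_pair_fst)
  qed
  have \<pi>s[measurable_cong]: "sets \<pi> = sets (?M \<Otimes>\<^sub>M ?M)"
    unfolding \<pi>_def by (rule sets_pair_measure_cong[OF s\<nu>])
  define J where "J n = (\<integral>\<^sup>+z. min 1 (ennreal A * (ennreal \<kappa> ^ n * ?c z)) \<partial>\<pi>)" for n
  have J: "J \<longlonglongrightarrow> 0"
  proof -
    have "(\<lambda>n. \<integral>\<^sup>+z. min 1 (ennreal A * (ennreal \<kappa> ^ n * ?c z)) \<partial>\<pi>) \<longlonglongrightarrow> (\<integral>\<^sup>+z. 0 \<partial>\<pi>)"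
    proof (rule nn_integral_dominated_convergence[where w="\<lambda>_. 1"])
      show "(\<integral>\<^sup>+z. 1 \<partial>\<pi>) < \<infinity>" unfolding \<pi>_def by (simp add: N12.emeasure_space_1)
      show "AE z in \<pi>. (\<lambda>n. min 1 (ennreal A * (ennreal \<kappa> ^ n * ?c z))) \<longlonglongrightarrow> 0"
      proof (rule AE_I2)
        fix z assume "z \<in> space \<pi>"
        then have z: "cost (fst z) (snd z) \<ge> 0"
          using cost0 sets_eq_imp_space_eq[OF \<pi>s] by (auto simp: space_pair_measure spM)
        have "(\<lambda>n. min 1 (A * (\<kappa> ^ n * cost (fst z) (snd z)))) \<longlonglongrightarrow> min 1 (A * (0 * cost (fst z) (snd z)))"
          by (intro tendsto_intros LIMSEQ_realpow_zero \<kappa>)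
        then have "(\<lambda>n. ennreal (min 1 (A * (\<kappa> ^ n * cost (fst z) (snd z))))) \<longlonglongrightarrow> ennreal 0"
          by (intro tendsto_ennrealI) simp
        moreover have "ennreal (min 1 (A * (\<kappa> ^ n * cost (fst z) (snd z)))) = min 1 (ennreal A * (ennreal \<kappa> ^ n * ?c z))" for n
          using z A \<kappa> by (simp add: ennreal_min_one ennreal_mult ennreal_power)
        ultimately show "(\<lambda>n. min 1 (ennreal A * (ennreal \<kappa> ^ n * ?c z))) \<longlonglongrightarrow> 0" by simp
      qed
    qed (auto intro!: AE_I2)
    then show ?thesis by (simp add: J_def[abs_def])
  qed
  have eqb: "distr \<nu>1 borel (\<lambda>x. x) = distr \<nu>2 borel (\<lambda>x. x)"
  proof (rule prob_measure_eqI_lipschitz)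
    have m1: "(\<lambda>x. x) \<in> \<nu>1 \<rightarrow>\<^sub>M borel" "(\<lambda>x. x) \<in> \<nu>2 \<rightarrow>\<^sub>M borel" using idm by measurable
    show "prob_space (distr \<nu>1 borel (\<lambda>x. x))" "prob_space (distr \<nu>2 borel (\<lambda>x. x))"
      by (intro N1.prob_space_distr N2.prob_space_distr m1)+
    fix f :: "'a \<Rightarrow> real" and L assume lip: "L-lipschitz_on UNIV f" and bd: "\<And>z. 0 \<le> f z \<and> f z \<le> 1"
    have L0: "L \<ge> 0" using lip by (rule lipschitz_on_nonneg)
    have fm: "f \<in> borel_measurable borel"
      by (rule borel_measurable_continuous_onI[OF lipschitz_on_continuous_on[OF lip]])
    have fM[measurable]: "f \<in> borel_measurable ?M" by (rule measurable_restrict_space1[OF fm])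
    have diff: "\<bar>f x - f y\<bar> \<le> (1 + L) * min 1 (norm (x - y))" for x y
    proof (cases "norm (x - y) \<le> 1")
      case True
      have "\<bar>f x - f y\<bar> \<le> L * norm (x - y)"
        using lipschitz_onD[OF lip, of x y] by (simp add: dist_norm)
      also have "\<dots> \<le> (1 + L) * norm (x - y)" by (simp add: mult_right_mono)
      finally show ?thesis using True by (simp add: min_def)
    next
      case False
      have "\<bar>f x - f y\<bar> \<le> 1" using bd[of x] bd[of y] by (simp add: abs_le_iff) 
      then show ?thesis using False L0 by (simp add: min_def)
    qed
    have bound: "ennreal \<bar>(\<integral>x. f x \<partial>\<nu>1) - (\<integral>x. f x \<partial>\<nu>2)\<bar> \<le> ennreal (1 + L) * J n" for n
    proof -
      obtain \<pi>' where \<pi>': "\<pi>' \<in> couplings \<nu>1 \<nu>2"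
        and le: "(\<integral>\<^sup>+z. min 1 (ennreal A * ?c z) \<partial>\<pi>') \<le> J n"
        using coupling_steps[where c="?c" and \<kappa>="ennreal \<kappa>" and n=n, OF cM _ \<pi> \<nu>] contr
        unfolding fixed J_def spM by auto
      have p': "\<pi>' \<in> space (prob_algebra (?M \<Otimes>\<^sub>M ?M))" by (rule coupling_prob[OF \<pi>' \<nu>])
      then have s'[measurable_cong]: "sets \<pi>' = sets (?M \<Otimes>\<^sub>M ?M)" and pp: "prob_space \<pi>'" by (auto simp: space_prob_algebra)
      interpret P: prob_space \<pi>' by fact
      have sp': "space \<pi>' = S \<times> S" using sets_eq_imp_space_eq[OF s'] by (simp add: space_pair_measure spM)
      have i: "integrable \<pi>' (\<lambda>z. f (fst z))" "integrable \<pi>' (\<lambda>z. f (snd z))"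
        by (rule P.integrable_const_bound[where B=1]; use bd in simp)+
      have m: "distr \<pi>' \<nu>1 fst = \<nu>1" "distr \<pi>' \<nu>2 snd = \<nu>2" using \<pi>' by (auto simp: couplings_def)
      have e1: "(\<integral>x. f x \<partial>\<nu>1) = (\<integral>z. f (fst z) \<partial>\<pi>')"
        by (subst m(1)[symmetric], subst integral_distr) auto
      have e2: "(\<integral>x. f x \<partial>\<nu>2) = (\<integral>z. f (snd z) \<partial>\<pi>')"
        by (subst m(2)[symmetric], subst integral_distr) auto
      have "(\<integral>x. f x \<partial>\<nu>1) - (\<integral>x. f x \<partial>\<nu>2) = (\<integral>z. f (fst z) - f (snd z) \<partial>\<pi>')"
        unfolding e1 e2 using i by simp
      then have "ennreal \<bar>(\<integral>x. f x \<partial>\<nu>1) - (\<integral>x. f x \<partial>\<nu>2)\<bar> \<le> (\<integral>\<^sup>+z. norm (f (fst z) - f (snd z)) \<partial>\<pi>')"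
        using integral_norm_bound_ennreal[of \<pi>' "\<lambda>z. f (fst z) - f (snd z)"] i by simp
      also have "\<dots> \<le> (\<integral>\<^sup>+z. ennreal (1 + L) * min 1 (ennreal A * ?c z) \<partial>\<pi>')"
      proof (rule nn_integral_mono)
        fix z assume "z \<in> space \<pi>'"
        then have z: "fst z \<in> S" "snd z \<in> S" by (auto simp: sp')
        have "min 1 (norm (fst z - snd z)) \<le> min 1 (A * cost (fst z) (snd z))"
          using dom[OF z] by simp
        then have "(1 + L) * min 1 (norm (fst z - snd z)) \<le> (1 + L) * min 1 (A * cost (fst z) (snd z))"
          using L0 by (intro mult_left_mono) auto
        then have "ennreal (norm (f (fst z) - f (snd z))) \<le> ennreal ((1 + L) * min 1 (A * cost (fst z) (snd z)))"
          using diff[of "fst z" "snd z"] by (intro ennreal_leI) simp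
        also have "\<dots> = ennreal (1 + L) * min 1 (ennreal A * ?c z)"
          using L0 A cost0[OF z] by (simp add: ennreal_min_one ennreal_mult)
        finally show "ennreal (norm (f (fst z) - f (snd z))) \<le> ennreal (1 + L) * min 1 (ennreal A * ?c z)" .
      qed
      also have "\<dots> = ennreal (1 + L) * (\<integral>\<^sup>+z. min 1 (ennreal A * ?c z) \<partial>\<pi>')"
        by (rule nn_integral_cmult) measurable
      also have "\<dots> \<le> ennreal (1 + L) * J n" by (rule mult_left_mono[OF le]) simp
      finally show ?thesis .
    qed
    have "(\<lambda>n. ennreal (1 + L) * J n) \<longlonglongrightarrow> ennreal (1 + L) * 0"
      by (rule ennreal_tendsto_cmult[OF _ J]) simp
    then have "ennreal \<bar>(\<integral>x. f x \<partial>\<nu>1) - (\<integral>x. f x \<partial>\<nu>2)\<bar> \<le> 0"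
      using bound by (intro Lim_bounded2[where f="\<lambda>n. ennreal (1 + L) * J n" and N=0]) auto
    then have "(\<integral>x. f x \<partial>\<nu>1) = (\<integral>x. f x \<partial>\<nu>2)" by simp
    then show "(\<integral>z. f z \<partial>distr \<nu>1 borel (\<lambda>x. x)) = (\<integral>z. f z \<partial>distr \<nu>2 borel (\<lambda>x. x))"
      using integral_distr[OF m1(1) fm] integral_distr[OF m1(2) fm] by simp
  qed simp_all
  show ?thesis
  proof (rule measure_eqI)
    show "sets \<nu>1 = sets \<nu>2" using s\<nu> by simp
    fix B assume "B \<in> sets \<nu>1"
    then have B: "B \<in> sets borel" "B \<subseteq> S" using S by (auto simp: s\<nu> sets_restrict_space_iff)
    have m1: "(\<lambda>x. x) \<in> \<nu>1 \<rightarrow>\<^sub>M borel" "(\<lambda>x. x) \<in> \<nu>2 \<rightarrow>\<^sub>M borel" using idm by measurable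
    have sp: "space \<nu>1 = S" "space \<nu>2 = S"
      using sets_eq_imp_space_eq[OF s\<nu>(1)] sets_eq_imp_space_eq[OF s\<nu>(2)] by (auto simp: spM)
    have "emeasure \<nu>1 B = emeasure (distr \<nu>1 borel (\<lambda>x. x)) B"
      using B m1 by (simp add: emeasure_distr sp Int_absorb2)
    also have "\<dots> = emeasure \<nu>2 B"
      unfolding eqb using B m1 by (simp add: emeasure_distr sp Int_absorb2)
    finally show "emeasure \<nu>1 B = emeasure \<nu>2 B" .
  qed
qed

section \<open>The pCN chain as a random map\<close>

definition unif :: "real measure" where
  "unif = uniform_measure lborel {0..1}"

definition pcn_prop :: "real \<Rightarrow> 'a::real_vector \<Rightarrow> 'a \<Rightarrow> 'a" where
  "pcn_prop \<delta> x \<xi> = sqrt (1 - 2 * \<delta>) *\<^sub>R x + sqrt (2 * \<delta>) *\<^sub>R \<xi>"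

text \<open>
The second component of \<open>w\<close> is uniform on \<open>[0, 1]\<close> and decides about acceptance.
\<close>

definition pcn_step :: "real \<Rightarrow> ('a::real_vector \<Rightarrow> real) \<Rightarrow> 'a \<Rightarrow> 'a \<times> real \<Rightarrow> 'a" where
  "pcn_step \<delta> \<Phi> x w = (if snd w < accept_prob \<Phi> x (pcn_prop \<delta> x (fst w)) then pcn_prop \<delta> x (fst w) else x)"

text \<open>
Proposals from a stationary draw are reversible. The covariance of a state and its proposal
is symmetric because \<open>(1 - 2 \<delta>) + 2 \<delta> = 1\<close>.
\<close>

definition reversible_proposal :: "real \<Rightarrow> 'a::real_vector measure \<Rightarrow> bool" where
  "reversible_proposal \<delta> g \<longleftrightarrow>
     distr (g \<Otimes>\<^sub>M g) (g \<Otimes>\<^sub>M g) (\<lambda>p. (fst p, pcn_prop \<delta> (fst p) (snd p)))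
   = distr (g \<Otimes>\<^sub>M g) (g \<Otimes>\<^sub>M g) (\<lambda>p. (pcn_prop \<delta> (fst p) (snd p), fst p))"

lemma sets_unif[simp, measurable_cong]: "sets unif = sets borel"
  by (simp add: unif_def)

lemma space_unif[simp]: "space unif = UNIV"
  by (simp add: unif_def)

lemma prob_space_unif: "prob_space unif"
  unfolding unif_def by (rule prob_space_uniform_measure) auto

lemma emeasure_unif_Ico: "0 \<le> a \<Longrightarrow> a \<le> b \<Longrightarrow> b \<le> 1 \<Longrightarrow> emeasure unif {u. a \<le> u \<and> u < b} = ennreal (b - a)"
proof -
  assume a: "0 \<le> a" "a \<le> b" "b \<le> 1"
  have "{u. a \<le> u \<and> u < b} = {a..<b}" by auto
  moreover have "{0..1} \<inter> {a..<b} = {a..<b}" using a by auto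
  ultimately show ?thesis using a by (simp add: unif_def divide_ennreal_def)
qed

lemma emeasure_unif_less: "0 \<le> a \<Longrightarrow> a \<le> 1 \<Longrightarrow> emeasure unif {u. u < a} = ennreal a"
proof -
  assume a: "0 \<le> a" "a \<le> 1"
  have "{0..1} \<inter> {u. u < a} = {0..<a}" using a by auto
  then show ?thesis using a by (simp add: unif_def divide_ennreal_def)
qed

lemma bernoulli_eq_unif:
  assumes a: "0 \<le> a" "a \<le> 1"
  shows "measure_pmf (bernoulli_pmf a) = distr unif (count_space UNIV) (\<lambda>u. u < a)"
proof (rule measure_eqI_finite)
  interpret U: prob_space unif by (rule prob_space_unif)
  show "sets (measure_pmf (bernoulli_pmf a)) = Pow UNIV" "sets (distr unif (count_space UNIV) (\<lambda>u. u < a)) = Pow UNIV"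
    by auto
  fix b :: bool
  have T: "emeasure unif {u. u < a} = ennreal a" by (rule emeasure_unif_less[OF a])
  have m: "{u. u < a} \<in> sets unif" by simp
  have "measure unif {u. u < a} = a" using T a by (simp add: measure_def)
  then have F: "emeasure unif (UNIV - {u. u < a}) = ennreal (1 - a)"
    using U.prob_compl[OF m] by (simp add: U.emeasure_eq_measure)
  show "emeasure (measure_pmf (bernoulli_pmf a)) {b} = emeasure (distr unif (count_space UNIV) (\<lambda>u. u < a)) {b}"
  proof (cases b)
    case True
    have "(\<lambda>u. u < a) -` {True} = {u. u < a}" by auto
    then show ?thesis using True a T by (simp add: emeasure_pmf_single emeasure_distr)
  next
    case False
    have "(\<lambda>u. u < a) -` {False} = UNIV - {u. u < a}" by auto
    then show ?thesis using False a F by (simp add: emeasure_pmf_single emeasure_distr)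
  qed
qed simp

lemma accept_prob_01: "0 < accept_prob \<Phi> x y" "accept_prob \<Phi> x y \<le> 1"
  by (auto simp: accept_prob_def)

text \<open>
On the negative half-line \<open>exp\<close> has slope at most \<open>1\<close>, and on the positive one \<open>min 1 \<circ> exp\<close> is constant.
\<close>

lemma min_one_exp_lipschitz: "\<bar>min 1 (exp a) - min 1 (exp b)\<bar> \<le> \<bar>a - b :: real\<bar>"
proof -
  have *: "min 1 (exp b) - min 1 (exp a) \<le> b - a" if "a \<le> b" for a b :: real
  proof (cases "a \<ge> 0")
    case True then show ?thesis using that by simp
  next
    case False
    define b' where "b' = min 0 b"
    have ab: "a \<le> b'" "b' \<le> 0" "b' \<le> b" using that False by (auto simp: b'_def)
    have "min 1 (exp b) = exp b'" by (auto simp: b'_def min_def)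
    moreover have "min 1 (exp a) = exp a" using False by simp
    moreover have "exp b' - exp a \<le> b' - a"
    proof -
      have "exp b' - exp a = exp b' * (1 - exp (a - b'))" by (simp add: algebra_simps flip: exp_add)
      also have "\<dots> \<le> 1 * (1 - exp (a - b'))" using ab by (intro mult_right_mono) auto
      also have "1 * (1 - exp (a - b')) = 1 - exp (a - b')" by simp
      also have "\<dots> \<le> b' - a" using exp_ge_add_one_self[of "a - b'"] by linarith
      finally show ?thesis .
    qed
    ultimately show ?thesis using ab by linarith
  qed
  show ?thesis
  proof (cases "a \<le> b")
    case True
    have "min 1 (exp a) \<le> min 1 (exp b)" using True by (simp add: min_def)
    then show ?thesis using *[OF True] True by linarith
  next
    case False
    then have ba: "b \<le> a" by simp
    have "min 1 (exp b) \<le> min 1 (exp a)" using ba by (simp add: min_def)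
    then show ?thesis using *[OF ba] ba by linarith
  qed
qed

text \<open>
The chain on a closed subspace \<open>S\<close> with noise \<open>g\<close>. The parameters \<open>mom\<close> and \<open>small\<close> bound the exponential
moments of the noise above and the mass of balls below; as they are not tied to \<open>S\<close> or \<open>g\<close>, constants
computed from them are the same for all \<open>S\<close> and \<open>g\<close>.
\<close>

locale pcn =
  fixes S :: "'a::{real_inner, polish_space} set" and g :: "'a measure" and \<Phi> :: "'a \<Rightarrow> real"
    and L \<delta> :: real and mom small :: "real \<Rightarrow> real"
  assumes subS: "subspace S" and clS: "closed S"
    and g: "g \<in> space (prob_algebra (restrict_space borel S))"
    and lip: "L-lipschitz_on UNIV \<Phi>" and \<delta>: "0 < \<delta>" "\<delta> \<le> 1/2"
    and mom: "\<And>w. 0 \<le> w \<Longrightarrow> (\<integral>\<^sup>+\<xi>. ennreal (exp (w * norm \<xi>)) \<partial>g) \<le> ennreal (mom w)"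
    and small: "\<And>s. 0 < s \<Longrightarrow> small s \<le> measure g {\<xi>\<in>S. norm \<xi> < s}"
begin

abbreviation M :: "'a measure" where "M \<equiv> restrict_space borel S"
abbreviation W :: "('a \<times> real) measure" where "W \<equiv> g \<Otimes>\<^sub>M unif"
abbreviation F :: "'a \<Rightarrow> 'a \<times> real \<Rightarrow> 'a" where "F \<equiv> pcn_step \<delta> \<Phi>"
abbreviation c :: real where "c \<equiv> sqrt (1 - 2 * \<delta>)"
abbreviation \<theta> :: real where "\<theta> \<equiv> sqrt (2 * \<delta>)"

lemma sets_g[measurable_cong]: "sets g = sets M"
  using g by (simp add: space_prob_algebra)

lemma space_M: "space M = S" by (simp add: space_restrict_space)

lemma space_g[simp]: "space g = S"
  using sets_eq_imp_space_eq[OF sets_g] by (simp add: space_M)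

lemma S_borel: "S \<in> sets borel" using clS by simp

sublocale prob_space g using g by (simp add: space_prob_algebra)
sublocale U: prob_space unif by (rule prob_space_unif)
sublocale W: pair_prob_space g unif ..

lemma c01: "0 \<le> c" "c < 1" and \<theta>0: "0 < \<theta>"
  using \<delta> by auto

lemma L0: "L \<ge> 0" using lip by (rule lipschitz_on_nonneg)

lemma \<Phi>_diff: "\<bar>\<Phi> x - \<Phi> y\<bar> \<le> L * norm (x - y)"
  using lipschitz_onD[OF lip, of x y] by (simp add: dist_norm)

lemma \<Phi>_borel[measurable]: "\<Phi> \<in> borel_measurable borel"
  by (rule borel_measurable_continuous_onI[OF lipschitz_on_continuous_on[OF lip]])

lemma id_M[measurable]: "(\<lambda>x. x) \<in> M \<rightarrow>\<^sub>M borel"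
  by (rule measurable_restrict_space1) simp

lemma measurable_MI: "f \<in> N \<rightarrow>\<^sub>M borel \<Longrightarrow> (\<And>x. x \<in> space N \<Longrightarrow> f x \<in> S) \<Longrightarrow> f \<in> N \<rightarrow>\<^sub>M M"
  by (rule measurable_restrict_space2) auto

lemma prop_S: "x \<in> S \<Longrightarrow> \<xi> \<in> S \<Longrightarrow> pcn_prop \<delta> x \<xi> \<in> S"
  unfolding pcn_prop_def using subS by (intro subspace_add subspace_scale)

lemma F_S: "x \<in> S \<Longrightarrow> fst w \<in> S \<Longrightarrow> F x w \<in> S"
  by (simp add: pcn_step_def prop_S)

lemma F_measurable: "(\<lambda>(x, w). F x w) \<in> M \<Otimes>\<^sub>M W \<rightarrow>\<^sub>M M"
proof (rule measurable_MI)
  have [measurable]: "(\<lambda>z. fst z) \<in> M \<Otimes>\<^sub>M W \<rightarrow>\<^sub>M borel" "(\<lambda>z. fst (snd z)) \<in> M \<Otimes>\<^sub>M W \<rightarrow>\<^sub>M borel"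
    by (rule measurable_compose[OF _ id_M], measurable)+
  show "(\<lambda>(x, w). F x w) \<in> borel_measurable (M \<Otimes>\<^sub>M W)"
    unfolding pcn_step_def pcn_prop_def accept_prob_def by measurable
  show "(case z of (x, w) \<Rightarrow> F x w) \<in> S" if "z \<in> space (M \<Otimes>\<^sub>M W)" for z
    using that by (auto simp: space_pair_measure space_M intro!: F_S)
qed

sublocale rm: random_map M W F
  by unfold_locales (rule F_measurable)

lemma F_M: "x \<in> S \<Longrightarrow> F x \<in> W \<rightarrow>\<^sub>M M"
  using rm.F_sect by (simp add: space_M)

lemma F_borel: "x \<in> S \<Longrightarrow> F x \<in> W \<rightarrow>\<^sub>M borel"
  using measurable_compose[OF F_M id_M] by simp

lemma fst_borel[measurable]: "(\<lambda>z. fst z) \<in> W \<rightarrow>\<^sub>M borel"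
  by (rule measurable_compose[OF _ id_M]) measurable

text \<open>
Flipping a coin with success probability \<open>p\<close> amounts to testing whether a uniform variable is below \<open>p\<close>.
\<close>

lemma kernel_eq:
  assumes x: "x \<in> S" shows "pcn_kernel \<delta> \<Phi> g x = rm.kern x"
proof -
  note Fx = F_M[OF x]
  have Fg: "F x \<in> W \<rightarrow>\<^sub>M g" using Fx measurable_cong_sets[OF refl sets_g] by blast
  have Fu: "(\<lambda>u. F x (\<xi>, u)) \<in> unif \<rightarrow>\<^sub>M g" if "\<xi> \<in> S" for \<xi>
    by (rule measurable_compose[OF measurable_Pair1' Fg]) (simp add: that)
  have "pcn_kernel \<delta> \<Phi> g x = g \<bind> (\<lambda>\<xi>. distr unif g (\<lambda>u. F x (\<xi>, u)))"
    unfolding pcn_kernel_def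
  proof (rule bind_cong[OF refl])
    fix \<xi> assume "\<xi> \<in> space g"
    then have \<xi>: "\<xi> \<in> S" by simp
    let ?p = "pcn_prop \<delta> x \<xi>"
    let ?a = "accept_prob \<Phi> x ?p"
    have pS: "?p \<in> S" by (rule prop_S[OF x \<xi>])
    have "distr (measure_pmf (bernoulli_pmf ?a)) g (\<lambda>b. if b then ?p else x)
        = distr unif g ((\<lambda>b. if b then ?p else x) \<circ> (\<lambda>u. u < ?a))"
      unfolding bernoulli_eq_unif[OF accept_prob_01(1)[THEN less_imp_le] accept_prob_01(2)]
      using pS x by (intro distr_distr) auto
    also have "((\<lambda>b. if b then ?p else x) \<circ> (\<lambda>u. u < ?a)) = (\<lambda>u. F x (\<xi>, u))"
      by (auto simp: pcn_step_def)
    finally show "(let p = sqrt (1 - 2 * \<delta>) *\<^sub>R x + sqrt (2 * \<delta>) *\<^sub>R \<xi>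
          in distr (measure_pmf (bernoulli_pmf (accept_prob \<Phi> x p))) g (\<lambda>b. if b then p else x))
       = distr unif g (\<lambda>u. F x (\<xi>, u))"
      by (simp only: Let_def pcn_prop_def[symmetric])
  qed
  also have "\<dots> = rm.kern x"
  proof (rule measure_eqI)
    have km: "(\<lambda>\<xi>. distr unif g (\<lambda>u. F x (\<xi>, u))) \<in> g \<rightarrow>\<^sub>M subprob_algebra g"
    proof (rule measurable_distr2)
      show "(\<lambda>(\<xi>, u). F x (\<xi>, u)) \<in> g \<Otimes>\<^sub>M unif \<rightarrow>\<^sub>M g" using Fg by simp
      show "(\<lambda>\<xi>. unif) \<in> g \<rightarrow>\<^sub>M subprob_algebra unif"
        by (intro measurable_const) (simp add: space_subprob_algebra U.subprob_space_axioms)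
    qed
    have ne: "space g \<noteq> {}" by (rule not_empty)
    show "sets (g \<bind> (\<lambda>\<xi>. distr unif g (\<lambda>u. F x (\<xi>, u)))) = sets (rm.kern x)"
      by (subst sets_bind[where N=g]) (use ne in \<open>auto simp: rm.kern_def sets_g\<close>)
    fix A assume "A \<in> sets (g \<bind> (\<lambda>\<xi>. distr unif g (\<lambda>u. F x (\<xi>, u))))"
    then have A: "A \<in> sets g" by (subst (asm) sets_bind[where N=g]) (use ne in auto)
    then have AM: "A \<in> sets M" by (simp add: sets_g)
    have "emeasure (g \<bind> (\<lambda>\<xi>. distr unif g (\<lambda>u. F x (\<xi>, u)))) A = (\<integral>\<^sup>+\<xi>. emeasure (distr unif g (\<lambda>u. F x (\<xi>, u))) A \<partial>g)"
      by (rule emeasure_bind[OF ne km A])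
    also have "\<dots> = (\<integral>\<^sup>+\<xi>. emeasure unif (Pair \<xi> -` (F x -` A \<inter> space W)) \<partial>g)"
    proof (rule nn_integral_cong)
      fix \<xi> assume "\<xi> \<in> space g"
      then show "emeasure (distr unif g (\<lambda>u. F x (\<xi>, u))) A = emeasure unif (Pair \<xi> -` (F x -` A \<inter> space W))"
        using Fu A by (subst emeasure_distr) (auto simp: space_pair_measure vimage_def)
    qed
    also have "\<dots> = emeasure W (F x -` A \<inter> space W)"
      by (rule U.emeasure_pair_measure_alt[symmetric]) (rule measurable_sets[OF Fx AM])
    also have "\<dots> = emeasure (rm.kern x) A"
      unfolding rm.kern_def by (rule emeasure_distr[symmetric, OF Fx AM])
    finally show "emeasure (g \<bind> (\<lambda>\<xi>. distr unif g (\<lambda>u. F x (\<xi>, u)))) A = emeasure (rm.kern x) A" .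
  qed
  finally show ?thesis .
qed

lemma bind_kernel_eq:
  assumes "\<nu> \<in> space (prob_algebra M)" shows "\<nu> \<bind> pcn_kernel \<delta> \<Phi> g = \<nu> \<bind> rm.kern"
proof (rule bind_cong[OF refl])
  have "space \<nu> = S" using assms sets_eq_imp_space_eq[of \<nu> M] by (simp add: space_prob_algebra space_M)
  then show "pcn_kernel \<delta> \<Phi> g x = rm.kern x" if "x \<in> space \<nu>" for x using kernel_eq that by simp
qed

lemma kernel_steps_eq:
  assumes "\<nu> \<in> space (prob_algebra M)" shows "kernel_steps (pcn_kernel \<delta> \<Phi> g) n \<nu> = kernel_steps rm.kern n \<nu>"
proof (induction n)
  case (Suc n)
  then show ?case
    using bind_kernel_eq[OF rm.kernel_steps_prob[OF assms, of n]] by (simp add: kernel_steps_def)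
qed (simp add: kernel_steps_def)

section \<open>Reversibility\<close>

lemma integrable_exp_\<Phi>: "integrable g (\<lambda>x. exp (- \<Phi> x))"
proof (rule integrableI_bounded)
  show "(\<lambda>x. exp (- \<Phi> x)) \<in> borel_measurable g" by measurable
  have "(\<integral>\<^sup>+x. ennreal (norm (exp (- \<Phi> x))) \<partial>g) \<le> (\<integral>\<^sup>+x. ennreal (exp (- \<Phi> 0)) * ennreal (exp (L * norm x)) \<partial>g)"
  proof (rule nn_integral_mono)
    fix x
    have "- \<Phi> x \<le> - \<Phi> 0 + L * norm x" using \<Phi>_diff[of x 0] by simp
    then show "ennreal (norm (exp (- \<Phi> x))) \<le> ennreal (exp (- \<Phi> 0)) * ennreal (exp (L * norm x))"
      by (simp flip: ennreal_mult exp_add)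
  qed
  also have "\<dots> = ennreal (exp (- \<Phi> 0)) * (\<integral>\<^sup>+x. ennreal (exp (L * norm x)) \<partial>g)"
    by (rule nn_integral_cmult) measurable
  also have "\<dots> \<le> ennreal (exp (- \<Phi> 0)) * ennreal (mom L)" by (rule mult_left_mono[OF mom[OF L0]]) simp
  also have "\<dots> < \<infinity>" by (simp add: ennreal_mult_less_top)
  finally show "(\<integral>\<^sup>+x. ennreal (norm (exp (- \<Phi> x))) \<partial>g) < \<infinity>" .
qed

lemma normaliser_pos: "(\<integral>x. exp (- \<Phi> x) \<partial>g) > 0"
proof -
  have "(\<integral>x. exp (- \<Phi> x) \<partial>g) \<noteq> 0"
  proof
    assume "(\<integral>x. exp (- \<Phi> x) \<partial>g) = 0"
    then have "AE x in g. exp (- \<Phi> x) = 0"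
      using integrable_exp_\<Phi> by (subst (asm) integral_nonneg_eq_0_iff_AE) auto
    then have "AE x in g. False" by simp
    then show False by simp
  qed
  moreover have "(\<integral>x. exp (- \<Phi> x) \<partial>g) \<ge> 0" by simp
  ultimately show ?thesis by linarith
qed

lemma target_prob: "target g \<Phi> \<in> space (prob_algebra M)"
proof -
  have m: "(\<lambda>x. ennreal (exp (- \<Phi> x) / (\<integral>z. exp (- \<Phi> z) \<partial>g))) \<in> borel_measurable g" by measurable
  have "prob_space (target g \<Phi>)"
  proof (rule prob_spaceI)
    have "emeasure (target g \<Phi>) (space (target g \<Phi>)) = (\<integral>\<^sup>+x. ennreal (exp (- \<Phi> x) / (\<integral>z. exp (- \<Phi> z) \<partial>g)) \<partial>g)"
      unfolding target_def using m by (subst emeasure_density) (auto intro!: nn_integral_cong simp: indicator_def sets.top[of g, simplified])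
    also have "\<dots> = ennreal (\<integral>x. exp (- \<Phi> x) / (\<integral>z. exp (- \<Phi> z) \<partial>g) \<partial>g)"
      using integrable_exp_\<Phi> normaliser_pos by (intro nn_integral_eq_integral) auto
    also have "\<dots> = 1" using normaliser_pos by simp
    finally show "emeasure (target g \<Phi>) (space (target g \<Phi>)) = 1" .
  qed
  then show ?thesis by (simp add: space_prob_algebra target_def sets_g)
qed

lemma nn_integral_accept:
  assumes x: "x \<in> S" and h[measurable]: "h \<in> borel_measurable M"
  shows "(\<integral>\<^sup>+w. h (F x w) \<partial>W) = (\<integral>\<^sup>+\<xi>. ennreal (accept_prob \<Phi> x (pcn_prop \<delta> x \<xi>)) * h (pcn_prop \<delta> x \<xi>)
       + ennreal (1 - accept_prob \<Phi> x (pcn_prop \<delta> x \<xi>)) * h x \<partial>g)"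
proof -
  note Fx = F_M[OF x]
  have m: "(\<lambda>w. h (F x w)) \<in> borel_measurable W" using Fx by measurable
  have "(\<integral>\<^sup>+w. h (F x w) \<partial>W) = (\<integral>\<^sup>+\<xi>. \<integral>\<^sup>+u. h (F x (\<xi>, u)) \<partial>unif \<partial>g)"
    by (rule U.nn_integral_fst[symmetric, OF m])
  also have "\<dots> = (\<integral>\<^sup>+\<xi>. ennreal (accept_prob \<Phi> x (pcn_prop \<delta> x \<xi>)) * h (pcn_prop \<delta> x \<xi>)
       + ennreal (1 - accept_prob \<Phi> x (pcn_prop \<delta> x \<xi>)) * h x \<partial>g)"
  proof (rule nn_integral_cong)
    fix \<xi>
    let ?a = "accept_prob \<Phi> x (pcn_prop \<delta> x \<xi>)" and ?p = "pcn_prop \<delta> x \<xi>"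
    have a: "0 \<le> ?a" "?a \<le> 1" using accept_prob_01[of \<Phi> x ?p] by auto
    have ms: "{u. u < ?a} \<in> sets unif" by simp
    have T: "emeasure unif {u. u < ?a} = ennreal ?a" by (rule emeasure_unif_less[OF a])
    then have "measure unif {u. u < ?a} = ?a" using a by (simp add: measure_def)
    then have Fl: "emeasure unif (UNIV - {u. u < ?a}) = ennreal (1 - ?a)"
      using U.prob_compl[OF ms] by (simp add: U.emeasure_eq_measure)
    have "(\<integral>\<^sup>+u. h (F x (\<xi>, u)) \<partial>unif) = (\<integral>\<^sup>+u. h ?p * indicator {u. u < ?a} u + h x * indicator (UNIV - {u. u < ?a}) u \<partial>unif)"
      by (intro nn_integral_cong) (simp add: pcn_step_def indicator_def)
    also have "\<dots> = h ?p * ennreal ?a + h x * ennreal (1 - ?a)"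
      by (subst nn_integral_add) (auto simp: nn_integral_cmult_indicator T Fl)
    finally show "(\<integral>\<^sup>+u. h (F x (\<xi>, u)) \<partial>unif) = ennreal ?a * h ?p + ennreal (1 - ?a) * h x"
      by (simp add: mult.commute)
  qed
  finally show ?thesis .
qed

text \<open>
Detailed balance: the right-hand side is symmetric in \<open>x\<close> and \<open>y\<close>.
\<close>

lemma exp_accept: "exp (- \<Phi> x) * accept_prob \<Phi> x y = min (exp (- \<Phi> x)) (exp (- \<Phi> y))"
  unfolding accept_prob_def
  by (simp add: min_def flip: exp_add)

text \<open>
With \<open>mm x y = min (exp (- \<Phi> x)) (exp (- \<Phi> y)) / Z\<close> the accepted part of one step, started from the
target, is the integral of \<open>mm x p * indicator A p\<close>. Exchanging state and proposal turns it into
the integral of \<open>mm x p * indicator A x\<close>, the mass of the accepted proposals made from \<open>A\<close>; adding the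
rejected part gives the target measure of \<open>A\<close>.
\<close>

lemma target_invariant:
  assumes sym: "distr (g \<Otimes>\<^sub>M g) (g \<Otimes>\<^sub>M g) (\<lambda>p. (fst p, pcn_prop \<delta> (fst p) (snd p)))
      = distr (g \<Otimes>\<^sub>M g) (g \<Otimes>\<^sub>M g) (\<lambda>p. (pcn_prop \<delta> (fst p) (snd p), fst p))"
  shows "target g \<Phi> \<bind> rm.kern = target g \<Phi>"
proof (rule measure_eqI)
  let ?T = "target g \<Phi>"
  define Z where "Z = (\<integral>z. exp (- \<Phi> z) \<partial>g)"
  have Z: "Z > 0" unfolding Z_def by (rule normaliser_pos)
  have sT: "sets ?T = sets M" using target_prob by (simp add: space_prob_algebra)
  have sb: "sets (?T \<bind> rm.kern) = sets M" by (rule sets_bind'[OF target_prob rm.kern_measurable])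
  show "sets (?T \<bind> rm.kern) = sets ?T" using sT sb by simp
  fix A assume "A \<in> sets (?T \<bind> rm.kern)"
  then have A[measurable]: "A \<in> sets M" by (simp add: sb)
  let ?I = "indicator A :: 'a \<Rightarrow> ennreal" and ?p = "\<lambda>p. pcn_prop \<delta> (fst p) (snd p)"
  have I[measurable]: "?I \<in> borel_measurable M" by measurable
  have idg[measurable]: "(\<lambda>x. x) \<in> g \<rightarrow>\<^sub>M borel" by measurable
  have pm: "?p \<in> g \<Otimes>\<^sub>M g \<rightarrow>\<^sub>M M"
  proof (rule measurable_MI)
    have [measurable]: "(\<lambda>z. fst z) \<in> g \<Otimes>\<^sub>M g \<rightarrow>\<^sub>M borel" "(\<lambda>z. snd z) \<in> g \<Otimes>\<^sub>M g \<rightarrow>\<^sub>M borel"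
      by (rule measurable_compose[OF _ idg], measurable)+
    show "?p \<in> g \<Otimes>\<^sub>M g \<rightarrow>\<^sub>M borel"
      unfolding pcn_prop_def by measurable
  qed (auto simp: space_pair_measure intro!: prop_S)
  then have pm'[measurable]: "?p \<in> g \<Otimes>\<^sub>M g \<rightarrow>\<^sub>M g"
    using measurable_cong_sets[OF refl sets_g] by blast
  have ap[measurable]: "(\<lambda>p. accept_prob \<Phi> (fst p) (pcn_prop \<delta> (fst p) (snd p))) \<in> borel_measurable (g \<Otimes>\<^sub>M g)"
    unfolding accept_prob_def by measurable
  define mm where "mm x y = ennreal (min (exp (- \<Phi> x)) (exp (- \<Phi> y)) / Z)" for x y
  have mmm[measurable]: "(\<lambda>z. mm (fst z) (snd z)) \<in> borel_measurable (g \<Otimes>\<^sub>M g)" unfolding mm_def by measurable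
  have IA[measurable]: "(\<lambda>p. ?I (pcn_prop \<delta> (fst p) (snd p))) \<in> borel_measurable (g \<Otimes>\<^sub>M g)"
    by (rule measurable_compose[OF pm I])
  have I1[measurable]: "(\<lambda>p. ?I (fst p)) \<in> borel_measurable (g \<Otimes>\<^sub>M g)" "(\<lambda>p. ?I (snd p)) \<in> borel_measurable (g \<Otimes>\<^sub>M g)"
    by (rule measurable_compose[OF _ I], measurable)+
  have mmp[measurable]: "(\<lambda>p. mm (fst p) (pcn_prop \<delta> (fst p) (snd p))) \<in> borel_measurable (g \<Otimes>\<^sub>M g)"
    "(\<lambda>p. mm (pcn_prop \<delta> (fst p) (snd p)) (fst p)) \<in> borel_measurable (g \<Otimes>\<^sub>M g)"
    unfolding mm_def by measurable
  let ?a = "\<lambda>p. accept_prob \<Phi> (fst p) (pcn_prop \<delta> (fst p) (snd p))"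
  have Hm1: "(\<lambda>p. mm (fst p) (?p p) * ?I (?p p)) \<in> borel_measurable (g \<Otimes>\<^sub>M g)"
    by measurable
  have Hm2: "(\<lambda>p. ennreal (exp (- \<Phi> (fst p)) / Z * (1 - ?a p)) * ?I (fst p)) \<in> borel_measurable (g \<Otimes>\<^sub>M g)"
    by measurable
  have Hm3: "(\<lambda>p. mm (?p p) (fst p) * ?I (fst p)) \<in> borel_measurable (g \<Otimes>\<^sub>M g)"
    by measurable
  have Hm4: "(\<lambda>p. ennreal (exp (- \<Phi> (fst p)) / Z) * ?I (fst p)) \<in> borel_measurable (g \<Otimes>\<^sub>M g)"
    by measurable
  have Hm5: "(\<lambda>z. mm (fst z) (snd z) * ?I (snd z)) \<in> borel_measurable (g \<Otimes>\<^sub>M g)"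
    by measurable
  have Hd: "(\<lambda>p. (fst p, ?p p)) \<in> g \<Otimes>\<^sub>M g \<rightarrow>\<^sub>M g \<Otimes>\<^sub>M g"
    "(\<lambda>p. (?p p, fst p)) \<in> g \<Otimes>\<^sub>M g \<rightarrow>\<^sub>M g \<Otimes>\<^sub>M g"
    by measurable
  note Hm = borel_measurable_add[OF Hm1 Hm2]
  have "emeasure (?T \<bind> rm.kern) A = (\<integral>\<^sup>+x. emeasure (rm.kern x) A \<partial>?T)"
    by (rule emeasure_bind_prob_algebra[OF target_prob rm.kern_measurable A])
  also have "\<dots> = (\<integral>\<^sup>+x. ennreal (exp (- \<Phi> x) / Z) * emeasure (rm.kern x) A \<partial>g)"
    unfolding target_def Z_def[symmetric]
    by (rule nn_integral_density)
       (use measurable_emeasure_kernel[OF measurable_prob_algebraD[OF rm.kern_measurable] A] in \<open>auto cong: measurable_cong_sets\<close>)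
  also have "\<dots> = (\<integral>\<^sup>+x. \<integral>\<^sup>+\<xi>. mm x (pcn_prop \<delta> x \<xi>) * ?I (pcn_prop \<delta> x \<xi>)
       + ennreal (exp (- \<Phi> x) / Z * (1 - accept_prob \<Phi> x (pcn_prop \<delta> x \<xi>))) * ?I x \<partial>g \<partial>g)"
  proof (rule nn_integral_cong)
    fix x assume "x \<in> space g"
    then have x: "x \<in> S" by simp
    note Fx = F_M[OF x]
    have pmx: "pcn_prop \<delta> x \<in> g \<rightarrow>\<^sub>M g" 
      using measurable_compose_Pair1[of x g, OF _ pm'] x unfolding fst_conv snd_conv space_g by blast
    have [measurable]: "(\<lambda>\<xi>. accept_prob \<Phi> x (pcn_prop \<delta> x \<xi>)) \<in> borel_measurable g"
      using measurable_compose_Pair1[OF _ ap] x by simp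
    have [measurable]: "(\<lambda>\<xi>. ?I (pcn_prop \<delta> x \<xi>)) \<in> borel_measurable g"
      by (rule measurable_compose[OF pmx]) measurable
    have "emeasure (rm.kern x) A = (\<integral>\<^sup>+y. ?I y \<partial>rm.kern x)"
      by (simp add: rm.kern_def)
    also have "\<dots> = (\<integral>\<^sup>+w. ?I (F x w) \<partial>W)"
      unfolding rm.kern_def by (subst nn_integral_distr[OF Fx]) auto
    finally have "emeasure (rm.kern x) A = (\<integral>\<^sup>+\<xi>. ennreal (accept_prob \<Phi> x (pcn_prop \<delta> x \<xi>)) * ?I (pcn_prop \<delta> x \<xi>)
       + ennreal (1 - accept_prob \<Phi> x (pcn_prop \<delta> x \<xi>)) * ?I x \<partial>g)"
      using nn_integral_accept[OF x I] by simp
    then have "ennreal (exp (- \<Phi> x) / Z) * emeasure (rm.kern x) A = (\<integral>\<^sup>+\<xi>. ennreal (exp (- \<Phi> x) / Z) * (ennreal (accept_prob \<Phi> x (pcn_prop \<delta> x \<xi>)) * ?I (pcn_prop \<delta> x \<xi>)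
       + ennreal (1 - accept_prob \<Phi> x (pcn_prop \<delta> x \<xi>)) * ?I x) \<partial>g)"
      by (subst nn_integral_cmult) simp_all
    also have "\<dots> = (\<integral>\<^sup>+\<xi>. mm x (pcn_prop \<delta> x \<xi>) * ?I (pcn_prop \<delta> x \<xi>)
       + ennreal (exp (- \<Phi> x) / Z * (1 - accept_prob \<Phi> x (pcn_prop \<delta> x \<xi>))) * ?I x \<partial>g)"
    proof (rule nn_integral_cong)
      fix \<xi>
      let ?p = "pcn_prop \<delta> x \<xi>"
      have a: "0 \<le> accept_prob \<Phi> x ?p" "accept_prob \<Phi> x ?p \<le> 1" using accept_prob_01[of \<Phi> x ?p] by auto
      have 1: "ennreal (exp (- \<Phi> x) / Z) * ennreal (accept_prob \<Phi> x ?p) = mm x ?p"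
        using a Z unfolding mm_def exp_accept[symmetric] by (simp flip: ennreal_mult)
      have 2: "ennreal (exp (- \<Phi> x) / Z) * ennreal (1 - accept_prob \<Phi> x ?p) = ennreal (exp (- \<Phi> x) / Z * (1 - accept_prob \<Phi> x ?p))"
        using a Z by (intro ennreal_mult[symmetric]) auto
      show "ennreal (exp (- \<Phi> x) / Z) * (ennreal (accept_prob \<Phi> x ?p) * ?I ?p + ennreal (1 - accept_prob \<Phi> x ?p) * ?I x)
        = mm x ?p * ?I ?p + ennreal (exp (- \<Phi> x) / Z * (1 - accept_prob \<Phi> x ?p)) * ?I x"
        unfolding distrib_left mult.assoc[symmetric] 1 2 ..
    qed
    finally show "ennreal (exp (- \<Phi> x) / Z) * emeasure (rm.kern x) A = (\<integral>\<^sup>+\<xi>. mm x (pcn_prop \<delta> x \<xi>) * ?I (pcn_prop \<delta> x \<xi>)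
       + ennreal (exp (- \<Phi> x) / Z * (1 - accept_prob \<Phi> x (pcn_prop \<delta> x \<xi>))) * ?I x \<partial>g)" .
  qed
  also have "\<dots> = (\<integral>\<^sup>+p. mm (fst p) (?p p) * ?I (?p p)
       + ennreal (exp (- \<Phi> (fst p)) / Z * (1 - ?a p)) * ?I (fst p) \<partial>(g \<Otimes>\<^sub>M g))"
    using nn_integral_fst[OF Hm] by simp
  also have "\<dots> = (\<integral>\<^sup>+p. mm (fst p) (?p p) * ?I (?p p) \<partial>(g \<Otimes>\<^sub>M g))
       + (\<integral>\<^sup>+p. ennreal (exp (- \<Phi> (fst p)) / Z * (1 - ?a p)) * ?I (fst p) \<partial>(g \<Otimes>\<^sub>M g))"
    by (rule nn_integral_add[OF Hm1 Hm2])
  also have "(\<integral>\<^sup>+p. mm (fst p) (?p p) * ?I (?p p) \<partial>(g \<Otimes>\<^sub>M g))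
     = (\<integral>\<^sup>+z. mm (fst z) (snd z) * ?I (snd z) \<partial>distr (g \<Otimes>\<^sub>M g) (g \<Otimes>\<^sub>M g) (\<lambda>p. (fst p, ?p p)))"
    by (subst nn_integral_distr[OF Hd(1)]) (use Hm5 in \<open>simp_all only: fst_conv snd_conv measurable_distr_eq1\<close>)
  also have "\<dots> = (\<integral>\<^sup>+p. mm (?p p) (fst p) * ?I (fst p) \<partial>(g \<Otimes>\<^sub>M g))"
    unfolding sym[unfolded reversible_proposal_def] by (subst nn_integral_distr[OF Hd(2)]) (use Hm5 in \<open>simp_all only: fst_conv snd_conv measurable_distr_eq1\<close>)
  also have "\<dots> + (\<integral>\<^sup>+p. ennreal (exp (- \<Phi> (fst p)) / Z * (1 - ?a p)) * ?I (fst p) \<partial>(g \<Otimes>\<^sub>M g))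
     = (\<integral>\<^sup>+p. mm (?p p) (fst p) * ?I (fst p) + ennreal (exp (- \<Phi> (fst p)) / Z * (1 - ?a p)) * ?I (fst p) \<partial>(g \<Otimes>\<^sub>M g))"
    by (rule nn_integral_add[OF Hm3 Hm2, symmetric])
  also have "\<dots> = (\<integral>\<^sup>+p. ennreal (exp (- \<Phi> (fst p)) / Z) * ?I (fst p) \<partial>(g \<Otimes>\<^sub>M g))"
  proof (rule nn_integral_cong)
    fix p :: "'a \<times> 'a"
    have a: "0 \<le> ?a p" "?a p \<le> 1" using accept_prob_01[of \<Phi> "fst p"] by (auto simp: less_imp_le)
    have "mm (?p p) (fst p) = ennreal (exp (- \<Phi> (fst p)) / Z * ?a p)"
      unfolding mm_def using exp_accept[of "fst p" "?p p"] by (simp add: min.commute)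
    then have "mm (?p p) (fst p) + ennreal (exp (- \<Phi> (fst p)) / Z * (1 - ?a p))
      = ennreal (exp (- \<Phi> (fst p)) / Z * ?a p + exp (- \<Phi> (fst p)) / Z * (1 - ?a p))"
      using a Z by (simp add: ennreal_plus)
    also have "\<dots> = ennreal (exp (- \<Phi> (fst p)) / Z)"
      by (simp only: distrib_left[symmetric]) simp
    finally show "mm (?p p) (fst p) * ?I (fst p) + ennreal (exp (- \<Phi> (fst p)) / Z * (1 - ?a p)) * ?I (fst p)
      = ennreal (exp (- \<Phi> (fst p)) / Z) * ?I (fst p)"
      by (simp flip: distrib_right)
  qed
  also have "\<dots> = (\<integral>\<^sup>+x. \<integral>\<^sup>+\<xi>. ennreal (exp (- \<Phi> x) / Z) * ?I x \<partial>g \<partial>g)"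
    using nn_integral_fst[OF Hm4] by simp
  also have "\<dots> = (\<integral>\<^sup>+x. ennreal (exp (- \<Phi> x) / Z) * ?I x \<partial>g)"
    by (simp add: emeasure_space_1[simplified])
  also have "\<dots> = emeasure ?T A"
    unfolding target_def Z_def[symmetric] by (rule emeasure_density[symmetric]) (use A in \<open>auto simp: sets_g\<close>)
  finally show "emeasure (?T \<bind> rm.kern) A = emeasure ?T A" .
qed

section \<open>Contraction of the distance\<close>

text \<open>
The event on which, by the assumption \<open>acc\<close> of the lemmas below, all states accept their proposals.
\<close>

lemma prob_small_noise_ge:
  assumes s: "0 < s" and a: "0 \<le> a" "a \<le> 1"
  shows "small (s / \<theta>) * a \<le> measure W {w \<in> space W. \<theta> * norm (fst w) < s \<and> snd w < a}"
proof -
  have e: "{w \<in> space W. \<theta> * norm (fst w) < s \<and> snd w < a} = {\<xi>\<in>S. norm \<xi> < s / \<theta>} \<times> {u. u < a}"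
    using \<theta>0 by (auto simp: space_pair_measure field_simps)
  have m: "{\<xi>\<in>S. norm \<xi> < s / \<theta>} \<in> sets g"
  proof -
    have "{\<xi>\<in>space g. norm \<xi> < s / \<theta>} \<in> sets g" by measurable
    then show ?thesis by simp
  qed
  have "emeasure W ({\<xi>\<in>S. norm \<xi> < s / \<theta>} \<times> {u. u < a}) = emeasure g {\<xi>\<in>S. norm \<xi> < s / \<theta>} * ennreal a"
    using m by (simp add: U.emeasure_pair_measure_Times emeasure_unif_less[OF a])
  then have "measure W ({\<xi>\<in>S. norm \<xi> < s / \<theta>} \<times> {u. u < a}) = measure g {\<xi>\<in>S. norm \<xi> < s / \<theta>} * a"
    using a by (simp add: measure_def enn2real_mult)
  moreover have "small (s / \<theta>) \<le> measure g {\<xi>\<in>S. norm \<xi> < s / \<theta>}" using s \<theta>0 by (intro small) simp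
  ultimately show ?thesis using a e by (simp add: mult_right_mono)
qed

text \<open>
Exactly one of the two states accepts iff the uniform variable lies between the two acceptance
probabilities. Their distance is at most the increment of \<open>\<Phi>\<close> between the states plus that between the
proposals.
\<close>

lemma prob_disagreement_le:
  assumes x: "x \<in> S" and y: "y \<in> S"
  defines "\<alpha> \<equiv> \<lambda>x w. accept_prob \<Phi> x (pcn_prop \<delta> x (fst w))"
  shows "measure W {w \<in> space W. min (\<alpha> x w) (\<alpha> y w) \<le> snd w \<and> snd w < max (\<alpha> x w) (\<alpha> y w)} \<le> 2 * L * norm (x - y)"
    and "{w \<in> space W. min (\<alpha> x w) (\<alpha> y w) \<le> snd w \<and> snd w < max (\<alpha> x w) (\<alpha> y w)} \<in> sets W"
proof -
  let ?B = "{w \<in> space W. min (\<alpha> x w) (\<alpha> y w) \<le> snd w \<and> snd w < max (\<alpha> x w) (\<alpha> y w)}"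
  have [measurable]: "\<alpha> x \<in> borel_measurable W" for x
  proof -
    show ?thesis unfolding \<alpha>_def accept_prob_def pcn_prop_def by measurable
  qed
  show B: "?B \<in> sets W" by measurable
  have "emeasure W ?B = (\<integral>\<^sup>+\<xi>. emeasure unif (Pair \<xi> -` ?B) \<partial>g)"
    by (rule U.emeasure_pair_measure_alt[OF B])
  also have "\<dots> \<le> (\<integral>\<^sup>+\<xi>. ennreal (2 * L * norm (x - y)) \<partial>g)"
  proof (rule nn_integral_mono)
    fix \<xi> assume "\<xi> \<in> space g"
    let ?a = "\<alpha> x (\<xi>, 0)" and ?b = "\<alpha> y (\<xi>, 0)"
    have "Pair \<xi> -` ?B \<subseteq> {u. min ?a ?b \<le> u \<and> u < max ?a ?b}"
      by (auto simp: \<alpha>_def)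
    then have "emeasure unif (Pair \<xi> -` ?B) \<le> emeasure unif {u. min ?a ?b \<le> u \<and> u < max ?a ?b}"
      by (rule emeasure_mono) simp
    also have "\<dots> = ennreal (max ?a ?b - min ?a ?b)"
      using accept_prob_01 accept_prob_01(1)[THEN less_imp_le] by (intro emeasure_unif_Ico) (auto simp: \<alpha>_def min_def max_def)
    also have "max ?a ?b - min ?a ?b = \<bar>?a - ?b\<bar>" by (auto simp: max_def min_def)
    also have "\<bar>?a - ?b\<bar> \<le> \<bar>(\<Phi> x - \<Phi> (pcn_prop \<delta> x \<xi>)) - (\<Phi> y - \<Phi> (pcn_prop \<delta> y \<xi>))\<bar>"
      unfolding \<alpha>_def accept_prob_def using min_one_exp_lipschitz by simp
    also have "\<dots> \<le> \<bar>\<Phi> x - \<Phi> y\<bar> + \<bar>\<Phi> (pcn_prop \<delta> x \<xi>) - \<Phi> (pcn_prop \<delta> y \<xi>)\<bar>" by linarith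
    also have "\<dots> \<le> L * norm (x - y) + L * norm (pcn_prop \<delta> x \<xi> - pcn_prop \<delta> y \<xi>)"
      by (intro add_mono \<Phi>_diff)
    also have "norm (pcn_prop \<delta> x \<xi> - pcn_prop \<delta> y \<xi>) = c * norm (x - y)"
      using c01 by (simp add: pcn_prop_def flip: scaleR_diff_right)
    also have "L * norm (x - y) + L * (c * norm (x - y)) \<le> 2 * L * norm (x - y)"
      using mult_left_le_one_le[of "norm (x - y)" c] c01 mult_left_mono[OF _ L0, of "c * norm (x - y)" "norm (x - y)"] by simp
    finally show "emeasure unif (Pair \<xi> -` ?B) \<le> ennreal (2 * L * norm (x - y))" by (simp add: ennreal_leI)
  qed
  also have "\<dots> = ennreal (2 * L * norm (x - y))" by (simp add: emeasure_space_1[simplified])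
  finally show "measure W ?B \<le> 2 * L * norm (x - y)"
    using L0 by (simp add: W.emeasure_eq_measure)
qed

text \<open>
On \<open>G\<close> both states accept and \<open>f\<close> decreases by \<open>D = f r - f (c r)\<close>; on \<open>B\<close> exactly one accepts and \<open>f\<close>
increases by at most \<open>E = 1 - f r\<close>; elsewhere \<open>f\<close> does not increase. The inequality
\<open>D \<ge> E (1 - c) r / \<eta>\<close> shows that the exponential profile makes gain and loss comparable, and
\<open>\<eta>\<close> is chosen so small that the gain \<open>q D\<close> exceeds the loss \<open>2 L r E\<close> by \<open>r E\<close>.
\<close>

lemma distance_contraction:
  assumes x: "x \<in> S" and y: "y \<in> S" and s: "0 < s" and a: "0 < a" "a \<le> 1"
    and acc: "\<And>x \<xi>. \<theta> * norm \<xi> < s \<Longrightarrow> a \<le> accept_prob \<Phi> x (pcn_prop \<delta> x \<xi>)"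
    and q: "q = small (s / \<theta>) * a" "q > 0"
    and \<eta>: "\<eta> = q * (1 - c) / (2 * L + 1)"
    and f: "\<And>t. f t = 1 - exp (- t / \<eta>)" and r: "r = norm (x - y)"
  shows "(\<integral>\<^sup>+w. ennreal (f (norm (F x w - F y w))) \<partial>W) \<le> ennreal (f r - r * exp (- r / \<eta>))"
proof -
  have \<eta>0: "\<eta> > 0" unfolding \<eta> using q(2) c01 L0 by (simp add: add_nonneg_pos)
  define \<alpha> where "\<alpha> x (w :: 'a \<times> real) = accept_prob \<Phi> x (pcn_prop \<delta> x (fst w))" for x w
  define G where "G = {w \<in> space W. \<theta> * norm (fst w) < s \<and> snd w < a}"
  define B where "B = {w \<in> space W. min (\<alpha> x w) (\<alpha> y w) \<le> snd w \<and> snd w < max (\<alpha> x w) (\<alpha> y w)}"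
  define E where "E = exp (- r / \<eta>)"
  define D where "D = f r - f (c * r)"
  have r0: "r \<ge> 0" by (simp add: r)
  have Gm: "G \<in> sets W"
    unfolding G_def by measurable
  have Bm: "B \<in> sets W" unfolding B_def \<alpha>_def using prob_disagreement_le(2)[OF x y] .
  have qG: "q \<le> measure W G" unfolding q(1) G_def using prob_small_noise_ge[OF s, of a] a by simp
  have LB: "measure W B \<le> 2 * L * r" unfolding B_def \<alpha>_def r using prob_disagreement_le(1)[OF x y] .
  have f_mono: "f t \<le> f t'" if "t \<le> t'" for t t' using that \<eta>0 by (simp add: f divide_right_mono)
  have f1: "f t \<le> 1" for t by (simp add: f)
  have f0: "f t \<ge> 0" if "t \<ge> 0" for t using that \<eta>0 by (simp add: f)
  have D: "D \<ge> E * ((1 - c) * r / \<eta>)"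
  proof -
    have "D = E * (exp ((1 - c) * r / \<eta>) - 1)"
      by (simp add: D_def f E_def algebra_simps diff_divide_distrib flip: exp_add)
    also have "\<dots> \<ge> E * ((1 - c) * r / \<eta>)"
    proof (rule mult_left_mono)
      show "(1 - c) * r / \<eta> \<le> exp ((1 - c) * r / \<eta>) - 1"
        using exp_ge_add_one_self[of "(1 - c) * r / \<eta>"] by linarith
    qed (simp add: E_def)
    finally show ?thesis .
  qed
  have D0: "D \<ge> 0" unfolding D_def using f_mono[of "c * r" r] c01 r0 mult_left_le_one_le[of r c] by simp
  have E0: "E \<ge> 0" by (simp add: E_def)
  have point: "f (norm (F x w - F y w)) \<le> f r - D * indicator G w + E * indicator B w" if w: "w \<in> space W" for w
  proof -
    have both: "norm (F x w - F y w) = c * r" if "snd w < \<alpha> x w" "snd w < \<alpha> y w"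
      using that c01 by (simp add: pcn_step_def \<alpha>_def pcn_prop_def r flip: scaleR_diff_right)
    have none: "norm (F x w - F y w) = r" if "\<not> snd w < \<alpha> x w" "\<not> snd w < \<alpha> y w"
      using that by (simp add: pcn_step_def \<alpha>_def r)
    have inB: "w \<in> B" if "(snd w < \<alpha> x w) \<noteq> (snd w < \<alpha> y w)"
      using that w unfolding B_def by (auto simp: min_def max_def)
    have GG: "snd w < \<alpha> x w \<and> snd w < \<alpha> y w" if "w \<in> G"
      using that acc[of "fst w" x] acc[of "fst w" y] unfolding G_def \<alpha>_def by auto
    have Bn: "E * indicator B w \<ge> 0" using E0 by simp
    show ?thesis
    proof (cases "snd w < \<alpha> x w \<and> snd w < \<alpha> y w")
      case True
      then have "f (norm (F x w - F y w)) = f r - D" using both by (simp add: D_def)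
      moreover have "D * indicator G w \<le> D" using D0 by (simp add: indicator_def)
      ultimately show ?thesis using Bn by linarith
    next
      case False
      then have nG: "w \<notin> G" using GG by blast
      show ?thesis
      proof (cases "snd w < \<alpha> x w \<or> snd w < \<alpha> y w")
        case True
        then have "w \<in> B" using False inB by blast
        then show ?thesis using nG f1[of "norm (F x w - F y w)"] by (simp add: f E_def)
      next
        case F2: False
        then show ?thesis using none nG Bn by simp
      qed
    qed
  qed
  note [measurable] = F_borel[OF x] F_borel[OF y]
  have fm[measurable]: "(\<lambda>w. f (norm (F x w - F y w))) \<in> borel_measurable W"
    unfolding f by measurable
  have i1: "integrable W (\<lambda>w. f (norm (F x w - F y w)))"
    by (rule W.integrable_const_bound[where B=1]) (auto intro!: AE_I2 simp: f0 f1)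
  have iGB: "integrable W (indicat_real G)" "integrable W (indicat_real B)"
    using Gm Bm by (auto intro!: integrable_real_indicator simp: W.emeasure_finite less_top[symmetric])
  have "(\<integral>\<^sup>+w. ennreal (f (norm (F x w - F y w))) \<partial>W) = ennreal (\<integral>w. f (norm (F x w - F y w)) \<partial>W)"
    by (rule nn_integral_eq_integral[OF i1]) (auto intro!: AE_I2 simp: f0)
  also have "(\<integral>w. f (norm (F x w - F y w)) \<partial>W) \<le> (\<integral>w. f r - D * indicator G w + E * indicator B w \<partial>W)"
  proof (rule integral_mono[OF i1])
    show "integrable W (\<lambda>w. f r - D * indicator G w + E * indicator B w)"
      using iGB by (intro Bochner_Integration.integrable_add Bochner_Integration.integrable_diff integrable_mult_right) simp_all
  qed (rule point)
  also have "\<dots> = f r - D * measure W G + E * measure W B"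
    using iGB sets.sets_into_space[OF Gm] sets.sets_into_space[OF Bm] W.prob_space by (simp add: Int_absorb2)
  also have "\<dots> \<le> f r - r * E"
  proof -
    have "E * ((1 - c) * r / \<eta>) * q \<le> D * measure W G"
      using D qG q(2) D0 by (intro mult_mono) auto
    moreover have "E * measure W B \<le> E * (2 * L * r)" by (rule mult_left_mono[OF LB E0])
    moreover have "E * ((1 - c) * r / \<eta>) * q = E * (2 * L + 1) * r"
      using q(2) c01 L0 unfolding \<eta> by (simp add: field_simps)
    ultimately show ?thesis by (simp add: algebra_simps)
  qed
  finally show ?thesis by (simp add: E_def ennreal_leI)
qed

end

section \<open>Drift of the weight\<close>

lemma power_le_fact_exp: "0 \<le> x \<Longrightarrow> x ^ i \<le> fact i * exp (x::real)"
proof -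
  assume x: "0 \<le> x"
  have "(\<Sum>n\<in>{i}. inverse (fact n) * x ^ n) \<le> (\<Sum>n. inverse (fact n) * x ^ n)"
    using x by (intro sum_le_suminf summable_exp) auto
  also have "\<dots> = exp x" by (simp add: exp_def divide_inverse scaleR_conv_of_real)
  finally show ?thesis by (simp add: field_simps)
qed

text \<open>
The increment of the \<open>i\<close>-th power is of lower order: \<open>(t + s)^i - t^i = O(t^(i-1))\<close> for fixed \<open>s\<close>. The
form with a factor \<open>t\<close> avoids a truncated exponent.
\<close>

lemma power_add_diff_le:
  fixes t s :: real
  assumes t: "1 \<le> t" and s: "0 \<le> s"
  shows "t * ((t + s) ^ i - t ^ i) \<le> t ^ i * (1 + s) ^ i"
proof -
  have "t * (t + s) ^ i \<le> t ^ Suc i + t ^ i * ((1 + s) ^ i - 1)"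
  proof (induction i)
    case (Suc i)
    define B where "B = (1 + s) ^ i"
    have B: "B \<ge> 1" unfolding B_def using s by simp
    have ti: "t ^ i \<ge> 0" using t by simp
    have "t * (t + s) ^ Suc i = (t + s) * (t * (t + s) ^ i)" by simp
    also have "\<dots> \<le> (t + s) * (t ^ Suc i + t ^ i * (B - 1))"
      using Suc t s unfolding B_def by (intro mult_left_mono) auto
    also have "\<dots> = t ^ Suc (Suc i) + t ^ Suc i * ((1 + s) * B - 1) - s * (B - 1) * t ^ i * (t - 1)"
      by (simp add: algebra_simps)
    also have "\<dots> \<le> t ^ Suc (Suc i) + t ^ Suc i * ((1 + s) * B - 1)"
      using s B ti t by (simp add: mult_nonneg_nonneg)
    finally show ?case by (simp add: B_def)
  qed simp
  moreover have "t ^ i \<ge> 0" using t by simp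
  ultimately show ?thesis by (simp add: algebra_simps)
qed

lemma ennreal_le_diff:
  assumes "I + ennreal a \<le> ennreal b" "0 \<le> a" "0 \<le> b"
  shows "I \<le> ennreal (b - a)"
proof (cases I)
  case (real i)
  then have "ennreal (i + a) \<le> ennreal b" using assms by (simp add: ennreal_plus)
  then have "i + a \<le> b" using assms(3) by simp
  then show ?thesis using real by (simp add: ennreal_leI)
next
  case top
  then show ?thesis using assms by (simp add: top_unique)
qed

lemma (in pcn) nn_integral_W_fst:
  assumes h[measurable]: "h \<in> borel_measurable g"
  shows "(\<integral>\<^sup>+w. h (fst w) \<partial>W) = (\<integral>\<^sup>+\<xi>. h \<xi> \<partial>g)"
proof -
  have m: "(\<lambda>w. h (fst w)) \<in> borel_measurable W" by measurable
  show ?thesis using U.nn_integral_fst[OF m] U.emeasure_space_1 by simp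
qed

lemma (in pcn) scaled_exp_moment:
  assumes "0 \<le> d" "0 \<le> w" "0 \<le> mom w"
  shows "(\<integral>\<^sup>+\<xi>. ennreal (d * exp (w * norm \<xi>)) \<partial>g) \<le> ennreal (d * mom w)"
proof -
  have "(\<integral>\<^sup>+\<xi>. ennreal (d * exp (w * norm \<xi>)) \<partial>g) = ennreal d * (\<integral>\<^sup>+\<xi>. ennreal (exp (w * norm \<xi>)) \<partial>g)"
    using assms by (simp add: ennreal_mult nn_integral_cmult)
  also have "\<dots> \<le> ennreal d * ennreal (mom w)"
    using mom assms by (intro mult_left_mono) auto
  finally show ?thesis using assms by (simp add: ennreal_mult)
qed

text \<open>
If the noise \<open>\<theta> |\<xi>|\<close> is below \<open>rad t\<close>, proposal and state have norm at most \<open>t = |x|\<close>, and acceptance,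
which has probability at least \<open>q\<close> already on smaller noises, brings the norm down by the
factor \<open>1 - (1 - c) / 2\<close>. If the noise is larger, the new norm is at most \<open>t + \<theta> |\<xi>|\<close>; by \<open>h2\<close> the resulting
increase uses up only half of the gain. The states with \<open>|x| < R1\<close> contribute the constant \<open>K\<close>.
\<close>

lemma (in pcn) lyapunov_step:
  fixes v rad :: "real \<Rightarrow> real"
  assumes v0: "\<And>t. 0 \<le> t \<Longrightarrow> 0 \<le> v t" and vmono: "\<And>t t'. 0 \<le> t \<Longrightarrow> t \<le> t' \<Longrightarrow> v t \<le> v t'"
    and vm[measurable]: "v \<in> borel_measurable borel"
    and s: "0 < s" and a: "0 < a" "a \<le> 1"
    and acc: "\<And>x \<xi>. \<theta> * norm \<xi> < s \<Longrightarrow> a \<le> accept_prob \<Phi> x (pcn_prop \<delta> x \<xi>)"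
    and q: "q = small (s / \<theta>) * a" "q > 0"
    and rad: "\<And>t. R1 \<le> t \<Longrightarrow> s \<le> rad t \<and> rad t \<le> (1 - c) / 2 * t"
    and R1: "0 \<le> R1" and c0: "0 \<le> c0" "c0 \<le> 1" and \<epsilon>: "\<epsilon> = q * (1 - c0) / 2"
    and h1: "\<And>t. R1 \<le> t \<Longrightarrow> v ((1 - (1 - c) / 2) * t) \<le> c0 * v t"
    and h2: "\<And>t. R1 \<le> t \<Longrightarrow> (\<integral>\<^sup>+\<xi>. ennreal (if rad t \<le> \<theta> * norm \<xi> then v (t + \<theta> * norm \<xi>) - v t else 0) \<partial>g) \<le> ennreal (\<epsilon> * v t)"
    and h3: "(\<integral>\<^sup>+\<xi>. ennreal (v (R1 + \<theta> * norm \<xi>)) \<partial>g) \<le> ennreal K" and K: "0 \<le> K"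
    and x: "x \<in> S"
  shows "(\<integral>\<^sup>+w. ennreal (v (norm (F x w))) \<partial>W) \<le> ennreal (max 0 (1 - \<epsilon>) * v (norm x) + K)"
proof -
  define t where "t = norm x"
  have t0: "t \<ge> 0" by (simp add: t_def)
  have prop_le: "norm (pcn_prop \<delta> x \<xi>) \<le> c * t + \<theta> * norm \<xi>" for \<xi>
    unfolding pcn_prop_def t_def using norm_triangle_ineq[of "c *\<^sub>R x" "\<theta> *\<^sub>R \<xi>"] c01 \<theta>0 by simp
  have ct: "c * t \<le> t" using c01 t0 by (simp add: mult_left_le_one_le)
  have F_le: "norm (F x w) \<le> t + \<theta> * norm (fst w)" for w
  proof -
    have "0 \<le> \<theta> * norm (fst w)" using \<theta>0 by simp
    then show ?thesis
      using prop_le[of "fst w"] ct unfolding pcn_step_def by (auto simp: t_def)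
  qed
  have [measurable]: "(\<lambda>z. z) \<in> g \<rightarrow>\<^sub>M borel" by measurable
  note [measurable] = F_borel[OF x]
  have Vm: "(\<lambda>w. ennreal (v (norm (F x w)))) \<in> borel_measurable W" by measurable
  show ?thesis
  proof (cases "R1 \<le> t")
    case False
    have "(\<integral>\<^sup>+w. ennreal (v (norm (F x w))) \<partial>W) \<le> (\<integral>\<^sup>+w. ennreal (v (R1 + \<theta> * norm (fst w))) \<partial>W)"
    proof (intro nn_integral_mono ennreal_leI vmono)
      show "norm (F x w) \<le> R1 + \<theta> * norm (fst w)" for w using F_le[of w] False by linarith
    qed simp
    also have "\<dots> = (\<integral>\<^sup>+\<xi>. ennreal (v (R1 + \<theta> * norm \<xi>)) \<partial>g)"
      by (rule nn_integral_W_fst) measurable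
    also have "\<dots> \<le> ennreal K" by (rule h3)
    also have "\<dots> \<le> ennreal (max 0 (1 - \<epsilon>) * v (norm x) + K)"
      using v0[OF t0] by (intro ennreal_leI) (simp add: t_def)
    finally show ?thesis .
  next
    case True
    define G where "G = {w \<in> space W. \<theta> * norm (fst w) < s \<and> snd w < a}"
    have Gm[measurable]: "G \<in> sets W"
      unfolding G_def by measurable
    have qG: "q \<le> measure W G" unfolding q(1) G_def using prob_small_noise_ge[OF s, of a] a by simp
    define tail where "tail \<xi> = (if rad t \<le> \<theta> * norm \<xi> then v (t + \<theta> * norm \<xi>) - v t else 0)" for \<xi> :: 'a
    have tm[measurable]: "(\<lambda>\<xi>. ennreal (tail \<xi>)) \<in> borel_measurable g" unfolding tail_def by measurable
    have tail0: "tail \<xi> \<ge> 0" for \<xi>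
      unfolding tail_def using vmono[OF t0, of "t + \<theta> * norm \<xi>"] \<theta>0 by simp
    have vt: "v t \<ge> 0" by (rule v0[OF t0])
    have r: "s \<le> rad t" "rad t \<le> (1 - c) / 2 * t" using rad[OF True] by auto
    have point: "v (norm (F x w)) + (1 - c0) * v t * indicator G w \<le> v t + tail (fst w)" for w
    proof (cases "rad t \<le> \<theta> * norm (fst w)")
      case tl: True
      then have "w \<notin> G" using r by (auto simp: G_def)
      moreover have "v (norm (F x w)) \<le> v (t + \<theta> * norm (fst w))" by (rule vmono[OF norm_ge_zero F_le])
      ultimately show ?thesis using tl by (simp add: tail_def)
    next
      case ntl: False
      have "norm (pcn_prop \<delta> x (fst w)) \<le> c * t + rad t" using prop_le[of "fst w"] ntl by simp
      also have "\<dots> \<le> c * t + (1 - c) / 2 * t" using r(2) by simp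
      also have "\<dots> = (1 - (1 - c) / 2) * t" by (simp add: field_simps)
      finally have p: "norm (pcn_prop \<delta> x (fst w)) \<le> (1 - (1 - c) / 2) * t" .
      have half: "(1 - (1 - c) / 2) * t \<le> t"
      proof -
        have "(1 - (1 - d) / 2) * t \<le> t" if "d < 1" for d :: real
          using mult_nonneg_nonneg[of "(1 - d) / 2" t] that t0 by (simp add: left_diff_distrib)
        then show ?thesis using c01(2) by blast
      qed
      show ?thesis
      proof (cases "w \<in> G")
        case True
        then have "F x w = pcn_prop \<delta> x (fst w)"
          using acc[of "fst w" x] by (auto simp: G_def pcn_step_def)
        then have "v (norm (F x w)) \<le> c0 * v t"
          using vmono[OF _ p] h1[OF \<open>R1 \<le> t\<close>] by (smt (verit) norm_ge_zero)
        then show ?thesis using ntl True by (simp add: tail_def algebra_simps)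
      next
        case False
        have "norm (F x w) \<le> t" using p half by (simp add: pcn_step_def t_def)
        then show ?thesis using False ntl vmono[of "norm (F x w)" t] by (simp add: tail_def)
      qed
    qed
    have c0v: "0 \<le> (1 - c0) * v t" using c0 vt by simp
    have "(\<integral>\<^sup>+w. ennreal (v (norm (F x w))) \<partial>W) + ennreal (q * ((1 - c0) * v t))
       \<le> (\<integral>\<^sup>+w. ennreal (v (norm (F x w))) \<partial>W) + ennreal ((1 - c0) * v t) * emeasure W G"
      using qG c0v by (intro add_left_mono) (simp add: W.emeasure_eq_measure mult.commute mult_right_mono ennreal_leI flip: ennreal_mult)
    also have "\<dots> = (\<integral>\<^sup>+w. ennreal (v (norm (F x w))) + ennreal ((1 - c0) * v t) * indicator G w \<partial>W)"
      using Gm Vm by (subst nn_integral_add) (auto simp: nn_integral_cmult_indicator)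
    also have "\<dots> \<le> (\<integral>\<^sup>+w. ennreal (v t) + ennreal (tail (fst w)) \<partial>W)"
    proof (rule nn_integral_mono)
      fix w
      have "ennreal (v (norm (F x w))) + ennreal ((1 - c0) * v t) * indicator G w = ennreal (v (norm (F x w)) + (1 - c0) * v t * indicator G w)"
        using c0v v0 by (simp add: indicator_def)
      also have "\<dots> \<le> ennreal (v t + tail (fst w))" by (rule ennreal_leI[OF point])
      finally show "ennreal (v (norm (F x w))) + ennreal ((1 - c0) * v t) * indicator G w \<le> ennreal (v t) + ennreal (tail (fst w))"
        using vt tail0 by simp
    qed
    also have "\<dots> = (\<integral>\<^sup>+w. ennreal (v t) \<partial>W) + (\<integral>\<^sup>+w. ennreal (tail (fst w)) \<partial>W)"
      by (rule nn_integral_add) measurable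
    also have "\<dots> = ennreal (v t) + (\<integral>\<^sup>+\<xi>. ennreal (tail \<xi>) \<partial>g)"
      using nn_integral_W_fst[OF tm] W.emeasure_space_1 by simp
    also have "\<dots> \<le> ennreal (v t) + ennreal (\<epsilon> * v t)"
      unfolding tail_def by (intro add_left_mono h2 True)
    also have "\<dots> = ennreal (v t + \<epsilon> * v t)"
      using vt q(2) c0 by (intro ennreal_plus[symmetric]) (auto simp: \<epsilon>)
    finally have "(\<integral>\<^sup>+w. ennreal (v (norm (F x w))) \<partial>W) \<le> ennreal (v t + \<epsilon> * v t - q * ((1 - c0) * v t))"
      using vt q(2) c0 by (intro ennreal_le_diff) (auto simp: \<epsilon>)
    also have "v t + \<epsilon> * v t - q * ((1 - c0) * v t) = (1 - \<epsilon>) * v t" by (simp add: \<epsilon> field_simps)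
    also have "(1 - \<epsilon>) * v t \<le> max 0 (1 - \<epsilon>) * v t + K"
      using vt K by (smt (verit) mult_right_mono)
    finally show ?thesis by (simp add: t_def ennreal_leI)
  qed
qed

section \<open>The weighted cost\<close>

text \<open>
The distance for which one step of the coupled chain is a contraction; \<open>\<eta>\<close> and \<open>\<beta>\<close> are chosen small.
\<close>

definition harris_cost :: "real \<Rightarrow> real \<Rightarrow> ('a::real_normed_vector \<Rightarrow> real) \<Rightarrow> 'a \<Rightarrow> 'a \<Rightarrow> real" where
  "harris_cost \<eta> \<beta> V x y = sqrt ((1 - exp (- norm (x - y) / \<eta>)) * (1 + \<beta> * V x + \<beta> * V y))"

text \<open>
Here \<open>A\<close> stands for the new mean of \<open>f\<close> and \<open>W\<close> for \<open>V x + V y\<close>, so that \<open>1 + 2 \<beta> K + l \<beta> W\<close> bounds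
the new mean of the weight. For \<open>W \<le> W0\<close> the factor \<open>\<kappa>0\<close> beats \<open>1 + 2 \<beta> K\<close> if \<open>\<beta>\<close> is small. For \<open>W > W0\<close>
the drift absorbs \<open>2 K\<close> and leaves the factor \<open>(1 + m \<beta> W) / (1 + \<beta> W)\<close> with \<open>m = (1 + l) / 2\<close>,
which is largest at \<open>W = W0\<close>.
\<close>

lemma exists_weight_contraction:
  fixes l K W0 \<kappa>0 :: real
  assumes l: "0 \<le> l" "l < 1" and K: "0 \<le> K" and W0: "W0 = 4 * K / (1 - l) + 1" and \<kappa>0: "\<kappa>0 < 1"
  shows "\<exists>\<beta> \<kappa>. 0 < \<beta> \<and> \<beta> \<le> 1 \<and> 0 \<le> \<kappa> \<and> \<kappa> < 1 \<and>
    (\<forall>f A W. 0 \<le> f \<and> 0 \<le> A \<and> A \<le> f \<and> 0 \<le> W \<and> (W \<le> W0 \<longrightarrow> A \<le> \<kappa>0 * f) \<longrightarrow>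
        A * (1 + 2 * \<beta> * K + l * \<beta> * W) \<le> \<kappa>\<^sup>2 * (f * (1 + \<beta> * W)))"
proof -
  \<comment> \<open>\<open>\<kappa>0\<close> may be negative\<close>
  define k where "k = max 0 \<kappa>0"
  have k: "0 \<le> k" "k < 1" "\<kappa>0 \<le> k" using \<kappa>0 by (auto simp: k_def)
  define \<beta> where "\<beta> = (1 - k) / (4 * (K + 1))"
  have \<beta>: "0 < \<beta>" "\<beta> \<le> 1" using k K by (auto simp: \<beta>_def divide_le_eq)
  have \<beta>K: "2 * \<beta> * K \<le> (1 - k) / 2"
  proof -
    have "2 * \<beta> * K \<le> 2 * \<beta> * (K + 1)" using \<beta> by simp
    also have "\<dots> = (1 - k) / 2" using K by (simp add: \<beta>_def field_simps)
    finally show ?thesis .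
  qed
  have W0': "W0 > 0" "4 * K \<le> (1 - l) * W0"
  proof -
    show "W0 > 0" using l K by (simp add: W0 add_nonneg_pos)
    have "(1 - l) * W0 = 4 * K + (1 - l)" using l by (simp add: W0 distrib_left)
    then show "4 * K \<le> (1 - l) * W0" using l by simp
  qed
  define m where "m = (1 + l) / 2"
  have m: "0 \<le> m" "m < 1" using l by (auto simp: m_def)
  define k1 where "k1 = (1 + m * \<beta> * W0) / (1 + \<beta> * W0)"
  have den: "1 + \<beta> * W0 > 0" using \<beta> W0' by (simp add: add_pos_pos)
  have k1: "0 \<le> k1" "k1 < 1"
  proof -
    show "0 \<le> k1" using m \<beta> W0' by (simp add: k1_def)
    have "m * (\<beta> * W0) < 1 * (\<beta> * W0)" using m \<beta> W0' by (intro mult_strict_right_mono) auto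
    then show "k1 < 1" using den by (simp add: k1_def mult.assoc)
  qed
  define k2 where "k2 = max ((1 + k) / 2) k1"
  have k2: "0 \<le> k2" "k2 < 1" using k k1 by (auto simp: k2_def)
  have main: "A * (1 + 2 * \<beta> * K + l * \<beta> * W) \<le> k2 * (f * (1 + \<beta> * W))"
    if f: "0 \<le> f" "0 \<le> A" "A \<le> f" "0 \<le> W" "W \<le> W0 \<longrightarrow> A \<le> \<kappa>0 * f" for f A W
  proof -
    have pos: "0 \<le> f * (1 + \<beta> * W)" using f \<beta> by simp
    have num: "0 \<le> 1 + 2 * \<beta> * K + l * \<beta> * W" using f \<beta> K l by simp
    show ?thesis
    proof (cases "W \<le> W0")
      case True
      have "A \<le> k * f" using True f k(3) by (meson mult_right_mono order_trans)
      then have "A * (1 + 2 * \<beta> * K + l * \<beta> * W) \<le> (k * f) * (1 + 2 * \<beta> * K + l * \<beta> * W)"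
        using num by (rule mult_right_mono)
      also have "\<dots> \<le> (k * f) * ((1 + 2 * \<beta> * K) * (1 + \<beta> * W))"
      proof (rule mult_left_mono)
        have "l * (\<beta> * W) \<le> \<beta> * W" using l f \<beta> by (intro mult_left_le_one_le) auto
        moreover have "0 \<le> 2 * \<beta> * K * (\<beta> * W)" using f \<beta> K by simp
        ultimately show "1 + 2 * \<beta> * K + l * \<beta> * W \<le> (1 + 2 * \<beta> * K) * (1 + \<beta> * W)"
          by (simp add: algebra_simps)
      qed (use k f in simp)
      also have "\<dots> = (k * (1 + 2 * \<beta> * K)) * (f * (1 + \<beta> * W))" by simp
      also have "\<dots> \<le> k2 * (f * (1 + \<beta> * W))"
      proof (rule mult_right_mono[OF _ pos])
        have "k * (2 * \<beta> * K) \<le> 1 * ((1 - k) / 2)" using k \<beta>K \<beta> K by (intro mult_mono) auto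
        moreover have "k * (1 + 2 * \<beta> * K) = k + k * (2 * \<beta> * K)" by (simp add: distrib_left)
        moreover have "(1 + k) / 2 \<le> k2" by (simp add: k2_def)
        ultimately show "k * (1 + 2 * \<beta> * K) \<le> k2" by (simp add: field_simps)
      qed
      finally show ?thesis .
    next
      case False
      have "4 * K \<le> (1 - l) * W" using W0'(2) False l mult_left_mono[of W0 W "1 - l"] by linarith
      then have "\<beta> * (2 * K + l * W) \<le> \<beta> * (m * W)" using \<beta> by (intro mult_left_mono) (auto simp: m_def field_simps)
      then have "1 + 2 * \<beta> * K + l * \<beta> * W \<le> 1 + m * \<beta> * W" by (simp add: algebra_simps)
      also have "\<dots> \<le> k1 * (1 + \<beta> * W)"
      proof -
        have "(1 - m) * \<beta> * W0 \<le> (1 - m) * \<beta> * W" using False m \<beta> by (intro mult_left_mono) auto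
        then have "(1 + m * \<beta> * W) * (1 + \<beta> * W0) \<le> (1 + m * \<beta> * W0) * (1 + \<beta> * W)"
          by (simp add: algebra_simps)
        then show ?thesis using den by (simp add: k1_def field_simps)
      qed
      also have "\<dots> \<le> k2 * (1 + \<beta> * W)" using f \<beta> by (intro mult_right_mono) (auto simp: k2_def)
      finally have "A * (1 + 2 * \<beta> * K + l * \<beta> * W) \<le> f * (k2 * (1 + \<beta> * W))"
        using f num by (intro mult_mono) auto
      then show ?thesis by (simp add: mult_ac)
    qed
  qed
  show ?thesis
    using \<beta> k2 main by (intro exI[of _ \<beta>] exI[of _ "sqrt k2"]) auto
qed

lemma ennreal_square_le:
  assumes "I\<^sup>2 \<le> ennreal (b\<^sup>2)" "0 \<le> b" shows "I \<le> ennreal b"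
proof (cases I)
  case (real i)
  then have "ennreal (i\<^sup>2) \<le> ennreal (b\<^sup>2)" using assms by (simp add: ennreal_power)
  then have "i\<^sup>2 \<le> b\<^sup>2" by simp
  then have "i \<le> b" using assms(2) power2_le_imp_le by blast
  then show ?thesis using real by (simp add: ennreal_leI)
next
  case top
  then show ?thesis using assms(1) by (simp add: top_unique power2_eq_square ennreal_top_mult)
qed

lemma min_div_le:
  fixes a b r :: real
  assumes "0 < a" "0 < b" "0 \<le> r"
  shows "min 1 (r / a) \<le> max 1 (b / a) * min 1 (r / b)"
proof (cases "1 \<le> r / b")
  case True then show ?thesis by simp
next
  case False
  have "r / a = (b / a) * (r / b)" using assms by simp
  also have "\<dots> \<le> max 1 (b / a) * (r / b)" using assms by (intro mult_right_mono) auto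
  finally show ?thesis using False by simp
qed

lemma one_minus_exp_bounds:
  assumes u: "0 \<le> (u::real)"
  shows "1 - exp (- u) \<le> min 1 u" "min 1 u \<le> 2 * (1 - exp (- u))"
proof -
  show "1 - exp (- u) \<le> min 1 u" using exp_ge_add_one_self[of "- u"] by auto
  have "(1 + u) * exp (- u) \<le> exp u * exp (- u)" by (rule mult_right_mono) auto
  then have "(1 + u) * exp (- u) \<le> 1" by (simp flip: exp_add)
  then have "exp (- u) \<le> 1 / (1 + u)" using u by (simp add: field_simps)
  moreover have "min 1 u \<le> 2 * (1 - 1 / (1 + u))"
  proof (cases "u \<le> 1")
    case True
    have "u * (1 + u) \<le> u * 2" using True u by (intro mult_left_mono) auto
    then show ?thesis using True u by (simp add: field_simps)
  next
    case False then show ?thesis by (simp add: field_simps)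
  qed
  moreover have "2 * (1 - a) \<le> 2 * (1 - b)" if "b \<le> a" for a b :: real
    using that by simp
  ultimately show "min 1 u \<le> 2 * (1 - exp (- u))" using order_trans by blast
qed

lemma weighted_dist_le_harris_cost:
  assumes "0 < \<epsilon>" "0 < \<eta>" "0 < \<beta>" "\<beta> \<le> 1" "0 \<le> V x" "0 \<le> V y"
  shows "weighted_dist \<epsilon> V x y \<le> sqrt (2 * max 1 (\<eta> / \<epsilon>) / \<beta>) * harris_cost \<eta> \<beta> V x y"
proof -
  define u where "u = norm (x - y) / \<eta>"
  have u: "u \<ge> 0" unfolding u_def using assms by simp
  have "trunc_dist \<epsilon> x y \<le> max 1 (\<eta> / \<epsilon>) * min 1 u"
    unfolding trunc_dist_def u_def using assms by (intro min_div_le) auto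
  also have "\<dots> \<le> max 1 (\<eta> / \<epsilon>) * (2 * (1 - exp (- u)))"
    by (rule mult_left_mono[OF one_minus_exp_bounds(2)[OF u]]) simp
  finally have 1: "trunc_dist \<epsilon> x y \<le> 2 * max 1 (\<eta> / \<epsilon>) * (1 - exp (- u))"
    by (simp only: mult.assoc mult.left_commute)
  have 2: "1 + V x + V y \<le> (1 + \<beta> * V x + \<beta> * V y) / \<beta>"
    using assms by (simp add: field_simps)
  have "trunc_dist \<epsilon> x y * (1 + V x + V y) \<le> (2 * max 1 (\<eta> / \<epsilon>) * (1 - exp (- u))) * ((1 + \<beta> * V x + \<beta> * V y) / \<beta>)"
    using assms u by (intro mult_mono[OF 1 2]) auto
  also have "\<dots> = (2 * max 1 (\<eta> / \<epsilon>) / \<beta>) * ((1 - exp (- u)) * (1 + \<beta> * V x + \<beta> * V y))" by simp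
  finally have "weighted_dist \<epsilon> V x y \<le> sqrt ((2 * max 1 (\<eta> / \<epsilon>) / \<beta>) * ((1 - exp (- u)) * (1 + \<beta> * V x + \<beta> * V y)))"
    unfolding weighted_dist_def by (rule real_sqrt_le_mono)
  then show ?thesis by (simp only: real_sqrt_mult harris_cost_def u_def minus_divide_left)
qed

lemma harris_cost_le_weighted_dist:
  assumes "0 < \<epsilon>" "0 < \<eta>" "0 < \<beta>" "\<beta> \<le> 1" "0 \<le> V x" "0 \<le> V y"
  shows "harris_cost \<eta> \<beta> V x y \<le> sqrt (max 1 (\<epsilon> / \<eta>)) * weighted_dist \<epsilon> V x y"
proof -
  define u where "u = norm (x - y) / \<eta>"
  have u: "u \<ge> 0" unfolding u_def using assms by simp
  have "1 - exp (- u) \<le> min 1 u" by (rule one_minus_exp_bounds(1)[OF u])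
  also have "\<dots> \<le> max 1 (\<epsilon> / \<eta>) * trunc_dist \<epsilon> x y"
    unfolding trunc_dist_def u_def using assms by (intro min_div_le) auto
  finally have 1: "1 - exp (- u) \<le> max 1 (\<epsilon> / \<eta>) * trunc_dist \<epsilon> x y" .
  have 2: "1 + \<beta> * V x + \<beta> * V y \<le> 1 + V x + V y"
    using assms by (intro add_mono mult_left_le_one_le) auto
  have "(1 - exp (- u)) * (1 + \<beta> * V x + \<beta> * V y) \<le> (max 1 (\<epsilon> / \<eta>) * trunc_dist \<epsilon> x y) * (1 + V x + V y)"
    using assms u by (intro mult_mono[OF 1 2]) (auto simp: trunc_dist_def)
  then have "sqrt ((1 - exp (- u)) * (1 + \<beta> * V x + \<beta> * V y)) \<le> sqrt (max 1 (\<epsilon> / \<eta>) * (trunc_dist \<epsilon> x y * (1 + V x + V y)))"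
    by (intro real_sqrt_le_mono) (simp add: mult.assoc)
  then show ?thesis by (simp only: real_sqrt_mult harris_cost_def weighted_dist_def u_def minus_divide_left)
qed

text \<open>
Two states of small cost are close, as needed for uniqueness of the invariant measure.
\<close>

lemma trunc_dist_le_harris_cost:
  assumes "0 < \<eta>" "0 < \<beta>" "0 \<le> V x" "0 \<le> V y"
  shows "min 1 (norm (x - y)) \<le> 2 * max 1 \<eta> * harris_cost \<eta> \<beta> V x y"
proof -
  define u where "u = norm (x - y) / \<eta>"
  have u: "u \<ge> 0" unfolding u_def using assms by simp
  define p where "p = 1 - exp (- u)"
  have p: "0 \<le> p" "p \<le> 1" using u by (auto simp: p_def)
  have "p \<le> sqrt (p * (1 + \<beta> * V x + \<beta> * V y))"
  proof (rule real_le_rsqrt)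
    have "p\<^sup>2 \<le> p * 1" unfolding power2_eq_square using p by (intro mult_left_mono) auto
    also have "\<dots> \<le> p * (1 + \<beta> * V x + \<beta> * V y)" using assms p by (intro mult_left_mono) auto
    finally show "p\<^sup>2 \<le> p * (1 + \<beta> * V x + \<beta> * V y)" .
  qed
  then have pc: "p \<le> harris_cost \<eta> \<beta> V x y"
    by (simp add: harris_cost_def p_def u_def)
  have "min 1 (norm (x - y)) \<le> max 1 \<eta> * min 1 u"
    using min_div_le[of 1 \<eta> "norm (x - y)"] assms unfolding u_def by simp
  also have "\<dots> \<le> max 1 \<eta> * (2 * p)"
    unfolding p_def by (rule mult_left_mono[OF one_minus_exp_bounds(2)[OF u]]) simp
  also have "\<dots> \<le> max 1 \<eta> * (2 * harris_cost \<eta> \<beta> V x y)"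
    using pc by (intro mult_left_mono) auto
  finally show ?thesis by simp
qed

section \<open>Constants that are uniform in the noise\<close>

text \<open>
The drift constants are chosen before the state space and the noise.
\<close>

definition pcn_drift :: "('a::{real_inner, polish_space} \<Rightarrow> real) \<Rightarrow> real \<Rightarrow> real \<Rightarrow> (real \<Rightarrow> real) \<Rightarrow> (real \<Rightarrow> real) \<Rightarrow> ('a \<Rightarrow> real) \<Rightarrow> bool" where
  "pcn_drift \<Phi> L \<delta> mom small V \<longleftrightarrow>
     (\<exists>l K. 0 \<le> l \<and> l < 1 \<and> 0 \<le> K \<and> (\<forall>S g. pcn S g \<Phi> L \<delta> mom small \<longrightarrow>
        (\<forall>x\<in>S. (\<integral>\<^sup>+w. ennreal (V (pcn_step \<delta> \<Phi> x w)) \<partial>(g \<Otimes>\<^sub>M unif)) \<le> ennreal (l * V x + K))))"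

context
  fixes \<Phi> :: "'a::{real_inner, polish_space} \<Rightarrow> real" and L \<delta> :: real and mom small :: "real \<Rightarrow> real"
    and s a q :: real
  assumes \<delta>: "0 < \<delta>" "\<delta> \<le> 1/2" and L0: "L \<ge> 0"
    and s: "0 < s" and a: "0 < a" "a \<le> 1"
    and acc: "\<And>x \<xi>. sqrt (2 * \<delta>) * norm \<xi> < s \<Longrightarrow> a \<le> accept_prob \<Phi> x (pcn_prop \<delta> x \<xi>)"
    and q: "q = small (s / sqrt (2 * \<delta>)) * a" "q > 0"
begin

text \<open>
The increase caused by the noise is of order \<open>t^(i-1)\<close> (\<open>power_add_diff_le\<close>) and hence small compared
with \<open>t^i\<close>, so only the small noises \<open>\<theta> |\<xi>| < s\<close>, with a constant \<open>s\<close>, have to bring a gain.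
\<close>

lemma pcn_drift_power:
  assumes rad: "\<And>t. R \<le> t \<Longrightarrow> s \<le> rad t \<and> rad t \<le> (1 - sqrt (1 - 2 * \<delta>)) / 2 * t" and i: "i \<ge> 1"
    and mom0: "\<And>w. 0 \<le> mom w"
  shows "pcn_drift \<Phi> L \<delta> mom small (\<lambda>x. norm x ^ i)"
proof -
  let ?c = "sqrt (1 - 2 * \<delta>)" and ?\<theta> = "sqrt (2 * \<delta>)"
  define c0 where "c0 = (1 - (1 - ?c) / 2) ^ i"
  have c: "0 \<le> ?c" "?c < 1" using \<delta> by auto
  have c0: "0 \<le> c0" "c0 < 1"
  proof -
    have b: "0 \<le> 1 - (1 - ?c) / 2" "1 - (1 - ?c) / 2 < 1" using c by (simp_all add: field_simps)
    show "0 \<le> c0" unfolding c0_def by (rule zero_le_power[OF b(1)])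
    show "c0 < 1" unfolding c0_def using b i by (auto simp: power_less_one_iff)
  qed
  define \<epsilon> where "\<epsilon> = q * (1 - c0) / 2"
  have \<epsilon>: "\<epsilon> > 0" unfolding \<epsilon>_def using q c0 by simp
  define H where "H = fact i * exp 1 * mom ?\<theta>"
  have H0: "H \<ge> 0" unfolding H_def using mom0 by simp
  define R1 where "R1 = max R (max 1 (H / \<epsilon>))"
  define K where "K = fact i * exp R1 * mom ?\<theta>"
  have R1: "R \<le> R1" "1 \<le> R1" "H \<le> \<epsilon> * R1"
  proof -
    show "R \<le> R1" "1 \<le> R1" by (simp_all add: R1_def)
    have "H / \<epsilon> \<le> R1" by (simp add: R1_def)
    then show "H \<le> \<epsilon> * R1" using \<epsilon> by (simp add: pos_divide_le_eq mult.commute)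
  qed
  have K0: "K \<ge> 0" unfolding K_def using mom0 by simp
  have "(\<integral>\<^sup>+w. ennreal (norm (pcn_step \<delta> \<Phi> x w) ^ i) \<partial>(g \<Otimes>\<^sub>M unif)) \<le> ennreal (max 0 (1 - \<epsilon>) * norm x ^ i + K)"
    if pc: "pcn S g \<Phi> L \<delta> mom small" and x: "x \<in> S" for S g x
  proof -
    interpret pcn S g \<Phi> L \<delta> mom small by fact
    note EM = scaled_exp_moment[OF _ _ mom0]
    show ?thesis
    proof (rule lyapunov_step[where v="\<lambda>t. t ^ i" and ?R1.0=R1 and ?c0.0=c0 and rad=rad, OF _ _ _ s a acc q])
      show "s \<le> rad t \<and> rad t \<le> (1 - c) / 2 * t" if "R1 \<le> t" for t using rad[of t] that R1 by simp
      show "\<epsilon> = q * (1 - c0) / 2" by (rule \<epsilon>_def)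
      show "((1 - (1 - c) / 2) * t) ^ i \<le> c0 * t ^ i" for t by (simp add: c0_def power_mult_distrib)
      show "(\<integral>\<^sup>+\<xi>. ennreal (if rad t \<le> \<theta> * norm \<xi> then (t + \<theta> * norm \<xi>) ^ i - t ^ i else 0) \<partial>g) \<le> ennreal (\<epsilon> * t ^ i)"
        if t: "R1 \<le> t" for t
      proof -
        have t1: "1 \<le> t" using t R1 by simp
        define d where "d = t ^ i / t * (fact i * exp 1)"
        have d0: "0 \<le> d" using t1 by (simp add: d_def)
        have "(\<integral>\<^sup>+\<xi>. ennreal (if rad t \<le> \<theta> * norm \<xi> then (t + \<theta> * norm \<xi>) ^ i - t ^ i else 0) \<partial>g)
          \<le> (\<integral>\<^sup>+\<xi>. ennreal (d * exp (\<theta> * norm \<xi>)) \<partial>g)"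
        proof (intro nn_integral_mono ennreal_leI)
          fix \<xi> :: 'a
          have n: "0 \<le> \<theta> * norm \<xi>" using \<theta>0 by simp
          have "t * ((t + \<theta> * norm \<xi>) ^ i - t ^ i) \<le> t ^ i * (1 + \<theta> * norm \<xi>) ^ i"
            by (rule power_add_diff_le[OF t1 n])
          also have "\<dots> \<le> t ^ i * (fact i * exp (1 + \<theta> * norm \<xi>))"
            using n t1 by (intro mult_left_mono power_le_fact_exp) auto
          finally have "(t + \<theta> * norm \<xi>) ^ i - t ^ i \<le> d * exp (\<theta> * norm \<xi>)"
            using t1 by (simp add: d_def exp_add field_simps)
          then show "(if rad t \<le> \<theta> * norm \<xi> then (t + \<theta> * norm \<xi>) ^ i - t ^ i else 0) \<le> d * exp (\<theta> * norm \<xi>)"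
            using d0 by simp
        qed
        also have "\<dots> \<le> ennreal (d * mom \<theta>)" using \<theta>0 by (intro EM d0) simp
        also have "d * mom \<theta> = t ^ i / t * H" by (simp add: d_def H_def)
        also have "\<dots> \<le> t ^ i / t * (\<epsilon> * t)"
        proof (rule mult_left_mono)
          have "\<epsilon> * R1 \<le> \<epsilon> * t" using t \<epsilon> by simp
          then show "H \<le> \<epsilon> * t" using R1(3) by linarith
        qed (use t1 in simp)
        also have "\<dots> = \<epsilon> * t ^ i" using t1 by simp
        finally show ?thesis by (simp add: ennreal_leI)
      qed
      show "(\<integral>\<^sup>+\<xi>. ennreal ((R1 + \<theta> * norm \<xi>) ^ i) \<partial>g) \<le> ennreal K"
      proof -
        have "(\<integral>\<^sup>+\<xi>. ennreal ((R1 + \<theta> * norm \<xi>) ^ i) \<partial>g) \<le> (\<integral>\<^sup>+\<xi>. ennreal ((fact i * exp R1) * exp (\<theta> * norm \<xi>)) \<partial>g)"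
        proof (intro nn_integral_mono ennreal_leI)
          fix \<xi> :: 'a
          have "0 \<le> R1 + \<theta> * norm \<xi>" using R1 \<theta>0 by (simp add: add_nonneg_nonneg)
          from power_le_fact_exp[OF this, of i]
          show "(R1 + \<theta> * norm \<xi>) ^ i \<le> fact i * exp R1 * exp (\<theta> * norm \<xi>)" by (simp add: exp_add)
        qed
        also have "\<dots> \<le> ennreal K" unfolding K_def using \<theta>0 by (intro EM) simp_all
        finally show ?thesis .
      qed
    qed (use R1 c0 K0 x in \<open>auto intro: power_mono\<close>)
  qed
  then show ?thesis unfolding pcn_drift_def using \<epsilon> K0 by (intro exI[of _ "max 0 (1 - \<epsilon>)"] exI[of _ K]) auto
qed

text \<open>
Here the noise changes \<open>V\<close> by a factor, and only its tail beyond \<open>rad t\<close> may be charged. It is bounded by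
\<open>exp (- v rad t)\<close> times an exponential moment, which tends to \<open>0\<close> as \<open>rad\<close> tends to infinity.
\<close>

lemma pcn_drift_exp:
  assumes rad: "\<And>t. R \<le> t \<Longrightarrow> s \<le> rad t \<and> rad t \<le> (1 - sqrt (1 - 2 * \<delta>)) / 2 * t"
    and rad_top: "filterlim rad at_top at_top" and v: "v > 0"
    and mom0: "\<And>w. 0 \<le> mom w"
  shows "pcn_drift \<Phi> L \<delta> mom small (\<lambda>x. exp (v * norm x))"
proof -
  let ?c = "sqrt (1 - 2 * \<delta>)" and ?\<theta> = "sqrt (2 * \<delta>)"
  have c: "0 \<le> ?c" "?c < 1" using \<delta> by auto
  define \<epsilon> where "\<epsilon> = q * (1 - 1/2) / 2"
  have \<epsilon>: "\<epsilon> > 0" unfolding \<epsilon>_def using q by simp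
  define H where "H = mom (2 * v * ?\<theta>)"
  have H0: "H \<ge> 0" unfolding H_def using mom0 by simp
  have "eventually (\<lambda>t. (H / \<epsilon>) / v \<le> rad t) at_top"
    using rad_top by (simp add: filterlim_at_top)
  then obtain R0 where R0: "\<And>t. R0 \<le> t \<Longrightarrow> H / \<epsilon> / v \<le> rad t"
    by (auto simp: eventually_at_top_linorder)
  define R1 where "R1 = max (max R R0) (max 0 (2 / (v * (1 - ?c))))"
  have R1: "R \<le> R1" "R0 \<le> R1" "0 \<le> R1" "2 / (v * (1 - ?c)) \<le> R1" by (auto simp: R1_def)
  define K where "K = exp (v * R1) * mom (v * ?\<theta>)"
  have K0: "K \<ge> 0" unfolding K_def using mom0 by simp
  have "(\<integral>\<^sup>+w. ennreal (exp (v * norm (pcn_step \<delta> \<Phi> x w))) \<partial>(g \<Otimes>\<^sub>M unif)) \<le> ennreal (max 0 (1 - \<epsilon>) * exp (v * norm x) + K)"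
    if pc: "pcn S g \<Phi> L \<delta> mom small" and x: "x \<in> S" for S g x
  proof -
    interpret pcn S g \<Phi> L \<delta> mom small by fact
    note EM = scaled_exp_moment[OF _ _ mom0]
    show ?thesis
    proof (rule lyapunov_step[where v="\<lambda>t. exp (v * t)" and ?R1.0=R1 and ?c0.0="1/2" and rad=rad, OF _ _ _ s a acc q])
      show "s \<le> rad t \<and> rad t \<le> (1 - c) / 2 * t" if "R1 \<le> t" for t using rad[of t] that R1 by simp
      show "\<epsilon> = q * (1 - 1/2) / 2" by (rule \<epsilon>_def)
      show "exp (v * ((1 - (1 - c) / 2) * t)) \<le> 1/2 * exp (v * t)" if t: "R1 \<le> t" for t
      proof -
        have vc: "v * (1 - c) > 0" using v c by simp
        have "2 / (v * (1 - c)) \<le> t" using R1(4) t by simp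
        then have "2 \<le> v * (1 - c) * t" using vc by (simp add: field_simps)
        then have "1 \<le> v * (1 - c) / 2 * t" by simp
        then have "2 \<le> exp (v * (1 - c) / 2 * t)" using exp_ge_add_one_self[of "v * (1 - c) / 2 * t"] by linarith
        then have "2 * exp (v * ((1 - (1 - c) / 2) * t)) \<le> exp (v * (1 - c) / 2 * t) * exp (v * ((1 - (1 - c) / 2) * t))"
          by (rule mult_right_mono) simp
        also have "\<dots> = exp (v * t)" unfolding exp_add[symmetric] by (rule arg_cong[where f=exp]) (simp add: field_simps)
        finally show ?thesis by simp
      qed
      show "(\<integral>\<^sup>+\<xi>. ennreal (if rad t \<le> \<theta> * norm \<xi> then exp (v * (t + \<theta> * norm \<xi>)) - exp (v * t) else 0) \<partial>g) \<le> ennreal (\<epsilon> * exp (v * t))"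
        if t: "R1 \<le> t" for t
      proof -
        define d where "d = exp (v * t) * exp (- (v * rad t))"
        have d0: "0 \<le> d" by (simp add: d_def)
        have "(\<integral>\<^sup>+\<xi>. ennreal (if rad t \<le> \<theta> * norm \<xi> then exp (v * (t + \<theta> * norm \<xi>)) - exp (v * t) else 0) \<partial>g)
          \<le> (\<integral>\<^sup>+\<xi>. ennreal (d * exp (2 * v * \<theta> * norm \<xi>)) \<partial>g)"
        proof (intro nn_integral_mono ennreal_leI)
          fix \<xi> :: 'a
          show "(if rad t \<le> \<theta> * norm \<xi> then exp (v * (t + \<theta> * norm \<xi>)) - exp (v * t) else 0) \<le> d * exp (2 * v * \<theta> * norm \<xi>)"
          proof (cases "rad t \<le> \<theta> * norm \<xi>")
            case True
            have "exp (v * (t + \<theta> * norm \<xi>)) - exp (v * t) \<le> exp (v * (t + \<theta> * norm \<xi>))" by simp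
            also have "\<dots> \<le> exp (v * t + - (v * rad t) + 2 * v * \<theta> * norm \<xi>)"
              using True v mult_left_mono[OF True, of v] by (simp add: algebra_simps)
            also have "\<dots> = d * exp (2 * v * \<theta> * norm \<xi>)" by (simp only: d_def exp_add)
            finally show ?thesis using True by simp
          qed (use d0 in simp)
        qed
        also have "\<dots> \<le> ennreal (d * mom (2 * v * \<theta>))" using v \<theta>0 by (intro EM d0) simp
        also have "d * mom (2 * v * \<theta>) = exp (v * t) * (exp (- (v * rad t)) * H)" by (simp add: d_def H_def)
        also have "\<dots> \<le> exp (v * t) * \<epsilon>"
        proof (rule mult_left_mono)
          have "H / \<epsilon> / v \<le> rad t" using R0[of t] t R1 by simp
          then have "H / \<epsilon> \<le> v * rad t" using v mult_left_mono[of "H / \<epsilon> / v" "rad t" v] by simp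
          also have "\<dots> \<le> exp (v * rad t)" using exp_ge_add_one_self[of "v * rad t"] by linarith
          finally have "H \<le> \<epsilon> * exp (v * rad t)" using \<epsilon> by (simp add: field_simps)
          then show "exp (- (v * rad t)) * H \<le> \<epsilon>" by (simp add: exp_minus field_simps)
        qed simp
        finally show ?thesis by (simp add: ennreal_leI mult.commute)
      qed
      show "(\<integral>\<^sup>+\<xi>. ennreal (exp (v * (R1 + \<theta> * norm \<xi>))) \<partial>g) \<le> ennreal K"
        using EM[of "exp (v * R1)" "v * \<theta>"] v \<theta>0 by (simp add: K_def exp_add distrib_left mult.assoc)
    qed (use R1 K0 x v in \<open>auto\<close>)
  qed
  then show ?thesis unfolding pcn_drift_def using \<epsilon> K0 by (intro exI[of _ "max 0 (1 - \<epsilon>)"] exI[of _ K]) auto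
qed

text \<open>
By the Cauchy-Schwarz inequality the squared mean of the cost is at most the mean of \<open>f\<close> times the mean of the
weight. If \<open>V x + V y \<le> W0\<close>, both states lie in a fixed ball, so \<open>|x - y| \<le> R2\<close> and the
decrease \<open>r exp (- r / \<eta>)\<close> of the mean of \<open>f\<close> is at least \<open>\<eta> exp (- R2 / \<eta>) f r\<close>.
\<close>

lemma exists_cost_contraction:
  fixes V :: "'a \<Rightarrow> real"
  assumes V0: "\<And>x. 0 \<le> V x" and Vm[measurable]: "V \<in> borel_measurable borel"
    and AB: "0 \<le> B" "\<And>x. norm x \<le> A + B * V x"
    and lyap: "pcn_drift \<Phi> L \<delta> mom small V"
  shows "\<exists>\<eta> \<beta> \<kappa>. 0 < \<eta> \<and> 0 < \<beta> \<and> \<beta> \<le> 1 \<and> 0 \<le> \<kappa> \<and> \<kappa> < 1 \<and> (\<forall>S g. pcn S g \<Phi> L \<delta> mom small \<longrightarrow>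
        (\<forall>x\<in>S. \<forall>y\<in>S. (\<integral>\<^sup>+w. ennreal (harris_cost \<eta> \<beta> V (pcn_step \<delta> \<Phi> x w) (pcn_step \<delta> \<Phi> y w)) \<partial>(g \<Otimes>\<^sub>M unif))
            \<le> ennreal \<kappa> * ennreal (harris_cost \<eta> \<beta> V x y)))"
proof -
  define \<eta> where "\<eta> = q * (1 - sqrt (1 - 2 * \<delta>)) / (2 * L + 1)"
  have \<eta>0: "\<eta> > 0" unfolding \<eta>_def using q(2) \<delta> L0 by (simp add: add_nonneg_pos)
  define f where "f t = 1 - exp (- t / \<eta>)" for t
  have f0: "0 \<le> f t" "f t \<le> 1" if "0 \<le> t" for t using that \<eta>0 by (simp_all add: f_def)
  obtain l K where l: "0 \<le> l" "l < 1" and K: "0 \<le> K" and LY: "\<And>S g x. pcn S g \<Phi> L \<delta> mom small \<Longrightarrow> x \<in> S \<Longrightarrow>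
        (\<integral>\<^sup>+w. ennreal (V (pcn_step \<delta> \<Phi> x w)) \<partial>(g \<Otimes>\<^sub>M unif)) \<le> ennreal (l * V x + K)"
    using lyap unfolding pcn_drift_def by blast
  define W0 where "W0 = 4 * K / (1 - l) + 1"
  define R2 where "R2 = 2 * A + B * W0"
  define \<kappa>0 where "\<kappa>0 = 1 - \<eta> * exp (- R2 / \<eta>)"
  have "\<kappa>0 < 1" using \<eta>0 by (simp add: \<kappa>0_def)
  then obtain \<beta> \<kappa> where \<beta>: "0 < \<beta>" "\<beta> \<le> 1" and \<kappa>: "0 \<le> \<kappa>" "\<kappa> < 1"
    and HW: "\<And>f A W. 0 \<le> f \<Longrightarrow> 0 \<le> A \<Longrightarrow> A \<le> f \<Longrightarrow> 0 \<le> W \<Longrightarrow> (W \<le> W0 \<Longrightarrow> A \<le> \<kappa>0 * f) \<Longrightarrow>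
        A * (1 + 2 * \<beta> * K + l * \<beta> * W) \<le> \<kappa>\<^sup>2 * (f * (1 + \<beta> * W))"
    using exists_weight_contraction[OF l K W0_def, of \<kappa>0] by blast
  have "(\<integral>\<^sup>+w. ennreal (harris_cost \<eta> \<beta> V (pcn_step \<delta> \<Phi> x w) (pcn_step \<delta> \<Phi> y w)) \<partial>(g \<Otimes>\<^sub>M unif))
            \<le> ennreal \<kappa> * ennreal (harris_cost \<eta> \<beta> V x y)"
    if pc: "pcn S g \<Phi> L \<delta> mom small" and x: "x \<in> S" and y: "y \<in> S" for S g x y
  proof -
    interpret pcn S g \<Phi> L \<delta> mom small by fact
    note [measurable] = F_borel[OF x] F_borel[OF y]
    define r where "r = norm (x - y)"
    have r0: "r \<ge> 0" by (simp add: r_def)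
    define Ad where "Ad = f r - r * exp (- r / \<eta>)"
    define Wt where "Wt = V x + V y"
    have Wt0: "Wt \<ge> 0" using V0 by (simp add: Wt_def)
    have dist: "(\<integral>\<^sup>+w. ennreal (f (norm (F x w - F y w))) \<partial>W) \<le> ennreal Ad"
      unfolding Ad_def by (rule distance_contraction[OF x y s a acc q \<eta>_def f_def r_def])
    have fr: "f r \<le> r / \<eta>" using exp_ge_add_one_self[of "- r / \<eta>"] by (simp add: f_def)
    have Ad1: "Ad \<le> f r" using r0 by (simp add: Ad_def)
    have Ad2: "Ad \<le> \<kappa>0 * f r" if "Wt \<le> W0"
    proof -
      have "r \<le> norm x + norm y" unfolding r_def by (rule norm_triangle_ineq4)
      also have "\<dots> \<le> 2 * A + B * Wt" using AB(2)[of x] AB(2)[of y] by (simp add: Wt_def algebra_simps)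
      also have "\<dots> \<le> R2" unfolding R2_def using that AB(1) by (simp add: mult_left_mono)
      finally have "exp (- R2 / \<eta>) \<le> exp (- r / \<eta>)" using \<eta>0 by (simp add: divide_right_mono)
      then have "(\<eta> * f r) * exp (- R2 / \<eta>) \<le> r * exp (- r / \<eta>)"
        using fr \<eta>0 r0 f0[OF r0] by (intro mult_mono) (auto simp: field_simps)
      then show ?thesis by (simp add: Ad_def \<kappa>0_def algebra_simps)
    qed
    have VFm: "(\<lambda>w. ennreal (V (F x w))) \<in> borel_measurable W" "(\<lambda>w. ennreal (V (F y w))) \<in> borel_measurable W"
      by measurable
    have weight: "(\<integral>\<^sup>+w. ennreal (1 + \<beta> * V (F x w) + \<beta> * V (F y w)) \<partial>W) \<le> ennreal (1 + 2 * \<beta> * K + l * \<beta> * Wt)"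
    proof -
      have "(\<integral>\<^sup>+w. ennreal (1 + \<beta> * V (F x w) + \<beta> * V (F y w)) \<partial>W)
         = (\<integral>\<^sup>+w. 1 + (ennreal \<beta> * ennreal (V (F x w)) + ennreal \<beta> * ennreal (V (F y w))) \<partial>W)"
        using \<beta> V0 by (intro nn_integral_cong) (simp add: ennreal_plus ennreal_mult add.assoc)
      also have "\<dots> = 1 + (ennreal \<beta> * (\<integral>\<^sup>+w. ennreal (V (F x w)) \<partial>W) + ennreal \<beta> * (\<integral>\<^sup>+w. ennreal (V (F y w)) \<partial>W))"
        using VFm W.emeasure_space_1 by (simp add: nn_integral_add nn_integral_cmult)
      also have "\<dots> \<le> 1 + (ennreal \<beta> * ennreal (l * V x + K) + ennreal \<beta> * ennreal (l * V y + K))"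
        by (intro add_left_mono add_mono mult_left_mono LY[OF pc] x y) auto
      also have "\<dots> = ennreal (1 + (\<beta> * (l * V x + K) + \<beta> * (l * V y + K)))"
        using \<beta> l K V0 by (simp add: ennreal_plus ennreal_mult)
      also have "1 + (\<beta> * (l * V x + K) + \<beta> * (l * V y + K)) = 1 + 2 * \<beta> * K + l * \<beta> * Wt"
        by (simp add: Wt_def algebra_simps)
      finally show ?thesis .
    qed
    \<comment> \<open>\<open>1 + r \<le> exp (r / \<eta>)\<close> holds because \<open>q\<close> is at most a probability, so \<open>\<eta> \<le> 1\<close>.\<close>
    have Ad0: "Ad \<ge> 0"
    proof -
      have "small (s / \<theta>) \<le> 1" using small[of "s / \<theta>"] s \<theta>0 prob_le_1 order_trans by fastforce
      then have "q \<le> 1" using q a mult_mono[of "small (s / \<theta>)" 1 a 1] by simp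
      then have "q * (1 - c) \<le> 1 * 1" using q(2) c01 by (intro mult_mono) auto
      then have "\<eta> \<le> 1" using L0 unfolding \<eta>_def by (simp add: divide_le_eq)
      then have "1 + r \<le> 1 + r / \<eta>" using \<eta>0 r0 mult_left_le[of \<eta> r] by (simp add: le_divide_eq)
      also have "\<dots> \<le> exp (r / \<eta>)" by (rule exp_ge_add_one_self)
      finally have "(1 + r) * exp (- r / \<eta>) \<le> exp (r / \<eta>) * exp (- r / \<eta>)" by (rule mult_right_mono) simp
      also have "\<dots> = 1" by (simp flip: exp_add)
      finally show ?thesis by (simp add: Ad_def f_def algebra_simps)
    qed
    have hc: "harris_cost \<eta> \<beta> V x y = sqrt (f r * (1 + \<beta> * Wt))"
      by (simp add: harris_cost_def r_def f_def Wt_def distrib_left add.assoc)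
    have hc0: "0 \<le> harris_cost \<eta> \<beta> V x y"
      unfolding hc using f0[OF r0] \<beta> Wt0 by simp
    let ?u = "\<lambda>w. ennreal (sqrt (f (norm (F x w - F y w))))" and ?v = "\<lambda>w. ennreal (sqrt (1 + \<beta> * V (F x w) + \<beta> * V (F y w)))"
    have "(\<integral>\<^sup>+w. ennreal (harris_cost \<eta> \<beta> V (F x w) (F y w)) \<partial>W)\<^sup>2 = (\<integral>\<^sup>+w. ?u w * ?v w \<partial>W)\<^sup>2"
      using \<beta> V0 f0 unfolding harris_cost_def f_def[symmetric]
      by (simp add: real_sqrt_mult ennreal_mult)
    also have "\<dots> \<le> (\<integral>\<^sup>+w. (?u w)\<^sup>2 \<partial>W) * (\<integral>\<^sup>+w. (?v w)\<^sup>2 \<partial>W)"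
      by (rule Cauchy_Schwarz_nn_integral) (unfold f_def, measurable)
    also have "(\<integral>\<^sup>+w. (?u w)\<^sup>2 \<partial>W) = (\<integral>\<^sup>+w. ennreal (f (norm (F x w - F y w))) \<partial>W)"
      using f0 by (simp add: ennreal_power)
    also have "(\<integral>\<^sup>+w. (?v w)\<^sup>2 \<partial>W) = (\<integral>\<^sup>+w. ennreal (1 + \<beta> * V (F x w) + \<beta> * V (F y w)) \<partial>W)"
      using \<beta> V0 by (simp add: ennreal_power)
    also have "(\<integral>\<^sup>+w. ennreal (f (norm (F x w - F y w))) \<partial>W) * \<dots> \<le> ennreal Ad * ennreal (1 + 2 * \<beta> * K + l * \<beta> * Wt)"
      by (rule mult_mono[OF dist weight]) auto
    also have "\<dots> = ennreal (Ad * (1 + 2 * \<beta> * K + l * \<beta> * Wt))"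
      using Ad0 \<beta> K l Wt0 by (intro ennreal_mult[symmetric]) auto
    also have "\<dots> \<le> ennreal (\<kappa>\<^sup>2 * (f r * (1 + \<beta> * Wt)))"
      by (intro ennreal_leI HW f0 r0 Ad0 Ad1 Wt0 Ad2)
    also have "\<kappa>\<^sup>2 * (f r * (1 + \<beta> * Wt)) = (\<kappa> * harris_cost \<eta> \<beta> V x y)\<^sup>2"
      using f0[OF r0] \<beta> Wt0 by (simp add: hc power_mult_distrib)
    finally have "(\<integral>\<^sup>+w. ennreal (harris_cost \<eta> \<beta> V (F x w) (F y w)) \<partial>W) \<le> ennreal (\<kappa> * harris_cost \<eta> \<beta> V x y)"
      by (rule ennreal_square_le[OF _ mult_nonneg_nonneg[OF \<kappa>(1) hc0]])
    then show ?thesis unfolding ennreal_mult[OF \<kappa>(1) hc0] .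
  qed
  then show ?thesis using \<eta>0 \<beta> \<kappa> by blast
qed

end

section \<open>Invariant measure and transport distance of one chain\<close>

context pcn
begin

context
  fixes V :: "'a \<Rightarrow> real" and \<eta> \<beta> \<kappa> :: real
  assumes V0: "\<And>x. 0 \<le> V x" and Vm[measurable]: "V \<in> borel_measurable borel"
    and \<eta>: "0 < \<eta>" and \<beta>: "0 < \<beta>" "\<beta> \<le> 1" and \<kappa>: "0 \<le> \<kappa>" "\<kappa> < 1"
    and contr: "\<And>x y. x \<in> S \<Longrightarrow> y \<in> S \<Longrightarrow>
       (\<integral>\<^sup>+w. ennreal (harris_cost \<eta> \<beta> V (F x w) (F y w)) \<partial>W) \<le> ennreal \<kappa> * ennreal (harris_cost \<eta> \<beta> V x y)"
begin

lemma proj_M_borel: "(\<lambda>z. fst z) \<in> M \<Otimes>\<^sub>M M \<rightarrow>\<^sub>M borel" "(\<lambda>z. snd z) \<in> M \<Otimes>\<^sub>M M \<rightarrow>\<^sub>M borel"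
  by (rule measurable_compose[OF _ id_M], measurable)+

lemma harris_cost_measurable: "(\<lambda>z. harris_cost \<eta> \<beta> V (fst z) (snd z)) \<in> borel_measurable (M \<Otimes>\<^sub>M M)"
proof -
  note [measurable] = proj_M_borel
  show ?thesis unfolding harris_cost_def by measurable
qed

lemma harris_cost_nonneg: "0 \<le> harris_cost \<eta> \<beta> V x y"
  unfolding harris_cost_def using \<eta> \<beta> V0 by simp

lemma unique_invariant_target:
  assumes sym: "distr (g \<Otimes>\<^sub>M g) (g \<Otimes>\<^sub>M g) (\<lambda>p. (fst p, pcn_prop \<delta> (fst p) (snd p)))
      = distr (g \<Otimes>\<^sub>M g) (g \<Otimes>\<^sub>M g) (\<lambda>p. (pcn_prop \<delta> (fst p) (snd p), fst p))"
  shows "unique_invariant M (pcn_kernel \<delta> \<Phi> g) (target g \<Phi>)"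
  unfolding unique_invariant_def
proof (intro conjI ballI impI)
  show "target g \<Phi> \<in> space (prob_algebra M)" by (rule target_prob)
  have inv: "target g \<Phi> \<bind> rm.kern = target g \<Phi>" by (rule target_invariant[OF sym])
  then show "target g \<Phi> \<bind> pcn_kernel \<delta> \<Phi> g = target g \<Phi>"
    using bind_kernel_eq[OF target_prob] by simp
  fix \<nu> assume \<nu>: "\<nu> \<in> space (prob_algebra M)" "\<nu> \<bind> pcn_kernel \<delta> \<Phi> g = \<nu>"
  then have "\<nu> \<bind> rm.kern = \<nu>" using bind_kernel_eq[OF \<nu>(1)] by simp
  then have \<nu>inv: "\<nu> \<bind> rm.kern = \<nu>" .
  show "\<nu> = target g \<Phi>"
  proof (rule unique_invariant_of_contraction[OF rm.random_map_axioms S_borel harris_cost_measurable \<kappa> _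
        harris_cost_nonneg contr _ \<nu>(1) target_prob \<nu>inv inv])
    show "min 1 (norm (x - y)) \<le> 2 * max 1 \<eta> * harris_cost \<eta> \<beta> V x y" for x y
      by (rule trunc_dist_le_harris_cost[where V=V, OF \<eta> \<beta>(1) V0 V0])
  qed simp
qed

lemma transport_contraction:
  assumes \<epsilon>: "0 < \<epsilon>"
    and n: "2 * (sqrt (2 * max 1 (\<eta> / \<epsilon>) / \<beta>) * \<kappa> ^ n * sqrt (max 1 (\<epsilon> / \<eta>))) \<le> 1"
    and \<nu>: "\<nu>1 \<in> space (prob_algebra M)" "\<nu>2 \<in> space (prob_algebra M)"
  shows "transport_dist (weighted_dist \<epsilon> V) (kernel_steps (pcn_kernel \<delta> \<Phi> g) n \<nu>1) (kernel_steps (pcn_kernel \<delta> \<Phi> g) n \<nu>2)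
     \<le> 1/2 * transport_dist (weighted_dist \<epsilon> V) \<nu>1 \<nu>2"
  unfolding kernel_steps_eq[OF \<nu>(1)] kernel_steps_eq[OF \<nu>(2)]
proof (rule rm.transport_dist_steps[where c="\<lambda>z. ennreal (harris_cost \<eta> \<beta> V (fst z) (snd z))" and \<kappa>="ennreal \<kappa>"
      and A="ennreal (sqrt (2 * max 1 (\<eta> / \<epsilon>) / \<beta>))" and B="ennreal (sqrt (max 1 (\<epsilon> / \<eta>)))"])
  let ?A = "sqrt (2 * max 1 (\<eta> / \<epsilon>) / \<beta>)" and ?B = "sqrt (max 1 (\<epsilon> / \<eta>))"
  note [measurable] = harris_cost_measurable proj_M_borel
  have AB: "0 \<le> ?A" "0 \<le> ?B" using \<beta> by auto
  show "(\<lambda>z. ennreal (harris_cost \<eta> \<beta> V (fst z) (snd z))) \<in> borel_measurable (M \<Otimes>\<^sub>M M)" by measurable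
  show "(\<lambda>z. ennreal (weighted_dist \<epsilon> V (fst z) (snd z))) \<in> borel_measurable (M \<Otimes>\<^sub>M M)"
    unfolding weighted_dist_def trunc_dist_def by measurable
  fix x y assume xy: "x \<in> space M" "y \<in> space M"
  show "(\<integral>\<^sup>+w. ennreal (harris_cost \<eta> \<beta> V (fst (F x w, F y w)) (snd (F x w, F y w))) \<partial>W)
     \<le> ennreal \<kappa> * ennreal (harris_cost \<eta> \<beta> V (fst (x, y)) (snd (x, y)))"
    using contr xy by (simp add: space_M)
  show "ennreal (weighted_dist \<epsilon> V x y) \<le> ennreal ?A * ennreal (harris_cost \<eta> \<beta> V (fst (x, y)) (snd (x, y)))"
    using weighted_dist_le_harris_cost[where V=V, OF \<epsilon> \<eta> \<beta> V0 V0, of x y]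
    unfolding fst_conv snd_conv ennreal_mult[OF AB(1) harris_cost_nonneg, symmetric] by (rule ennreal_leI)
  have wd: "0 \<le> weighted_dist \<epsilon> V x y" unfolding weighted_dist_def trunc_dist_def using \<epsilon> V0 by simp
  show "ennreal (harris_cost \<eta> \<beta> V (fst (x, y)) (snd (x, y))) \<le> ennreal ?B * ennreal (weighted_dist \<epsilon> V x y)"
    using harris_cost_le_weighted_dist[where V=V, OF \<epsilon> \<eta> \<beta> V0 V0, of x y]
    unfolding fst_conv snd_conv ennreal_mult[OF AB(2) wd, symmetric] by (rule ennreal_leI)
next
  let ?A = "sqrt (2 * max 1 (\<eta> / \<epsilon>) / \<beta>)" and ?B = "sqrt (max 1 (\<epsilon> / \<eta>))"
  have AB: "0 \<le> ?A" "0 \<le> ?B" using \<beta> by auto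
  have "2 * (ennreal ?A * ennreal \<kappa> ^ n * ennreal ?B) = ennreal 2 * (ennreal ?A * ennreal (\<kappa> ^ n) * ennreal ?B)"
    by (simp only: ennreal_power[OF \<kappa>(1)] ennreal_numeral)
  also have "\<dots> = ennreal (2 * (?A * \<kappa> ^ n * ?B))"
    using AB \<kappa>(1) by (simp only: ennreal_mult[symmetric] mult_nonneg_nonneg zero_le_power zero_le_numeral)
  also have "\<dots> \<le> ennreal 1" by (rule ennreal_leI[OF n])
  finally show "2 * (ennreal ?A * ennreal \<kappa> ^ n * ennreal ?B) \<le> 1" by (simp only: ennreal_1)
qed (rule \<nu>)+

end

end

section \<open>The Gaussian noise and its finite-dimensional projections\<close>

context gaussian_measure
begin

definition exp_mom :: "real \<Rightarrow> real" where
  "exp_mom w = enn2real (\<integral>\<^sup>+x. ennreal (exp (w * norm x)) \<partial>\<gamma>)"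

lemma exp_mom: "ennreal (exp_mom w) = (\<integral>\<^sup>+x. ennreal (exp (w * norm x)) \<partial>\<gamma>)"
  unfolding exp_mom_def using exp_moment[of w] by simp

lemma pcn_gaussian:
  assumes "L-lipschitz_on UNIV \<Phi>" "0 < \<delta>" "\<delta> \<le> 1/2"
  shows "pcn UNIV \<gamma> \<Phi> L \<delta> exp_mom (\<lambda>s. measure \<gamma> (ball 0 s))"
proof
  show "\<gamma> \<in> space (prob_algebra (restrict_space borel UNIV))"
    by (simp add: space_prob_algebra prob_space_axioms)
  show "measure \<gamma> (ball 0 s) \<le> measure \<gamma> {\<xi> \<in> UNIV. norm \<xi> < s}" for s
    by (simp add: ball_def)
qed (use assms exp_mom in auto)

text \<open>
A projection shrinks norms: balls gain mass, and exponential moments with nonnegative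
exponent decrease.
\<close>

lemma pcn_gaussian_head:
  assumes "L-lipschitz_on UNIV \<Phi>" "0 < \<delta>" "\<delta> \<le> 1/2"
  shows "pcn (head_span e m) (gaussian_head lam e m) \<Phi> L \<delta> exp_mom (\<lambda>s. measure \<gamma> (ball 0 s))"
proof
  let ?S = "head_span e m" and ?g = "gaussian_head lam e m"
  have P[measurable]: "basis_proj e m \<in> \<gamma> \<rightarrow>\<^sub>M restrict_space borel ?S" by (rule measurable_basis_proj)
  show "subspace ?S" by (simp add: head_span_def)
  show "closed ?S" by (rule closed_head_span[OF onb])
  show "?g \<in> space (prob_algebra (restrict_space borel ?S))"
    unfolding gaussian_head_eq by (simp add: space_prob_algebra prob_space_distr[OF P])
  show "(\<integral>\<^sup>+\<xi>. ennreal (exp (w * norm \<xi>)) \<partial>?g) \<le> ennreal (exp_mom w)" if "0 \<le> w" for w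
  proof -
    have m: "(\<lambda>\<xi>. ennreal (exp (w * norm \<xi>))) \<in> borel_measurable (restrict_space borel ?S)"
      by (rule measurable_restrict_space1) measurable
    have "(\<integral>\<^sup>+\<xi>. ennreal (exp (w * norm \<xi>)) \<partial>?g) = (\<integral>\<^sup>+x. ennreal (exp (w * norm (basis_proj e m x))) \<partial>\<gamma>)"
      unfolding gaussian_head_eq by (subst nn_integral_distr[OF P]) (simp_all add: m)
    also have "\<dots> \<le> ennreal (exp_mom w)"
      unfolding exp_mom using that by (intro nn_integral_mono ennreal_leI) (simp add: mult_left_mono norm_basis_proj_le[OF onb])
    finally show ?thesis .
  qed
  show "measure \<gamma> (ball 0 s) \<le> measure ?g {\<xi> \<in> ?S. norm \<xi> < s}" for s
  proof -
    have A: "{\<xi> \<in> ?S. norm \<xi> < s} \<in> sets (restrict_space borel ?S)"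
    proof -
      have "{\<xi> \<in> ?S. norm \<xi> < s} = ?S \<inter> ball 0 s" by (auto simp: ball_def)
      then show ?thesis by (auto simp: sets_restrict_space)
    qed
    have "measure \<gamma> (ball 0 s) \<le> measure \<gamma> (basis_proj e m -` {\<xi> \<in> ?S. norm \<xi> < s} \<inter> space \<gamma>)"
    proof (rule finite_measure_mono)
      show "ball 0 s \<subseteq> basis_proj e m -` {\<xi> \<in> ?S. norm \<xi> < s} \<inter> space \<gamma>"
        using norm_basis_proj_le[OF onb, of m] basis_proj_in_head_span[OF onb, of m]
        by (auto simp: ball_def intro: le_less_trans)
    qed (rule measurable_sets[OF P A])
    also have "\<dots> = measure ?g {\<xi> \<in> ?S. norm \<xi> < s}"
      unfolding gaussian_head_eq by (rule measure_distr[symmetric, OF P]) (simp add: A)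
    finally show ?thesis .
  qed
qed (use assms in auto)

lemma reversible_gaussian:
  assumes "0 < \<delta>" "\<delta> \<le> 1/2"
  shows "distr (\<gamma> \<Otimes>\<^sub>M \<gamma>) (\<gamma> \<Otimes>\<^sub>M \<gamma>) (\<lambda>p. (fst p, pcn_prop \<delta> (fst p) (snd p)))
      = distr (\<gamma> \<Otimes>\<^sub>M \<gamma>) (\<gamma> \<Otimes>\<^sub>M \<gamma>) (\<lambda>p. (pcn_prop \<delta> (fst p) (snd p), fst p))"
  unfolding reversible_proposal_def pcn_prop_def using assms by (intro rotation_symmetric) simp

text \<open>
The proposal is linear in state and noise, so it commutes with the projection, and the symmetry for \<open>\<gamma>\<close>
is carried over by the image measure.
\<close>

lemma reversible_gaussian_head:
  fixes m :: nat
  assumes \<delta>: "0 < \<delta>" "\<delta> \<le> 1/2"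
  defines "g \<equiv> gaussian_head lam e m"
  shows "distr (g \<Otimes>\<^sub>M g) (g \<Otimes>\<^sub>M g) (\<lambda>p. (fst p, pcn_prop \<delta> (fst p) (snd p)))
      = distr (g \<Otimes>\<^sub>M g) (g \<Otimes>\<^sub>M g) (\<lambda>p. (pcn_prop \<delta> (fst p) (snd p), fst p))"
proof -
  let ?M = "restrict_space borel (head_span e m)" and ?P = "basis_proj e m"
  define PP where "PP = (\<lambda>p. (?P (fst p), ?P (snd p)))"
  have P[measurable]: "?P \<in> \<gamma> \<rightarrow>\<^sub>M ?M" by (rule measurable_basis_proj)
  have g: "g = distr \<gamma> ?M ?P" unfolding g_def by (rule gaussian_head_eq)
  have sg[measurable_cong]: "sets g = sets ?M" by (simp add: g)
  have spg: "space g = head_span e m" using sets_eq_imp_space_eq[OF sg] by (simp add: space_restrict_space)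
  have pg: "prob_space g" unfolding g by (rule prob_space_distr[OF P])
  have PPm: "PP \<in> \<gamma> \<Otimes>\<^sub>M \<gamma> \<rightarrow>\<^sub>M g \<Otimes>\<^sub>M g" unfolding PP_def by measurable
  have gg: "g \<Otimes>\<^sub>M g = distr (\<gamma> \<Otimes>\<^sub>M \<gamma>) (g \<Otimes>\<^sub>M g) PP"
  proof -
    have "g \<Otimes>\<^sub>M g = distr (\<gamma> \<Otimes>\<^sub>M \<gamma>) (?M \<Otimes>\<^sub>M ?M) (\<lambda>(x, y). (?P x, ?P y))"
      using pair_measure_distr[OF P P] prob_space_imp_sigma_finite[OF pg] unfolding g by blast
    also have "\<dots> = distr (\<gamma> \<Otimes>\<^sub>M \<gamma>) (g \<Otimes>\<^sub>M g) PP"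
      by (rule distr_cong) (auto simp: PP_def sg intro!: sets_pair_measure_cong)
    finally show ?thesis .
  qed
  have Pprop: "?P (pcn_prop \<delta> x y) = pcn_prop \<delta> (?P x) (?P y)" for x y
    unfolding pcn_prop_def by (simp add: linear_add[OF linear_basis_proj] linear_scale[OF linear_basis_proj])
  have prop\<gamma>[measurable]: "(\<lambda>p. pcn_prop \<delta> (fst p) (snd p)) \<in> \<gamma> \<Otimes>\<^sub>M \<gamma> \<rightarrow>\<^sub>M \<gamma>"
    unfolding pcn_prop_def by measurable
  have propg[measurable]: "(\<lambda>p. pcn_prop \<delta> (fst p) (snd p)) \<in> g \<Otimes>\<^sub>M g \<rightarrow>\<^sub>M g"
  proof -
    have i: "(\<lambda>x. x) \<in> g \<rightarrow>\<^sub>M borel"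
      unfolding measurable_cong_sets[OF sg refl] by (rule measurable_restrict_space1) simp
    have [measurable]: "(\<lambda>z. fst z) \<in> g \<Otimes>\<^sub>M g \<rightarrow>\<^sub>M borel" "(\<lambda>z. snd z) \<in> g \<Otimes>\<^sub>M g \<rightarrow>\<^sub>M borel"
      using measurable_compose[OF measurable_fst i] measurable_compose[OF measurable_snd i] by auto
    have "(\<lambda>p. pcn_prop \<delta> (fst p) (snd p)) \<in> g \<Otimes>\<^sub>M g \<rightarrow>\<^sub>M ?M"
    proof (rule measurable_restrict_space2)
      show "(\<lambda>p. pcn_prop \<delta> (fst p) (snd p)) \<in> g \<Otimes>\<^sub>M g \<rightarrow>\<^sub>M borel" unfolding pcn_prop_def by measurable
    qed (auto simp: space_pair_measure spg pcn_prop_def head_span_def intro!: span_add span_scale)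
    then show ?thesis unfolding measurable_cong_sets[OF refl sg] .
  qed
  have A: "(\<lambda>p. (fst p, pcn_prop \<delta> (fst p) (snd p))) \<in> N \<Otimes>\<^sub>M N \<rightarrow>\<^sub>M N \<Otimes>\<^sub>M N"
    "(\<lambda>p. (pcn_prop \<delta> (fst p) (snd p), fst p)) \<in> N \<Otimes>\<^sub>M N \<rightarrow>\<^sub>M N \<Otimes>\<^sub>M N"
    if "N = g \<or> N = \<gamma>" for N
    using that prop\<gamma> propg by (auto intro!: measurable_Pair)
  have push: "distr (g \<Otimes>\<^sub>M g) (g \<Otimes>\<^sub>M g) f = distr (distr (\<gamma> \<Otimes>\<^sub>M \<gamma>) (\<gamma> \<Otimes>\<^sub>M \<gamma>) f) (g \<Otimes>\<^sub>M g) PP"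
    if f: "f \<in> g \<Otimes>\<^sub>M g \<rightarrow>\<^sub>M g \<Otimes>\<^sub>M g" "f \<in> \<gamma> \<Otimes>\<^sub>M \<gamma> \<rightarrow>\<^sub>M \<gamma> \<Otimes>\<^sub>M \<gamma>" and c: "f \<circ> PP = PP \<circ> f" for f
  proof -
    have "distr (g \<Otimes>\<^sub>M g) (g \<Otimes>\<^sub>M g) f = distr (distr (\<gamma> \<Otimes>\<^sub>M \<gamma>) (g \<Otimes>\<^sub>M g) PP) (g \<Otimes>\<^sub>M g) f"
      by (simp only: gg[symmetric])
    also have "\<dots> = distr (\<gamma> \<Otimes>\<^sub>M \<gamma>) (g \<Otimes>\<^sub>M g) (f \<circ> PP)" by (rule distr_distr[OF f(1) PPm])
    also have "\<dots> = distr (distr (\<gamma> \<Otimes>\<^sub>M \<gamma>) (\<gamma> \<Otimes>\<^sub>M \<gamma>) f) (g \<Otimes>\<^sub>M g) PP"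
      unfolding c by (rule distr_distr[symmetric, OF PPm f(2)])
    finally show ?thesis .
  qed
  have c: "(\<lambda>p. (fst p, pcn_prop \<delta> (fst p) (snd p))) \<circ> PP = PP \<circ> (\<lambda>p. (fst p, pcn_prop \<delta> (fst p) (snd p)))"
    "(\<lambda>p. (pcn_prop \<delta> (fst p) (snd p), fst p)) \<circ> PP = PP \<circ> (\<lambda>p. (pcn_prop \<delta> (fst p) (snd p), fst p))"
    by (auto simp: PP_def Pprop)
  have A': "(\<lambda>p. (fst p, pcn_prop \<delta> (fst p) (snd p))) \<in> g \<Otimes>\<^sub>M g \<rightarrow>\<^sub>M g \<Otimes>\<^sub>M g"
    "(\<lambda>p. (fst p, pcn_prop \<delta> (fst p) (snd p))) \<in> \<gamma> \<Otimes>\<^sub>M \<gamma> \<rightarrow>\<^sub>M \<gamma> \<Otimes>\<^sub>M \<gamma>"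
    "(\<lambda>p. (pcn_prop \<delta> (fst p) (snd p), fst p)) \<in> g \<Otimes>\<^sub>M g \<rightarrow>\<^sub>M g \<Otimes>\<^sub>M g"
    "(\<lambda>p. (pcn_prop \<delta> (fst p) (snd p), fst p)) \<in> \<gamma> \<Otimes>\<^sub>M \<gamma> \<rightarrow>\<^sub>M \<gamma> \<Otimes>\<^sub>M \<gamma>"
    by (intro A; simp)+
  show ?thesis
    unfolding reversible_proposal_def push[OF A'(1,2) c(1)] push[OF A'(3,4) c(2)]
    using reversible_gaussian[OF \<delta>] by (simp add: reversible_proposal_def)
qed

end

section \<open>Dimension-independent spectral gap\<close>

text \<open>
Inside the ball of radius \<open>R\<close> the proposal is at distance at most \<open>\<rho> R + s\<close> and \<open>\<Phi>\<close> is Lipschitz; outside, the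
proposal lies in the ball on which \<open>exp (\<Phi> x - \<Phi> z)\<close> is assumed to be bounded below.
\<close>

lemma accept_prob_lower_bound:
  fixes \<Phi> :: "'a::{real_inner, polish_space} \<Rightarrow> real"
  assumes lip: "L-lipschitz_on UNIV \<Phi>" and \<rho>: "\<rho> = 1 - sqrt (1 - 2 * \<delta>)" and \<delta>: "0 < \<delta>" "\<delta> \<le> 1/2"
    and inf: "\<forall>x. x \<notin> ball 0 R \<longrightarrow>
           (INF z\<in>ball ((1 - \<rho>) *\<^sub>R x) (rad (norm x)). exp (- \<Phi> z + \<Phi> x)) > exp \<alpha>l"
    and s: "\<And>t. R \<le> t \<Longrightarrow> s \<le> rad t"
    and \<xi>: "sqrt (2 * \<delta>) * norm \<xi> < s"
  shows "min (min 1 (exp \<alpha>l)) (exp (- (L * (\<rho> * R + s)))) \<le> accept_prob \<Phi> x (pcn_prop \<delta> x \<xi>)"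
proof (cases "norm x < R")
  case True
  let ?p = "pcn_prop \<delta> x \<xi>"
  have L0: "L \<ge> 0" using lip by (rule lipschitz_on_nonneg)
  have \<rho>0: "\<rho> \<ge> 0" unfolding \<rho> using \<delta> by simp
  have "x - ?p = \<rho> *\<^sub>R x - sqrt (2 * \<delta>) *\<^sub>R \<xi>" by (simp add: pcn_prop_def \<rho> algebra_simps)
  then have "norm (x - ?p) \<le> \<rho> * norm x + sqrt (2 * \<delta>) * norm \<xi>"
    using norm_triangle_ineq4[of "\<rho> *\<^sub>R x" "sqrt (2 * \<delta>) *\<^sub>R \<xi>"] \<rho>0 \<delta> by simp
  also have "\<dots> \<le> \<rho> * R + s" using True \<xi> \<rho>0 by (intro add_mono mult_left_mono) auto
  finally have "L * norm (x - ?p) \<le> L * (\<rho> * R + s)" using L0 by (rule mult_left_mono)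
  moreover have "\<bar>\<Phi> x - \<Phi> ?p\<bar> \<le> L * norm (x - ?p)"
    using lipschitz_onD[OF lip, of x ?p] by (simp add: dist_norm)
  ultimately have "exp (- (L * (\<rho> * R + s))) \<le> exp (\<Phi> x - \<Phi> ?p)" by simp
  then show ?thesis unfolding accept_prob_def by (auto simp: min_def)
next
  case False
  let ?p = "pcn_prop \<delta> x \<xi>"
  have c: "1 - \<rho> = sqrt (1 - 2 * \<delta>)" by (simp add: \<rho>)
  have "dist ((1 - \<rho>) *\<^sub>R x) ?p = sqrt (2 * \<delta>) * norm \<xi>"
    using \<delta> by (simp add: c pcn_prop_def dist_norm)
  then have p: "?p \<in> ball ((1 - \<rho>) *\<^sub>R x) (rad (norm x))"
    using \<xi> s[of "norm x"] False by simp
  have bdd: "bdd_below ((\<lambda>z. exp (- \<Phi> z + \<Phi> x)) ` ball ((1 - \<rho>) *\<^sub>R x) (rad (norm x)))"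
    by (rule bdd_belowI[of _ 0]) auto
  have "exp \<alpha>l < (INF z\<in>ball ((1 - \<rho>) *\<^sub>R x) (rad (norm x)). exp (- \<Phi> z + \<Phi> x))"
    using inf False by simp
  also have "\<dots> \<le> exp (- \<Phi> ?p + \<Phi> x)" by (rule cINF_lower[OF bdd p])
  finally have "exp \<alpha>l < exp (\<Phi> x - \<Phi> ?p)" by simp
  then show ?thesis unfolding accept_prob_def by (auto simp: min_def)
qed

lemma filterlim_mult_powr_at_top:
  fixes r a :: real
  assumes "0 < r" "0 < a" and "\<And>t. 0 \<le> t \<Longrightarrow> rad t = r * t powr a"
  shows "filterlim rad at_top at_top"
  unfolding filterlim_at_top
proof
  fix Z :: real
  define t0 where "t0 = (max 0 Z / r) powr (1 / a)"
  have "Z \<le> rad t" if "t0 \<le> t" for t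
  proof -
    have t0: "0 \<le> t0" by (simp add: t0_def)
    have "max 0 Z / r = t0 powr a" unfolding t0_def using assms by (simp add: powr_powr)
    also have "\<dots> \<le> t powr a" using assms that t0 by (intro powr_mono2) auto
    finally have "max 0 Z \<le> r * t powr a" using assms by (simp add: field_simps)
    then show ?thesis using assms(3)[of t] that t0 by simp
  qed
  then show "eventually (\<lambda>t. Z \<le> rad t) at_top" by (auto simp: eventually_at_top_linorder)
qed

theorem theorem2p12:
  fixes \<gamma> :: "'a::{real_inner, polish_space} measure"
    and C :: "'a \<Rightarrow> 'a" and e :: "nat \<Rightarrow> 'a" and lam :: "nat \<Rightarrow> real"
    and \<delta> \<rho> L R \<alpha>l :: real
    and \<Phi> V :: "'a \<Rightarrow> real" and rad :: "real \<Rightarrow> real"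
  assumes "centred_gaussian \<gamma>" and "covariance_operator \<gamma> C"
    and "orthonormal_basis e" and "\<forall>n. C (e n) = (lam n)\<^sup>2 *\<^sub>R e n"
    and "0 < \<delta>" and "\<delta> \<le> 1/2" and "\<rho> = 1 - sqrt (1 - 2 * \<delta>)"
    and "L-lipschitz_on UNIV \<Phi>" and "integrable \<gamma> (\<lambda>x. exp (- \<Phi> x))"
    and "R > 0" and "\<forall>s\<ge>0. rad s \<ge> 0" and "\<forall>s\<ge>R. rad s \<le> \<rho> / 2 * s"
    and "\<forall>x. x \<notin> ball 0 R \<longrightarrow>
           (INF z\<in>ball ((1 - \<rho>) *\<^sub>R x) (rad (norm x)). exp (- \<Phi> z + \<Phi> x)) > exp \<alpha>l"
    and "(\<exists>r>0. \<exists>a. 1/2 < a \<and> a < 1 \<and> (\<forall>x::'a. rad (norm x) = r * norm x powr a) \<and>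
            ((\<exists>i\<ge>1. \<forall>x. V x = norm x ^ i) \<or> (\<exists>v>0. \<forall>x. V x = exp (v * norm x)))) \<or>
         (\<exists>r>0. (\<forall>x::'a. rad (norm x) = r) \<and> (\<exists>i\<ge>1. \<forall>x. V x = norm x ^ i))"
  shows "let S = head_span e;
             \<gamma>m = gaussian_head lam e;
             P = pcn_kernel \<delta> \<Phi> \<gamma>;
             Pm = (\<lambda>m. pcn_kernel \<delta> \<Phi> (\<gamma>m m))
         in
         unique_invariant borel P (target \<gamma> \<Phi>) \<and>
         (\<forall>m\<ge>1. unique_invariant (restrict_space borel (S m)) (Pm m)
                   (target (\<gamma>m m) (\<lambda>x. \<Phi> (orth_proj (S m) x)))) \<and>
         (\<forall>\<^sub>F \<epsilon> in at_right 0. \<exists>n\<ge>1.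
            (\<forall>\<nu>1\<in>space (prob_algebra borel). \<forall>\<nu>2\<in>space (prob_algebra borel).
               transport_dist (weighted_dist \<epsilon> V) (kernel_steps P n \<nu>1) (kernel_steps P n \<nu>2)
                 \<le> 1/2 * transport_dist (weighted_dist \<epsilon> V) \<nu>1 \<nu>2) \<and>
            (\<forall>m\<ge>1. \<forall>\<nu>1\<in>space (prob_algebra (restrict_space borel (S m))).
                    \<forall>\<nu>2\<in>space (prob_algebra (restrict_space borel (S m))).
               transport_dist (weighted_dist \<epsilon> V) (kernel_steps (Pm m) n \<nu>1)
                   (kernel_steps (Pm m) n \<nu>2)
                 \<le> 1/2 * transport_dist (weighted_dist \<epsilon> V) \<nu>1 \<nu>2))"
proof -
  note gau = assms(1) and cov = assms(2) and onb = assms(3) and eig = assms(4) and \<delta> = assms(5,6) and \<rho> = assms(7)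
    and lip = assms(8) and R = assms(10) and rad\<rho> = assms(12) and inf = assms(13) and alt = assms(14)
  interpret gaussian_measure \<gamma> C e lam
    by unfold_locales (use gau cov onb eig in auto)
  have L0: "L \<ge> 0" using lip by (rule lipschitz_on_nonneg)
  have mom0: "0 \<le> exp_mom w" for w by (simp add: exp_mom_def)
  \<comment> \<open>Since \<open>e 0\<close> is a unit vector, the formulas for \<open>rad\<close> at norms of vectors hold at all nonnegative numbers.\<close>
  have all_norms: "\<exists>x::'a. norm x = t" if "0 \<le> t" for t
  proof -
    have "norm (e 0) = 1" using ortho[OF onb, of 0 0] by (simp add: norm_eq_sqrt_inner)
    then show ?thesis using that by (intro exI[of _ "t *\<^sub>R e 0"]) simp
  qed
  have "(\<exists>r>0. \<exists>a>1/2. \<forall>x::'a. rad (norm x) = r * norm x powr a) \<or> (\<exists>r>0. \<forall>x::'a. rad (norm x) = r)"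
    using alt by blast
  then have "\<exists>s>0. \<forall>t\<ge>R. s \<le> rad t"
  proof (elim disjE exE conjE)
    fix r a :: real assume r: "0 < r" "1/2 < a" "\<forall>x::'a. rad (norm x) = r * norm x powr a"
    have "r * R powr a \<le> rad t" if t: "R \<le> t" for t
    proof -
      obtain x :: 'a where x: "norm x = t" using all_norms[of t] t R by auto
      have "R powr a \<le> t powr a" using t R r by (intro powr_mono2) auto
      then show ?thesis using r x by (metis mult_le_cancel_left_pos)
    qed
    moreover have "0 < r * R powr a" using r R by simp
    ultimately show ?thesis by blast
  next
    fix r :: real assume r: "0 < r" "\<forall>x::'a. rad (norm x) = r"
    have "r \<le> rad t" if "R \<le> t" for t
      using all_norms[of t] that R r by auto
    then show ?thesis using r by blast
  qed
  then obtain s where s: "0 < s" "\<And>t. R \<le> t \<Longrightarrow> s \<le> rad t" by blast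
  define a where "a = min (min 1 (exp \<alpha>l)) (exp (- (L * (\<rho> * R + s))))"
  have a: "0 < a" "a \<le> 1" by (auto simp: a_def)
  have acc: "a \<le> accept_prob \<Phi> x (pcn_prop \<delta> x \<xi>)" if "sqrt (2 * \<delta>) * norm \<xi> < s" for x \<xi>
    unfolding a_def using accept_prob_lower_bound[OF lip \<rho> \<delta> inf s(2) that] .
  define small where "small = (\<lambda>s. measure \<gamma> (ball 0 s))"
  define q where "q = small (s / sqrt (2 * \<delta>)) * a"
  have q0: "q > 0" unfolding q_def small_def using small_ball_pos[of "s / sqrt (2 * \<delta>)"] s a \<delta> by simp
  note ctx = \<delta> L0 s(1) a acc q_def q0
  have rads: "s \<le> rad t \<and> rad t \<le> (1 - sqrt (1 - 2 * \<delta>)) / 2 * t" if "R \<le> t" for t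
    using s(2)[OF that] rad\<rho> that unfolding \<rho> by blast
  have power: "(\<forall>x. 0 \<le> V x) \<and> V \<in> borel_measurable borel \<and> (\<exists>A B. 0 \<le> B \<and> (\<forall>x. norm x \<le> A + B * V x)) \<and> pcn_drift \<Phi> L \<delta> exp_mom small V"
    if i: "i \<ge> 1" and V: "\<forall>x. V x = norm x ^ i" for i
  proof -
    have Veq: "V = (\<lambda>x. norm x ^ i)" using V by auto
    have "norm x \<le> 1 + 1 * norm x ^ i" for x :: 'a
    proof (cases "norm x \<le> 1")
      case False
      then have "norm x ^ 1 \<le> norm x ^ i" using i by (intro power_increasing) auto
      then show ?thesis by simp
    qed (simp add: add_increasing2)
    then have "\<exists>A B. 0 \<le> B \<and> (\<forall>x. norm x \<le> A + B * V x)"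
      unfolding Veq by (intro exI[of _ 1]) auto
    moreover have "pcn_drift \<Phi> L \<delta> exp_mom small V"
      unfolding Veq by (rule pcn_drift_power[where \<Phi>=\<Phi> and small=small and rad=rad and R=R and mom=exp_mom, OF ctx rads i mom0])
    ultimately show ?thesis unfolding Veq by auto
  qed
  have Vprops: "(\<forall>x. 0 \<le> V x) \<and> V \<in> borel_measurable borel \<and> (\<exists>A B. 0 \<le> B \<and> (\<forall>x. norm x \<le> A + B * V x)) \<and> pcn_drift \<Phi> L \<delta> exp_mom small V"
    using alt
  proof (elim disjE exE conjE)
    fix r b v :: real
    assume r: "0 < r" "1/2 < b" "\<forall>x::'a. rad (norm x) = r * norm x powr b" and v: "0 < v" "\<forall>x. V x = exp (v * norm x)"
    have Veq: "V = (\<lambda>x. exp (v * norm x))" using v by auto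
    have "rad t = r * t powr b" if "0 \<le> t" for t using all_norms[OF that] r by auto
    then have top: "filterlim rad at_top at_top"
      using r by (intro filterlim_mult_powr_at_top[of r b]) auto
    have "norm x \<le> 0 + (1 / v) * exp (v * norm x)" for x :: 'a
    proof -
      have "v * norm x \<le> exp (v * norm x)" using exp_ge_add_one_self[of "v * norm x"] by linarith
      then show ?thesis using v(1) by (simp add: field_simps)
    qed
    then have "\<exists>A B. 0 \<le> B \<and> (\<forall>x. norm x \<le> A + B * V x)"
      unfolding Veq using v(1) by (intro exI[of _ 0] exI[of _ "1 / v"]) auto
    moreover have "pcn_drift \<Phi> L \<delta> exp_mom small V"
      unfolding Veq by (rule pcn_drift_exp[where \<Phi>=\<Phi> and small=small and rad=rad and R=R and mom=exp_mom, OF ctx rads top v(1) mom0])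
    ultimately show ?thesis unfolding Veq by auto
  qed (rule power; assumption)+
  then have V0: "\<And>x. 0 \<le> V x" and Vm: "V \<in> borel_measurable borel" by auto
  obtain A B where AB: "0 \<le> B" "\<And>x. norm x \<le> A + B * V x" using Vprops by blast
  have lyap: "pcn_drift \<Phi> L \<delta> exp_mom small V" using Vprops by blast
  have "\<exists>\<eta> \<beta> \<kappa>. 0 < \<eta> \<and> 0 < \<beta> \<and> \<beta> \<le> 1 \<and> 0 \<le> \<kappa> \<and> \<kappa> < 1 \<and> (\<forall>S g. pcn S g \<Phi> L \<delta> exp_mom small \<longrightarrow> (\<forall>x\<in>S. \<forall>y\<in>S.
        (\<integral>\<^sup>+w. ennreal (harris_cost \<eta> \<beta> V (pcn_step \<delta> \<Phi> x w) (pcn_step \<delta> \<Phi> y w)) \<partial>(g \<Otimes>\<^sub>M unif))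
            \<le> ennreal \<kappa> * ennreal (harris_cost \<eta> \<beta> V x y)))"
    by (rule exists_cost_contraction[where \<Phi>=\<Phi> and small=small and mom=exp_mom and V=V and A=A and B=B, OF \<delta> L0 s(1) a acc q_def q0 V0 Vm AB lyap])
  then obtain \<eta> \<beta> \<kappa> where \<eta>: "0 < \<eta>" and \<beta>: "0 < \<beta>" "\<beta> \<le> 1" and \<kappa>: "0 \<le> \<kappa>" "\<kappa> < 1"
    and all: "\<forall>S g. pcn S g \<Phi> L \<delta> exp_mom small \<longrightarrow> (\<forall>x\<in>S. \<forall>y\<in>S.
        (\<integral>\<^sup>+w. ennreal (harris_cost \<eta> \<beta> V (pcn_step \<delta> \<Phi> x w) (pcn_step \<delta> \<Phi> y w)) \<partial>(g \<Otimes>\<^sub>M unif))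
            \<le> ennreal \<kappa> * ennreal (harris_cost \<eta> \<beta> V x y))"
    by (elim exE conjE)
  have contr: "(\<integral>\<^sup>+w. ennreal (harris_cost \<eta> \<beta> V (pcn_step \<delta> \<Phi> x w) (pcn_step \<delta> \<Phi> y w)) \<partial>(g \<Otimes>\<^sub>M unif))
            \<le> ennreal \<kappa> * ennreal (harris_cost \<eta> \<beta> V x y)"
    if "pcn S g \<Phi> L \<delta> exp_mom small" "x \<in> S" "y \<in> S" for S g x y
    using all[rule_format, OF that] .
  have full: "pcn UNIV \<gamma> \<Phi> L \<delta> exp_mom small" unfolding small_def by (rule pcn_gaussian[OF lip \<delta>])
  have head: "pcn (head_span e m) (gaussian_head lam e m) \<Phi> L \<delta> exp_mom small" for m
    unfolding small_def by (rule pcn_gaussian_head[OF lip \<delta>])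
  have bU: "restrict_space borel UNIV = (borel :: 'a measure)" by (rule measure_eqI) (auto simp: sets_restrict_space emeasure_restrict_space)
  have U1: "unique_invariant borel (pcn_kernel \<delta> \<Phi> \<gamma>) (target \<gamma> \<Phi>)"
    using pcn.unique_invariant_target[OF full V0 Vm \<eta> \<beta> \<kappa> contr[OF full] reversible_gaussian[OF \<delta>]] by (simp add: bU)
  have U2: "unique_invariant (restrict_space borel (head_span e m)) (pcn_kernel \<delta> \<Phi> (gaussian_head lam e m))
      (target (gaussian_head lam e m) (\<lambda>x. \<Phi> (orth_proj (head_span e m) x)))" for m
  proof -
    have sp: "space (gaussian_head lam e m) = head_span e m"
      by (simp add: gaussian_head_def space_restrict_space)
    have eq: "exp (- \<Phi> (orth_proj (head_span e m) x)) = exp (- \<Phi> x)" if "x \<in> space (gaussian_head lam e m)" for x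
      using that by (simp add: sp orth_proj_head_span[OF onb])
    have m: "(\<lambda>x. exp (- \<Phi> x)) \<in> borel_measurable (gaussian_head lam e m)"
      using borel_measurable_integrable[OF pcn.integrable_exp_\<Phi>[OF head]] .
    then have m': "(\<lambda>x. exp (- \<Phi> (orth_proj (head_span e m) x))) \<in> borel_measurable (gaussian_head lam e m)"
      by (subst measurable_cong[OF eq])
    have I: "(\<integral>x. exp (- \<Phi> (orth_proj (head_span e m) x)) \<partial>gaussian_head lam e m) = (\<integral>x. exp (- \<Phi> x) \<partial>gaussian_head lam e m)"
      by (rule Bochner_Integration.integral_cong[OF refl eq])
    have "target (gaussian_head lam e m) (\<lambda>x. \<Phi> (orth_proj (head_span e m) x)) = target (gaussian_head lam e m) \<Phi>"
      unfolding target_def I using m m' by (intro density_cong) (auto simp: eq)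
    then show ?thesis
      using pcn.unique_invariant_target[OF head V0 Vm \<eta> \<beta> \<kappa> contr[OF head] reversible_gaussian_head[OF \<delta>]] by simp
  qed
  have T: "\<exists>n\<ge>1. \<forall>S g. pcn S g \<Phi> L \<delta> exp_mom small \<longrightarrow> (\<forall>\<nu>1\<in>space (prob_algebra (restrict_space borel S)).
      \<forall>\<nu>2\<in>space (prob_algebra (restrict_space borel S)).
        transport_dist (weighted_dist \<epsilon> V) (kernel_steps (pcn_kernel \<delta> \<Phi> g) n \<nu>1) (kernel_steps (pcn_kernel \<delta> \<Phi> g) n \<nu>2)
          \<le> 1/2 * transport_dist (weighted_dist \<epsilon> V) \<nu>1 \<nu>2)"
    if \<epsilon>: "0 < \<epsilon>" for \<epsilon>
  proof -
    let ?A = "sqrt (2 * max 1 (\<eta> / \<epsilon>) / \<beta>)" and ?B = "sqrt (max 1 (\<epsilon> / \<eta>))"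
    have "(\<lambda>n. 2 * (?A * \<kappa> ^ n * ?B)) \<longlonglongrightarrow> 2 * (?A * 0 * ?B)"
      by (intro tendsto_intros LIMSEQ_realpow_zero \<kappa>)
    then have "\<forall>\<^sub>F n in sequentially. 2 * (?A * \<kappa> ^ n * ?B) < 1"
      by (rule order_tendstoD(2)) simp
    then obtain n0 where n0: "\<And>n. n0 \<le> n \<Longrightarrow> 2 * (?A * \<kappa> ^ n * ?B) < 1" by (auto simp: eventually_sequentially)
    define n where "n = max 1 n0"
    have n: "n \<ge> 1" "2 * (?A * \<kappa> ^ n * ?B) \<le> 1" using n0[of n] by (auto simp: n_def)
    show ?thesis
    proof (intro exI[of _ n] conjI n(1) allI impI ballI)
      fix S g \<nu>1 \<nu>2
      assume p: "pcn S g \<Phi> L \<delta> exp_mom small" and \<nu>: "\<nu>1 \<in> space (prob_algebra (restrict_space borel S))" "\<nu>2 \<in> space (prob_algebra (restrict_space borel S))"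
      show "transport_dist (weighted_dist \<epsilon> V) (kernel_steps (pcn_kernel \<delta> \<Phi> g) n \<nu>1) (kernel_steps (pcn_kernel \<delta> \<Phi> g) n \<nu>2)
          \<le> 1/2 * transport_dist (weighted_dist \<epsilon> V) \<nu>1 \<nu>2"
        by (rule pcn.transport_contraction[OF p V0 Vm \<eta> \<beta> \<kappa> contr[OF p] \<epsilon> n(2) \<nu>])
    qed
  qed
  show ?thesis
    unfolding Let_def
  proof (intro conjI)
    show "unique_invariant borel (pcn_kernel \<delta> \<Phi> \<gamma>) (target \<gamma> \<Phi>)" by (rule U1)
    show "\<forall>m\<ge>1. unique_invariant (restrict_space borel (head_span e m)) (pcn_kernel \<delta> \<Phi> (gaussian_head lam e m))
      (target (gaussian_head lam e m) (\<lambda>x. \<Phi> (orth_proj (head_span e m) x)))" using U2 by blast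
  \<comment> \<open>The number of steps that serves for all chains of the locale is used with \<open>S = UNIV\<close> and with the finite-dimensional \<open>S\<close>.\<close>
  qed (rule eventually_mono[OF eventually_at_right_less[of "0::real"]], drule T, elim exE conjE, intro exI conjI,
      assumption, use full bU in \<open>metis (no_types)\<close>, use head in blast)
qed

end
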